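(* If $\mathcal{H}$ is a string hypergraph, then $$\operatorname{pd}(\mathcal{H})=\mu(\mathcal{H})-b(\mathcal{H})+M(\mathcal{H}).$$
   Context: Fix a field $k$. A hypergraph on $V=[\mu]=\{1,\dots,\mu\}$ is a set $\mathcal{H}$ of nonempty subsets of $V$ (called faces) whose union is $V$. It is separated if for all $1\le j_1<j_2\le\mu$ there are faces $F_1,F_2\in\mathcal{H}$ with $j_1\in F_1\setminus F_2$ and $j_2\in F_2\setminus F_1$. All hypergraphs are assumed separated. If $I$ is a square-free monomial ideal in a polynomial ring $R$ over $k$ with minimal monomial generators $m_1,\dots,m_\mu$, its associated hypergraph is the one on $[\mu]$ whose faces are the nonempty sets $F=\{j : a\mid m_j\}$, as $a$ runs over the variables of $R$. The projective dimension $\operatorname{pd}(\mathcal{H})$ is $\operatorname{pd}_R(R/I)$ for any square-free monomial ideal $I$ with associated hypergraph $\mathcal{H}$ (this does not depend on $I$). For instance one may take $R=k[x_F : F\in\mathcal{H}]$ and $I=(m_1,\dots,m_\mu)$ with $m_i=\prod_{F\ni i}x_F$. A vertex $v$ is closed if $\{v\}\in\mathcal{H}$, and open otherwise. A string hypergraph on $[\mu]$ is a (separated) hypergraph whose faces are exactly $\{i,i+1\}$ for $i=1,\dots,\mu-1$, together with some singletons; separatedness forces $\{1\},\{\mu\}\in\mathcal{H}$. The vertices $1,\mu$ are its endpoints. A string of opens in $\mathcal{H}$ is a maximal run of $n\ge1$ consecutive open vertices together with the two closed vertices bounding it; $n$ is its number of open vertices. Let $\mu(\mathcal{H})$ be the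 number of vertices, $s=s(\mathcal{H})$ the number of strings of opens in $\mathcal{H}$, and $n_1,\dots,n_s$ their numbers of open vertices. Put $$b(\mathcal{H})=s(\mathcal{H})+\sum_{i=1}^{s}\left\lfloor\frac{n_i-1}{3}\right\rfloor .$$ A 2-special configuration contained in $\mathcal{H}$ is a sequence of $t\ge2$ successive strings of opens of $\mathcal{H}$, each two successive ones sharing a bounding closed vertex (so that no two adjacent closed vertices occur in it), such that the first and the last have a number of open vertices congruent to $1$ modulo $3$, and all the others (if any) have a number of open vertices congruent to $2$ modulo $3$. Two 2-special configurations are disjoint if they have no open vertex in common (they may share a closed vertex). The modularity $M(\mathcal{H})$ is the maximal number of pairwise disjoint 2-special configurations contained in $\mathcal{H}$. *)

theory Defs
  imports
    "HOL-Library.Poly_Mapping"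
    "HOL-Library.Extended_Nat"
    "HOL-Algebra.Module"
    "HOL-Algebra.QuotRing"
begin

section \<open>Projective dimension\<close>

definition module_hom ::
  "('r, 'x) ring_scheme \<Rightarrow> ('r, 'm, 'y) module_scheme \<Rightarrow> ('r, 'n, 'z) module_scheme \<Rightarrow> ('m \<Rightarrow> 'n) set"
where
  "module_hom R M N = {f \<in> carrier M \<rightarrow> carrier N.
     (\<forall>x\<in>carrier M. \<forall>y\<in>carrier M. f (x \<oplus>\<^bsub>M\<^esub> y) = f x \<oplus>\<^bsub>N\<^esub> f y) \<and>
     (\<forall>r\<in>carrier R. \<forall>x\<in>carrier M. f (r \<odot>\<^bsub>M\<^esub> x) = r \<odot>\<^bsub>N\<^esub> f x)}"

text \<open>
  The free module on a set \<open>B\<close>, as the finitely supported functions. The multiplicative fields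
  of a module record play no role.
\<close>

definition free_module :: "('r, 'x) ring_scheme \<Rightarrow> 'b set \<Rightarrow> ('r, 'b \<Rightarrow> 'r) module" where
  "free_module R B =
     \<lparr>carrier = {f. (\<forall>b\<in>B. f b \<in> carrier R) \<and> (\<forall>b. b \<notin> B \<longrightarrow> f b = \<zero>\<^bsub>R\<^esub>) \<and> finite {b. f b \<noteq> \<zero>\<^bsub>R\<^esub>}},
      mult = undefined, one = undefined,
      zero = (\<lambda>_. \<zero>\<^bsub>R\<^esub>), add = (\<lambda>f g b. f b \<oplus>\<^bsub>R\<^esub> g b),
      smult = (\<lambda>r f b. r \<otimes>\<^bsub>R\<^esub> f b)\<rparr>"

text \<open>
  A projective module is a direct summand (retract) of a free module. It suffices to consider
  bases of the type of the elements of \<open>P\<close>: if \<open>P\<close> is projective, then the canonical map onto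
  \<open>P\<close> from the free module on \<open>carrier P\<close> splits.
\<close>

definition projective_module :: "('r, 'x) ring_scheme \<Rightarrow> ('r, 'p, 'y) module_scheme \<Rightarrow> bool" where
  "projective_module R P \<longleftrightarrow> Module.module R P \<and>
     (\<exists>(B :: 'p set) i q. i \<in> module_hom R P (free_module R B) \<and> q \<in> module_hom R (free_module R B) P \<and>
        (\<forall>x\<in>carrier P. q (i x) = x))"

text \<open>
  A projective resolution
  \<open>\<dots> \<rightarrow> P 2 \<rightarrow> P 1 \<rightarrow> P 0 \<rightarrow> M \<rightarrow> 0\<close>
  with augmentation \<open>e\<close> and differentials \<open>d i\<close> from \<open>P (Suc i)\<close> to \<open>P i\<close>.
\<close>

definition projective_resolution ::
  "('r, 'x) ring_scheme \<Rightarrow> ('r, 'm, 'y) module_scheme \<Rightarrow> (nat \<Rightarrow> ('r, 'p, 'z) module_scheme) \<Rightarrow>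
   (nat \<Rightarrow> 'p \<Rightarrow> 'p) \<Rightarrow> ('p \<Rightarrow> 'm) \<Rightarrow> bool"
where
  "projective_resolution R M P d e \<longleftrightarrow>
     (\<forall>i. projective_module R (P i)) \<and>
     (\<forall>i. d i \<in> module_hom R (P (Suc i)) (P i)) \<and>
     e \<in> module_hom R (P 0) M \<and>
     e ` carrier (P 0) = carrier M \<and>
     {x \<in> carrier (P 0). e x = \<zero>\<^bsub>M\<^esub>} = d 0 ` carrier (P (Suc 0)) \<and>
     (\<forall>i. {x \<in> carrier (P (Suc i)). d i x = \<zero>\<^bsub>P i\<^esub>} = d (Suc i) ` carrier (P (Suc (Suc i))))"

text \<open>
  The infimum of the lengths of the projective resolutions of \<open>M\<close> (\<open>\<infinity>\<close> if there is no finite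
  one). A type for the elements of the resolving modules has to be fixed, and
  \<open>'m \<times> nat \<Rightarrow> 'r\<close> is large enough for every \<open>M\<close>: every module has a resolution by free modules
  on subsets of \<open>'m \<times> nat\<close>, since (unless \<open>R\<close> is trivial) the syzygies have at most as many
  elements as the free module on \<open>'m \<times> nat\<close>; and if some projective resolution has length \<open>n\<close>,
  then the \<open>n\<close>-th syzygy of this free resolution is projective, so that one can truncate there.
\<close>

definition proj_dim :: "('r, 'x) ring_scheme \<Rightarrow> ('r, 'm, 'y) module_scheme \<Rightarrow> enat" where
  "proj_dim R M = Inf {enat n | n.
     \<exists>(P :: nat \<Rightarrow> ('r, 'm \<times> nat \<Rightarrow> 'r) module) d e.
       projective_resolution R M P d e \<and> (\<forall>i>n. carrier (P i) = {\<zero>\<^bsub>P i\<^esub>})}"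

definition quotient_module :: "('r, 'x) ring_scheme \<Rightarrow> 'r set \<Rightarrow> ('r, 'r set) module" where
  "quotient_module R I =
     \<lparr>carrier = carrier (R Quot I), mult = mult (R Quot I), one = one (R Quot I),
      zero = zero (R Quot I), add = add (R Quot I),
      smult = (\<lambda>r C. (I +>\<^bsub>R\<^esub> r) \<otimes>\<^bsub>R Quot I\<^esub> C)\<rparr>"


section \<open>Square-free monomial ideals\<close>

text \<open>
  \<open>'v \<Rightarrow>\<^sub>0 nat\<close> is the type of exponent vectors of monomials, and
  \<open>('v \<Rightarrow>\<^sub>0 nat) \<Rightarrow>\<^sub>0 'k\<close> that of the polynomials in variables indexed by \<open>'v\<close>, with the convolution
  product. The ring below is the polynomial ring in the variables from \<open>X\<close>.
\<close>

definition poly_ring :: "'v set \<Rightarrow> (('v \<Rightarrow>\<^sub>0 nat) \<Rightarrow>\<^sub>0 'k::field) ring" where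
  "poly_ring X =
     \<lparr>carrier = {p. \<forall>t \<in> Poly_Mapping.keys p. Poly_Mapping.keys t \<subseteq> X},
      mult = (*), one = 1, zero = 0, add = (+)\<rparr>"

definition monomial :: "('v \<Rightarrow>\<^sub>0 nat) \<Rightarrow> (('v \<Rightarrow>\<^sub>0 nat) \<Rightarrow>\<^sub>0 'k::field)" where
  "monomial t = Poly_Mapping.single t 1"

definition squarefree_monomial :: "('v \<Rightarrow>\<^sub>0 nat) \<Rightarrow> bool" where
  "squarefree_monomial t \<longleftrightarrow> (\<forall>a. Poly_Mapping.lookup t a \<le> 1)"

definition monomial_divides :: "('v \<Rightarrow>\<^sub>0 nat) \<Rightarrow> ('v \<Rightarrow>\<^sub>0 nat) \<Rightarrow> bool" where
  "monomial_divides s t \<longleftrightarrow> (\<forall>a. Poly_Mapping.lookup s a \<le> Poly_Mapping.lookup t a)"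

text \<open>
  \<open>m 1, \<dots>, m \<mu>\<close> are the minimal monomial generators of \<open>I\<close>, and they are square-free.
\<close>

definition squarefree_minimal_generators ::
  "'v set \<Rightarrow> (('v \<Rightarrow>\<^sub>0 nat) \<Rightarrow>\<^sub>0 'k::field) set \<Rightarrow> nat \<Rightarrow> (nat \<Rightarrow> 'v \<Rightarrow>\<^sub>0 nat) \<Rightarrow> bool"
where
  "squarefree_minimal_generators X I \<mu> m \<longleftrightarrow>
     (\<forall>j\<in>{1..\<mu>}. Poly_Mapping.keys (m j) \<subseteq> X \<and> squarefree_monomial (m j)) \<and>
     (\<forall>i\<in>{1..\<mu>}. \<forall>j\<in>{1..\<mu>}. i \<noteq> j \<longrightarrow> \<not> monomial_divides (m i) (m j)) \<and>
     I = Idl\<^bsub>poly_ring X\<^esub> ((\<lambda>j. monomial (m j)) ` {1..\<mu>})"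

definition associated_hypergraph :: "'v set \<Rightarrow> nat \<Rightarrow> (nat \<Rightarrow> 'v \<Rightarrow>\<^sub>0 nat) \<Rightarrow> nat set set" where
  "associated_hypergraph X \<mu> m =
     {F. F \<noteq> {} \<and> (\<exists>a\<in>X. F = {j\<in>{1..\<mu>}. a \<in> Poly_Mapping.keys (m j)})}"


section \<open>String hypergraphs\<close>

definition hypergraph :: "nat \<Rightarrow> nat set set \<Rightarrow> bool" where
  "hypergraph \<mu> H \<longleftrightarrow> {} \<notin> H \<and> \<Union>H = {1..\<mu>}"

definition separated :: "nat \<Rightarrow> nat set set \<Rightarrow> bool" where
  "separated \<mu> H \<longleftrightarrow> (\<forall>j1 j2. 1 \<le> j1 \<and> j1 < j2 \<and> j2 \<le> \<mu> \<longrightarrow>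
     (\<exists>F1\<in>H. \<exists>F2\<in>H. j1 \<in> F1 - F2 \<and> j2 \<in> F2 - F1))"

definition string_hypergraph :: "nat \<Rightarrow> nat set set \<Rightarrow> bool" where
  "string_hypergraph \<mu> H \<longleftrightarrow> 1 \<le> \<mu> \<and> hypergraph \<mu> H \<and> separated \<mu> H \<and>
     (\<exists>S. H = {{i, i + 1} | i. 1 \<le> i \<and> i < \<mu>} \<union> {{v} | v. v \<in> S})"

definition closed_vertex :: "nat set set \<Rightarrow> nat \<Rightarrow> bool" where
  "closed_vertex H v \<longleftrightarrow> {v} \<in> H"

text \<open>
  A string of opens is encoded by the pair \<open>(a, b)\<close> of its bounding closed vertices; its open
  vertices are those strictly between \<open>a\<close> and \<open>b\<close>.
\<close>

definition strings_of_opens :: "nat set set \<Rightarrow> (nat \<times> nat) set" where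
  "strings_of_opens H = {(a, b). closed_vertex H a \<and> closed_vertex H b \<and> {a<..<b} \<noteq> {} \<and>
     (\<forall>v\<in>{a<..<b}. \<not> closed_vertex H v)}"

definition open_vertices :: "nat \<times> nat \<Rightarrow> nat set" where
  "open_vertices \<sigma> = {fst \<sigma><..<snd \<sigma>}"

definition num_opens :: "nat \<times> nat \<Rightarrow> nat" where
  "num_opens \<sigma> = card (open_vertices \<sigma>)"

definition b_inv :: "nat set set \<Rightarrow> nat" where
  "b_inv H = card (strings_of_opens H) + (\<Sum>\<sigma>\<in>strings_of_opens H. (num_opens \<sigma> - 1) div 3)"

definition two_special :: "nat set set \<Rightarrow> (nat \<times> nat) list \<Rightarrow> bool" where
  "two_special H c \<longleftrightarrow> 2 \<le> length c \<and> set c \<subseteq> strings_of_opens H \<and>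
     (\<forall>i. i + 1 < length c \<longrightarrow> snd (c ! i) = fst (c ! (i + 1))) \<and>
     num_opens (hd c) mod 3 = 1 \<and> num_opens (last c) mod 3 = 1 \<and>
     (\<forall>i. 0 < i \<and> i + 1 < length c \<longrightarrow> num_opens (c ! i) mod 3 = 2)"

definition disjoint_configurations :: "(nat \<times> nat) list \<Rightarrow> (nat \<times> nat) list \<Rightarrow> bool" where
  "disjoint_configurations c c' \<longleftrightarrow>
     (\<Union>\<sigma>\<in>set c. open_vertices \<sigma>) \<inter> (\<Union>\<sigma>\<in>set c'. open_vertices \<sigma>) = {}"

definition modularity :: "nat set set \<Rightarrow> nat" where
  "modularity H = Max {card C | C. C \<subseteq> {c. two_special H c} \<and> pairwise disjoint_configurations C}"


section \<open>Well-definedness\<close>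

lemma poly_ring_cring: "cring (poly_ring X :: (('v \<Rightarrow>\<^sub>0 nat) \<Rightarrow>\<^sub>0 'k::field) ring)"
proof -
  let ?C = "{p :: ('v \<Rightarrow>\<^sub>0 nat) \<Rightarrow>\<^sub>0 'k. \<forall>t \<in> Poly_Mapping.keys p. Poly_Mapping.keys t \<subseteq> X}"
  have add: "p + q \<in> ?C" if "p \<in> ?C" "q \<in> ?C" for p q
    using that Poly_Mapping.keys_add[of p q] by blast
  have uminus: "- p \<in> ?C" if "p \<in> ?C" for p
    using that by simp
  have mult: "p * q \<in> ?C" if p: "p \<in> ?C" and q: "q \<in> ?C" for p q
  proof safe
    fix t a assume t: "t \<in> Poly_Mapping.keys (p * q)" and a: "a \<in> Poly_Mapping.keys t"
    obtain u v where "t = u + v" "u \<in> Poly_Mapping.keys p" "v \<in> Poly_Mapping.keys q"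
      using keys_mult[of p q] t by blast
    then show "a \<in> X"
      using p q a Poly_Mapping.keys_add[of u v] by blast
  qed
  have one: "1 \<in> ?C" by simp
  let ?P = "poly_ring X :: (('v \<Rightarrow>\<^sub>0 nat) \<Rightarrow>\<^sub>0 'k) ring"
  have sel: "carrier ?P = ?C" "mult ?P = (*)" "one ?P = 1" "zero ?P = 0" "add ?P = (+)"
    by (simp_all add: poly_ring_def)
  show ?thesis
  proof (rule cringI)
    show "abelian_group ?P"
    proof (rule abelian_groupI, unfold sel)
      fix p assume "p \<in> ?C"
      then show "\<exists>q\<in>?C. q + p = 0"
        by (intro bexI[of _ "- p"] uminus) simp
    qed (rule add add.assoc add.commute add_0_left | assumption | simp)+
    show "comm_monoid ?P"
    proof (rule comm_monoidI, unfold sel)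
      show "p * q = q * p" for p q :: "('v \<Rightarrow>\<^sub>0 nat) \<Rightarrow>\<^sub>0 'k" by (rule mult.commute)
      show "p * q * r = p * (q * r)" for p q r :: "('v \<Rightarrow>\<^sub>0 nat) \<Rightarrow>\<^sub>0 'k" by (rule mult.assoc)
    qed (rule mult one mult_1_left | assumption)+
  qed (unfold sel, rule distrib_right)
qed

lemma quotient_module_module:
  assumes "cring R" "ideal I R"
  shows "Module.module R (quotient_module R I)"
proof -
  interpret R: cring R by fact
  interpret I: ideal I R by fact
  interpret Q: cring "R Quot I" by (rule I.quotient_is_cring) fact
  interpret h: ring_hom_ring R "R Quot I" "(+>\<^bsub>R\<^esub>) I" by (rule I.rcos_ring_hom_ring)
  have ag: "abelian_group (quotient_module R I)"
  proof (rule abelian_groupI)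
    fix x assume "x \<in> carrier (quotient_module R I)"
    then show "\<exists>y\<in>carrier (quotient_module R I). y \<oplus>\<^bsub>quotient_module R I\<^esub> x = \<zero>\<^bsub>quotient_module R I\<^esub>"
      using Q.l_neg[of x] Q.a_inv_closed[of x] by (auto simp: quotient_module_def)
  qed (auto simp: quotient_module_def Q.a_ac)
  show ?thesis
    by (rule moduleI[OF \<open>cring R\<close> ag])
       (auto simp: quotient_module_def Q.l_distr Q.r_distr Q.m_assoc)
qed

lemma strings_of_opens_bounds:
  assumes "hypergraph \<mu> H" "(a, b) \<in> strings_of_opens H"
  shows "1 \<le> a" "Suc a < b" "b \<le> \<mu>"
proof -
  have "{a} \<in> H" "{b} \<in> H" "{a<..<b} \<noteq> {}"
    using assms(2) by (auto simp: strings_of_opens_def closed_vertex_def)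
  moreover have "\<Union>H = {1..\<mu>}" using assms(1) by (simp add: hypergraph_def)
  ultimately have "a \<in> {1..\<mu>}" "b \<in> {1..\<mu>}" "{a<..<b} \<noteq> {}" by blast+
  then show "1 \<le> a" "Suc a < b" "b \<le> \<mu>" by auto
qed

lemma finite_strings_of_opens:
  assumes "hypergraph \<mu> H"
  shows "finite (strings_of_opens H)"
proof (rule finite_subset)
  show "strings_of_opens H \<subseteq> {..\<mu>} \<times> {..\<mu>}"
  proof clarify
    fix a b assume "(a, b) \<in> strings_of_opens H"
    from strings_of_opens_bounds[OF assms this] show "a \<in> {..\<mu>} \<and> b \<in> {..\<mu>}" by simp
  qed
qed simp

lemma b_inv_le:
  assumes "hypergraph \<mu> H"
  shows "b_inv H \<le> \<mu>"
proof -
  let ?S = "strings_of_opens H"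
  have fin: "finite ?S" using assms by (rule finite_strings_of_opens)
  have disj: "open_vertices \<sigma> \<inter> open_vertices \<tau> = {}" if "\<sigma> \<in> ?S" "\<tau> \<in> ?S" "\<sigma> \<noteq> \<tau>" for \<sigma> \<tau>
  proof (rule ccontr)
    obtain a b a' b' where [simp]: "\<sigma> = (a, b)" "\<tau> = (a', b')" by fastforce
    assume "\<not> ?thesis"
    then obtain v where "a < v" "v < b" "a' < v" "v < b'" by (auto simp: open_vertices_def)
    then have "\<not> a < a'" "\<not> a' < a" "\<not> b < b'" "\<not> b' < b"
      using that(1,2) by (auto simp: strings_of_opens_def)
    then show False using that(3) by simp
  qed
  have pos: "1 \<le> num_opens \<sigma>" if "\<sigma> \<in> ?S" for \<sigma>
    using that by (auto simp: num_opens_def open_vertices_def strings_of_opens_def Suc_le_eq)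
  have "b_inv H = (\<Sum>\<sigma>\<in>?S. 1 + (num_opens \<sigma> - 1) div 3)"
    unfolding b_inv_def sum.distrib by simp
  also have "\<dots> \<le> (\<Sum>\<sigma>\<in>?S. num_opens \<sigma>)"
  proof (rule sum_mono)
    fix \<sigma> assume "\<sigma> \<in> ?S"
    then show "1 + (num_opens \<sigma> - 1) div 3 \<le> num_opens \<sigma>"
      using pos[of \<sigma>] by simp
  qed
  also have "\<dots> = card (\<Union>\<sigma>\<in>?S. open_vertices \<sigma>)"
    unfolding num_opens_def
    by (rule card_UN_disjoint[symmetric]) (use fin disj in \<open>auto simp: open_vertices_def\<close>)
  also have "\<dots> \<le> card {1..\<mu>}"
  proof (rule card_mono)
    show "(\<Union>\<sigma>\<in>?S. open_vertices \<sigma>) \<subseteq> {1..\<mu>}"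
    proof clarify
      fix a b v assume "(a, b) \<in> ?S" "v \<in> open_vertices (a, b)"
      with strings_of_opens_bounds[OF assms this(1)] show "v \<in> {1..\<mu>}"
        by (simp add: open_vertices_def)
    qed
  qed simp
  finally show ?thesis by simp
qed

lemma finite_two_special:
  assumes "hypergraph \<mu> H"
  shows "finite {c. two_special H c}"
proof (rule finite_subset)
  let ?S = "strings_of_opens H"
  show "finite {c. set c \<subseteq> ?S \<and> length c \<le> \<mu>}"
    by (rule finite_lists_length_le[OF finite_strings_of_opens[OF assms]])
  show "{c. two_special H c} \<subseteq> {c. set c \<subseteq> ?S \<and> length c \<le> \<mu>}"
  proof safe
    fix c assume c: "two_special H c"
    then show "x \<in> ?S" if "x \<in> set c" for x using that by (auto simp: two_special_def)
    have S: "c ! i \<in> ?S" if "i < length c" for i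
      using c that by (auto simp: two_special_def)
    have "i < snd (c ! i)" if "i < length c" for i
      using that
    proof (induction i)
      case 0
      then show ?case
        using strings_of_opens_bounds[OF assms, of "fst (c ! 0)" "snd (c ! 0)"] S[of 0] by simp
    next
      case (Suc i)
      then have "snd (c ! i) = fst (c ! Suc i)" using c by (auto simp: two_special_def)
      then show ?case
        using strings_of_opens_bounds[OF assms, of "fst (c ! Suc i)" "snd (c ! Suc i)"] S[of "Suc i"] Suc
        by simp
    qed
    moreover have "2 \<le> length c" using c by (simp add: two_special_def)
    ultimately show "length c \<le> \<mu>"
      using strings_of_opens_bounds[OF assms, of "fst (c ! (length c - 1))" "snd (c ! (length c - 1))"]
        S[of "length c - 1"]
      by (metis One_nat_def Suc_1 Suc_le_eq Suc_pred diff_less le_trans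
          prod.collapse zero_less_Suc less_le_trans)
  qed
qed

lemma finite_modularity_set:
  assumes "hypergraph \<mu> H"
  shows "finite {card C | C. C \<subseteq> {c. two_special H c} \<and> pairwise disjoint_configurations C}"
  by (rule finite_subset[of _ "card ` Pow {c. two_special H c}"])
     (use finite_two_special[OF assms] in auto)

end

theory Submission
  imports Defs
begin

text \<open>
  The generators \<open>m 1, \<dots>, m \<mu>\<close> of a string are such that only neighbours share variables. Let \<open>p k\<close> be
  the projective dimension of the quotient by the first \<open>k\<close> of them, and \<open>J\<close> the ideal of the first
  \<open>k - 1\<close>. As \<open>m k\<close> has a variable not occurring in \<open>J\<close>, the mapping cone of
  \<open>m k : R/(J : m k) \<rightarrow> R/J\<close> on minimal resolutions is again minimal, so
  \<open>p k = max (p (k - 1)) (1 + pd (R/(J : m k)))\<close>. The colon ideal is a string of length \<open>k - 1\<close> if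
  vertex \<open>k - 1\<close> is closed, and otherwise a string of length \<open>k - 3\<close> together with one coprime
  monomial; so \<open>p k = p (k - 1) + 1\<close> or \<open>p k = max (p (k - 1)) (p (k - 3) + 2)\<close>. The length of a minimal
  resolution is the projective dimension, because by comparison with a shorter projective resolution
  the last differential of the minimal one would have a retraction. Following the recursion along a
  string of \<open>n\<close> opens, \<open>k - p k\<close> grows by \<open>1 + (n - 1) div 3\<close>, except that it grows by one less if
  \<open>n\<close> is 1 modulo 3 and the string completes a 2-special configuration in a greedy choice of
  disjoint configurations from left to right.
\<close>


section \<open>Modules and comparison of resolutions\<close>

text \<open>The recursion for p looks three generators back, so at a closed vertex a the value p a
  alone does not determine what follows: p (a - 1) enters as well. The defect d = p (a - 1) + 1 - p
  a is always 0 or 1, and the count rests on its combinatorial meaning: d = 1 exactly if some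
  largest packing of configurations up to a leaves room for a chain, that is, a configuration still
  lacking its last string, that ends at a. Let N be the size of a largest packing up to a. The next
  string sends (N, d) to (N + d, 1 - d) if its number of opens is 1 modulo 3, fixes it for residue
  2, and sends it to (N, 0) for residue 0; so does a step between two adjacent closed vertices. The
  recursion for p makes the same moves. On the algebraic side, passing to a colon ideal changes the
  last generator of a string, and truncation turns an open vertex into a closed end. The induction
  therefore runs over families of supports \<open>M 1\<close>, ..., \<open>M k\<close> instead of
  hypergraphs, prescribes openness only for the vertices before k, and asks of \<open>M k\<close>
  just a variable outside \<open>M (k - 1)\<close>.\<close>

lemma free_module_sel [simp]:
  "zero (free_module R B) = (\<lambda>_. \<zero>\<^bsub>R\<^esub>)"
  "add (free_module R B) = (\<lambda>f g b. f b \<oplus>\<^bsub>R\<^esub> g b)"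
  "smult (free_module R B) = (\<lambda>r f b. r \<otimes>\<^bsub>R\<^esub> f b)"
  by (simp_all add: free_module_def)

lemma free_module_carrier:
  "f \<in> carrier (free_module R B) \<longleftrightarrow>
     (\<forall>b\<in>B. f b \<in> carrier R) \<and> (\<forall>b. b \<notin> B \<longrightarrow> f b = \<zero>\<^bsub>R\<^esub>) \<and> finite {b. f b \<noteq> \<zero>\<^bsub>R\<^esub>}"
  by (simp add: free_module_def)

lemma free_module_value:
  assumes "ring R" "f \<in> carrier (free_module R B)"
  shows "f b \<in> carrier R"
  using assms by (cases "b \<in> B") (auto simp: free_module_carrier ring.ring_simprules)

definition unit_vector :: "('r, 'x) ring_scheme \<Rightarrow> 'b \<Rightarrow> 'b \<Rightarrow> 'r" where
  "unit_vector R b = (\<lambda>c. if c = b then \<one>\<^bsub>R\<^esub> else \<zero>\<^bsub>R\<^esub>)"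

lemma unit_vector_carrier:
  assumes "ring R" "b \<in> B"
  shows "unit_vector R b \<in> carrier (free_module R B)"
proof -
  interpret ring R by fact
  have "finite {c. unit_vector R b c \<noteq> \<zero>\<^bsub>R\<^esub>}"
    by (rule finite_subset[of _ "{b}"]) (auto simp: unit_vector_def)
  then show ?thesis using assms(2) by (auto simp: free_module_carrier unit_vector_def)
qed

lemma module_free_module:
  assumes "cring R"
  shows "Module.module R (free_module R B)"
proof -
  interpret cring R by fact
  have val: "f b \<in> carrier R" if "f \<in> carrier (free_module R B)" for f b
    using free_module_value[OF ring_axioms that] .
  show ?thesis
  proof (rule moduleI[OF assms])
    show "abelian_group (free_module R B)"
    proof (rule abelian_groupI)
      fix f g assume fg: "f \<in> carrier (free_module R B)" "g \<in> carrier (free_module R B)"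
      have "finite {b. f b \<oplus>\<^bsub>R\<^esub> g b \<noteq> \<zero>\<^bsub>R\<^esub>}"
        by (rule finite_subset[of _ "{b. f b \<noteq> \<zero>\<^bsub>R\<^esub>} \<union> {b. g b \<noteq> \<zero>\<^bsub>R\<^esub>}"])
           (use fg in \<open>auto simp: free_module_carrier\<close>)
      then show "f \<oplus>\<^bsub>free_module R B\<^esub> g \<in> carrier (free_module R B)"
        using fg by (auto simp: free_module_carrier)
    next
      fix f assume f: "f \<in> carrier (free_module R B)"
      have "finite {b. \<ominus>\<^bsub>R\<^esub> f b \<noteq> \<zero>\<^bsub>R\<^esub>}"
        by (rule finite_subset[of _ "{b. f b \<noteq> \<zero>\<^bsub>R\<^esub>}"])
           (use f in \<open>auto simp: free_module_carrier\<close>)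
      then have "(\<lambda>b. \<ominus>\<^bsub>R\<^esub> f b) \<in> carrier (free_module R B)"
        using f by (auto simp: free_module_carrier)
      moreover have "(\<lambda>b. \<ominus>\<^bsub>R\<^esub> f b) \<oplus>\<^bsub>free_module R B\<^esub> f = \<zero>\<^bsub>free_module R B\<^esub>"
        using val[OF f] by (auto simp: l_neg)
      ultimately show "\<exists>g\<in>carrier (free_module R B).
          g \<oplus>\<^bsub>free_module R B\<^esub> f = \<zero>\<^bsub>free_module R B\<^esub>" by blast
    qed (auto simp: val a_ac free_module_carrier)
  next
    fix r f assume rf: "r \<in> carrier R" "f \<in> carrier (free_module R B)"
    have "finite {b. r \<otimes>\<^bsub>R\<^esub> f b \<noteq> \<zero>\<^bsub>R\<^esub>}"
      by (rule finite_subset[of _ "{b. f b \<noteq> \<zero>\<^bsub>R\<^esub>}"])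
         (use rf in \<open>auto simp: free_module_carrier\<close>)
    then show "r \<odot>\<^bsub>free_module R B\<^esub> f \<in> carrier (free_module R B)"
      using rf by (auto simp: free_module_carrier)
  qed (auto simp: val l_distr r_distr m_assoc)
qed

lemma
  assumes "f \<in> module_hom R M N"
  shows module_hom_closed: "x \<in> carrier M \<Longrightarrow> f x \<in> carrier N"
    and module_hom_add:
      "x \<in> carrier M \<Longrightarrow> y \<in> carrier M \<Longrightarrow> f (x \<oplus>\<^bsub>M\<^esub> y) = f x \<oplus>\<^bsub>N\<^esub> f y"
    and module_hom_smult:
      "r \<in> carrier R \<Longrightarrow> x \<in> carrier M \<Longrightarrow> f (r \<odot>\<^bsub>M\<^esub> x) = r \<odot>\<^bsub>N\<^esub> f x"
  using assms by (auto simp: module_hom_def)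

lemma module_hom_zero:
  assumes "Module.module R M" "Module.module R N" "f \<in> module_hom R M N"
  shows "f \<zero>\<^bsub>M\<^esub> = \<zero>\<^bsub>N\<^esub>"
proof -
  interpret M: Module.module R M by fact
  interpret N: Module.module R N by fact
  have "f (\<zero>\<^bsub>R\<^esub> \<odot>\<^bsub>M\<^esub> \<zero>\<^bsub>M\<^esub>) = \<zero>\<^bsub>R\<^esub> \<odot>\<^bsub>N\<^esub> f \<zero>\<^bsub>M\<^esub>"
    by (rule module_hom_smult[OF assms(3)]) auto
  then show ?thesis using module_hom_closed[OF assms(3)] by simp
qed

lemma module_hom_comp:
  assumes "f \<in> module_hom R M N" "g \<in> module_hom R N K"
  shows "(\<lambda>x. g (f x)) \<in> module_hom R M K"
  using assms by (auto simp: module_hom_def Pi_iff)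

lemma module_hom_id: "(\<lambda>x. x) \<in> module_hom R M M"
  by (simp add: module_hom_def)

lemma module_hom_minus:
  assumes "Module.module R M" "Module.module R N" "f \<in> module_hom R M N" "g \<in> module_hom R M N"
  shows "(\<lambda>x. f x \<ominus>\<^bsub>N\<^esub> g x) \<in> module_hom R M N"
proof -
  interpret M: Module.module R M by fact
  interpret N: Module.module R N by fact
  note f = module_hom_closed[OF assms(3)] module_hom_add[OF assms(3)] module_hom_smult[OF assms(3)]
  note g = module_hom_closed[OF assms(4)] module_hom_add[OF assms(4)] module_hom_smult[OF assms(4)]
  show ?thesis
    by (auto simp: module_hom_def f g N.smult_r_distr N.smult_r_minus a_minus_def N.minus_add N.a_ac)
qed

lemma free_module_hom_exists:
  fixes R :: "('r, 'x) ring_scheme" and B :: "'b set"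
  assumes "Module.module R M" "\<And>b. b \<in> B \<Longrightarrow> y b \<in> carrier M"
  obtains f where "f \<in> module_hom R (free_module R B) M" "\<And>b. b \<in> B \<Longrightarrow> f (unit_vector R b) = y b"
proof -
  interpret M: Module.module R M by fact
  interpret F: Module.module R "free_module R B" by (rule module_free_module) (rule M.is_cring)
  define S where "S = (\<lambda>f :: 'b \<Rightarrow> 'r. {b. f b \<noteq> \<zero>\<^bsub>R\<^esub>})"
  define L where "L = (\<lambda>f. \<Oplus>\<^bsub>M\<^esub>b\<in>S f. f b \<odot>\<^bsub>M\<^esub> y b)"
  have SB: "S f \<subseteq> B" "finite (S f)" if "f \<in> carrier (free_module R B)" for f
    using that by (auto simp: S_def free_module_carrier)
  \<comment> \<open>The supports of two vectors and of their sum differ, so the sums defining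
    \<open>L\<close> have to be moved to a common finite index set. It stays inside \<open>B\<close>
    because \<open>y\<close> is known to take values in \<open>M\<close> only there.\<close>
  have Leq: "L f = (\<Oplus>\<^bsub>M\<^esub>b\<in>T. f b \<odot>\<^bsub>M\<^esub> y b)"
    if f: "f \<in> carrier (free_module R B)" and T: "finite T" "S f \<subseteq> T" "T \<subseteq> B" for f T
    unfolding L_def
  proof (rule M.add.finprod_mono_neutral_cong_left[OF T(1,2)])
    show "f b \<odot>\<^bsub>M\<^esub> y b = \<zero>\<^bsub>M\<^esub>" if "b \<in> T - S f" for b
      using that T assms(2) by (auto simp: S_def)
    show "(\<lambda>b. f b \<odot>\<^bsub>M\<^esub> y b) \<in> T \<rightarrow> carrier M"
      using f T assms(2) by (auto simp: free_module_carrier)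
  qed simp
  have "L \<in> module_hom R (free_module R B) M"
    unfolding module_hom_def
  proof (intro CollectI conjI ballI)
    show "L \<in> carrier (free_module R B) \<rightarrow> carrier M"
    proof
      fix f assume f: "f \<in> carrier (free_module R B)"
      show "L f \<in> carrier M" unfolding L_def
        using f SB[OF f] assms(2) by (intro M.M.finsum_closed) (auto simp: free_module_carrier)
    qed
  next
    fix f g assume f: "f \<in> carrier (free_module R B)" and g: "g \<in> carrier (free_module R B)"
    let ?T = "S f \<union> S g"
    have T: "finite ?T" "?T \<subseteq> B" using SB[OF f] SB[OF g] by auto
    have sub: "S (f \<oplus>\<^bsub>free_module R B\<^esub> g) \<subseteq> ?T" by (auto simp: S_def)
    have "L (f \<oplus>\<^bsub>free_module R B\<^esub> g) = (\<Oplus>\<^bsub>M\<^esub>b\<in>?T. (f \<oplus>\<^bsub>free_module R B\<^esub> g) b \<odot>\<^bsub>M\<^esub> y b)"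
      using T sub F.add.m_closed[OF f g] by (intro Leq) auto
    also have "\<dots> = (\<Oplus>\<^bsub>M\<^esub>b\<in>?T. f b \<odot>\<^bsub>M\<^esub> y b \<oplus>\<^bsub>M\<^esub> g b \<odot>\<^bsub>M\<^esub> y b)"
    proof (rule M.M.finsum_cong')
      show "(\<lambda>b. f b \<odot>\<^bsub>M\<^esub> y b \<oplus>\<^bsub>M\<^esub> g b \<odot>\<^bsub>M\<^esub> y b) \<in> ?T \<rightarrow> carrier M"
        using f g T assms(2) by (auto simp: free_module_carrier)
      show "(f \<oplus>\<^bsub>free_module R B\<^esub> g) b \<odot>\<^bsub>M\<^esub> y b = f b \<odot>\<^bsub>M\<^esub> y b \<oplus>\<^bsub>M\<^esub> g b \<odot>\<^bsub>M\<^esub> y b" if "b \<in> ?T" for b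
        using that T assms(2) f g
        by (auto intro!: M.smult_l_distr simp: free_module_carrier)
    qed simp
    also have "\<dots> = (\<Oplus>\<^bsub>M\<^esub>b\<in>?T. f b \<odot>\<^bsub>M\<^esub> y b) \<oplus>\<^bsub>M\<^esub> (\<Oplus>\<^bsub>M\<^esub>b\<in>?T. g b \<odot>\<^bsub>M\<^esub> y b)"
      using T assms(2) f g by (intro M.M.finsum_addf) (auto simp: free_module_carrier)
    also have "\<dots> = L f \<oplus>\<^bsub>M\<^esub> L g"
      using Leq[OF f T(1) _ T(2)] Leq[OF g T(1) _ T(2)] by simp
    finally show "L (f \<oplus>\<^bsub>free_module R B\<^esub> g) = L f \<oplus>\<^bsub>M\<^esub> L g" .
  next
    fix r f assume r: "r \<in> carrier R" and f: "f \<in> carrier (free_module R B)"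
    have sub: "S (r \<odot>\<^bsub>free_module R B\<^esub> f) \<subseteq> S f" using r by (auto simp: S_def)
    have cl: "f b \<in> carrier R" "y b \<in> carrier M" if "b \<in> S f" for b
      using SB[OF f] that f assms(2) by (auto simp: free_module_carrier)
    have "L (r \<odot>\<^bsub>free_module R B\<^esub> f) = (\<Oplus>\<^bsub>M\<^esub>b\<in>S f. (r \<odot>\<^bsub>free_module R B\<^esub> f) b \<odot>\<^bsub>M\<^esub> y b)"
      using SB[OF f] sub F.smult_closed[OF r f] by (intro Leq) auto
    also have "\<dots> = (\<Oplus>\<^bsub>M\<^esub>b\<in>S f. r \<odot>\<^bsub>M\<^esub> (f b \<odot>\<^bsub>M\<^esub> y b))"
      using cl r by (intro M.M.finsum_cong') (auto intro: M.smult_assoc1)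
    also have "\<dots> = r \<odot>\<^bsub>M\<^esub> L f"
      unfolding L_def using SB[OF f] cl r by (intro M.finsum_smult_ldistr[symmetric]) auto
    finally show "L (r \<odot>\<^bsub>free_module R B\<^esub> f) = r \<odot>\<^bsub>M\<^esub> L f" .
  qed
  moreover have "L (unit_vector R b) = y b" if b: "b \<in> B" for b
  proof -
    have "L (unit_vector R b) = (\<Oplus>\<^bsub>M\<^esub>c\<in>{b}. unit_vector R b c \<odot>\<^bsub>M\<^esub> y c)"
      using b by (intro Leq unit_vector_carrier M.R.ring_axioms) (auto simp: S_def unit_vector_def)
    also have "\<dots> = y b"
      using b assms(2) by (simp add: unit_vector_def)
    finally show ?thesis .
  qed
  ultimately show ?thesis by (rule that)
qed

text \<open>One nonzero coordinate is split off at a time. The induction is on the size of the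
  support, so the basis may be infinite.\<close>

lemma free_module_induct [consumes 2, case_names zero add]:
  assumes "cring R" "z \<in> carrier (free_module R B)"
    and "P (\<lambda>_. \<zero>\<^bsub>R\<^esub>)"
    and step: "\<And>z r b. z \<in> carrier (free_module R B) \<Longrightarrow> P z \<Longrightarrow> b \<in> B \<Longrightarrow> r \<in> carrier R \<Longrightarrow>
       P (z \<oplus>\<^bsub>free_module R B\<^esub> (r \<odot>\<^bsub>free_module R B\<^esub> unit_vector R b))"
  shows "P z"
  using assms(2)
proof (induction "card {b. z b \<noteq> \<zero>\<^bsub>R\<^esub>}" arbitrary: z)
  case 0
  then have "{b. z b \<noteq> \<zero>\<^bsub>R\<^esub>} = {}" by (simp add: free_module_carrier)
  then have "z = (\<lambda>_. \<zero>\<^bsub>R\<^esub>)" by auto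
  then show ?case using assms(3) by simp
next
  case (Suc n)
  interpret cring R by fact
  from Suc.hyps(2) obtain b where b: "z b \<noteq> \<zero>\<^bsub>R\<^esub>" by (metis (mono_tags, lifting) Collect_empty_eq card.empty nat.simps(3))
  have bB: "b \<in> B" and zb: "z b \<in> carrier R"
    using b Suc.prems by (auto simp: free_module_carrier)
  let ?z = "z(b := \<zero>\<^bsub>R\<^esub>)"
  have S: "{c. ?z c \<noteq> \<zero>\<^bsub>R\<^esub>} = {c. z c \<noteq> \<zero>\<^bsub>R\<^esub>} - {b}" by auto
  have fin: "finite {c. z c \<noteq> \<zero>\<^bsub>R\<^esub>}" using Suc.prems by (simp add: free_module_carrier)
  have "n = card {c. ?z c \<noteq> \<zero>\<^bsub>R\<^esub>}"
    unfolding S using Suc.hyps(2) b fin by (subst card_Diff_singleton) auto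
  moreover have z': "?z \<in> carrier (free_module R B)"
    using Suc.prems bB fin S by (auto simp: free_module_carrier)
  ultimately have "P ?z" by (rule Suc.hyps(1))
  from step[OF z' this bB zb]
  have "P (?z \<oplus>\<^bsub>free_module R B\<^esub> (z b \<odot>\<^bsub>free_module R B\<^esub> unit_vector R b))" .
  moreover have "?z \<oplus>\<^bsub>free_module R B\<^esub> (z b \<odot>\<^bsub>free_module R B\<^esub> unit_vector R b) = z"
  proof
    fix c
    show "(?z \<oplus>\<^bsub>free_module R B\<^esub> (z b \<odot>\<^bsub>free_module R B\<^esub> unit_vector R b)) c = z c"
      using zb free_module_value[OF ring_axioms Suc.prems, of c] by (auto simp: unit_vector_def)
  qed
  ultimately show ?case by simp
qed

lemma free_module_hom_eqI:
  assumes "Module.module R M" "f \<in> module_hom R (free_module R B) M" "g \<in> module_hom R (free_module R B) M"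
    and "\<And>b. b \<in> B \<Longrightarrow> f (unit_vector R b) = g (unit_vector R b)"
    and "z \<in> carrier (free_module R B)"
  shows "f z = g z"
proof -
  interpret M: Module.module R M by fact
  interpret F: Module.module R "free_module R B" by (rule module_free_module) (rule M.is_cring)
  note f = module_hom_add[OF assms(2)] module_hom_smult[OF assms(2)]
  note g = module_hom_add[OF assms(3)] module_hom_smult[OF assms(3)]
  note u = unit_vector_carrier[OF M.R.ring_axioms]
  from M.is_cring assms(5) show ?thesis
  proof (induction rule: free_module_induct)
    case zero
    show ?case
      using module_hom_zero[OF F.module_axioms assms(1,2)] module_hom_zero[OF F.module_axioms assms(1,3)]
      by simp
  next
    case (add z r b)
    note ub = u[OF \<open>b \<in> B\<close>]
    note rb = F.smult_closed[OF \<open>r \<in> carrier R\<close> ub]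
    show ?case
      by (simp only: f(1)[OF \<open>z \<in> _\<close> rb] g(1)[OF \<open>z \<in> _\<close> rb] f(2)[OF \<open>r \<in> _\<close> ub] g(2)[OF \<open>r \<in> _\<close> ub]
          \<open>f z = g z\<close> assms(4)[OF \<open>b \<in> B\<close>])
  qed
qed

section \<open>Projectivity, chain maps and homotopies\<close>

text \<open>\<open>projective_module\<close> wants a basis consisting of elements of the type of the
  module itself. The free module on \<open>B\<close> is therefore presented as a retract of the free
  module on its own unit vectors.\<close>

lemma projective_free_module:
  fixes R :: "('r, 'x) ring_scheme" and B :: "'b set"
  assumes "cring R" "\<one>\<^bsub>R\<^esub> \<noteq> \<zero>\<^bsub>R\<^esub>"
  shows "projective_module R (free_module R B)"
proof -
  interpret cring R by fact
  let ?F = "free_module R B" and ?u = "unit_vector R :: 'b \<Rightarrow> 'b \<Rightarrow> 'r"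
  let ?G = "free_module R (?u ` B)"
  note F = module_free_module[OF assms(1), of B] and G = module_free_module[OF assms(1), of "?u ` B"]
  obtain i where i: "i \<in> module_hom R ?F ?G" "\<And>b. b \<in> B \<Longrightarrow> i (?u b) = unit_vector R (?u b)"
    by (rule free_module_hom_exists[OF G, of B "\<lambda>b. unit_vector R (?u b)"])
       (auto intro: unit_vector_carrier[OF ring_axioms])
  obtain q where q: "q \<in> module_hom R ?G ?F" "\<And>c. c \<in> ?u ` B \<Longrightarrow> q (unit_vector R c) = c"
    by (rule free_module_hom_exists[OF F, of "?u ` B" "\<lambda>c. c"])
       (auto intro: unit_vector_carrier[OF ring_axioms])
  have "q (i x) = x" if "x \<in> carrier ?F" for x
    using free_module_hom_eqI[OF F module_hom_comp[OF i(1) q(1)] module_hom_id _ that] i(2) q(2)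
    by simp
  with F i(1) q(1) show ?thesis unfolding projective_module_def by (intro conjI exI ballI) auto
qed

text \<open>Preimages are chosen for the images of the basis of the free cover, and the resulting
  map is precomposed with the section \<open>i\<close>. The map \<open>g\<close> need not be onto:
  the uses are lifts along differentials, where only the image is known.\<close>

lemma projective_lift:
  assumes P: "projective_module R P" and "Module.module R M" "Module.module R N"
    and f: "f \<in> module_hom R P N" and g: "g \<in> module_hom R M N"
    and sub: "\<And>x. x \<in> carrier P \<Longrightarrow> f x \<in> g ` carrier M"
  shows "\<exists>h\<in>module_hom R P M. \<forall>x\<in>carrier P. g (h x) = f x"
proof -
  interpret M: Module.module R M by fact
  from P obtain B :: "'c set" and i q where
    i: "i \<in> module_hom R P (free_module R B)" and q: "q \<in> module_hom R (free_module R B) P"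
    and qi: "\<And>x. x \<in> carrier P \<Longrightarrow> q (i x) = x"
    unfolding projective_module_def by blast
  note u = unit_vector_carrier[OF M.R.ring_axioms]
  have "\<exists>m\<in>carrier M. g m = f (q (unit_vector R b))" if "b \<in> B" for b
    using sub[OF module_hom_closed[OF q u[OF that]]] by (metis imageE)
  then obtain y where y: "\<And>b. b \<in> B \<Longrightarrow> y b \<in> carrier M" "\<And>b. b \<in> B \<Longrightarrow> g (y b) = f (q (unit_vector R b))"
    by metis
  obtain l where l: "l \<in> module_hom R (free_module R B) M" "\<And>b. b \<in> B \<Longrightarrow> l (unit_vector R b) = y b"
    by (rule free_module_hom_exists[OF assms(2), of B y]) (use y(1) in blast)+
  have "g (l z) = f (q z)" if "z \<in> carrier (free_module R B)" for z
    using free_module_hom_eqI[OF assms(3) module_hom_comp[OF l(1) g] module_hom_comp[OF q f] _ that]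
    by (simp add: l(2) y(2))
  then have "g (l (i x)) = f x" if "x \<in> carrier P" for x
    using that qi module_hom_closed[OF i] by simp
  then show ?thesis by (intro bexI[OF _ module_hom_comp[OF i l(1)]]) simp
qed

text \<open>No augmentation is mentioned: it is enough that \<open>f0\<close> sends boundaries to
  boundaries. This serves both for comparing two resolutions of one module and for lifting a
  multiplication between resolutions of different quotients.\<close>

lemma chain_map_exists:
  fixes P :: "nat \<Rightarrow> ('r, 'p, 'y) module_scheme" and Q :: "nat \<Rightarrow> ('r, 'q, 'z) module_scheme"
  assumes proj: "\<And>i. projective_module R (P i)" and Q: "\<And>i. Module.module R (Q i)"
    and dP: "\<And>i. dP i \<in> module_hom R (P (Suc i)) (P i)"
    and dQ: "\<And>i. dQ i \<in> module_hom R (Q (Suc i)) (Q i)"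
    and complex: "\<And>i x. x \<in> carrier (P (Suc (Suc i))) \<Longrightarrow> dP i (dP (Suc i) x) = \<zero>\<^bsub>P i\<^esub>"
    and exact: "\<And>i. {x \<in> carrier (Q (Suc i)). dQ i x = \<zero>\<^bsub>Q i\<^esub>} = dQ (Suc i) ` carrier (Q (Suc (Suc i)))"
    and f0: "f0 \<in> module_hom R (P 0) (Q 0)"
    and f0_im: "\<And>x. x \<in> carrier (P (Suc 0)) \<Longrightarrow> f0 (dP 0 x) \<in> dQ 0 ` carrier (Q (Suc 0))"
  obtains f where "f 0 = f0" "\<And>i. f i \<in> module_hom R (P i) (Q i)"
    "\<And>i x. x \<in> carrier (P (Suc i)) \<Longrightarrow> dQ i (f (Suc i) x) = f i (dP i x)"
proof -
  have P: "Module.module R (P i)" for i using proj by (simp add: projective_module_def)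
  have "\<exists>f. \<forall>n. (f n \<in> module_hom R (P n) (Q n) \<and> (n = 0 \<longrightarrow> f n = f0) \<and>
        (\<forall>x\<in>carrier (P (Suc n)). f n (dP n x) \<in> dQ n ` carrier (Q (Suc n)))) \<and>
      (\<forall>x\<in>carrier (P (Suc n)). dQ n (f (Suc n) x) = f n (dP n x))"
  proof (rule dependent_nat_choice)
    show "\<exists>f. f \<in> module_hom R (P 0) (Q 0) \<and> (0 = (0::nat) \<longrightarrow> f = f0) \<and>
        (\<forall>x\<in>carrier (P (Suc 0)). f (dP 0 x) \<in> dQ 0 ` carrier (Q (Suc 0)))"
      using f0 f0_im by blast
  next
    fix f n
    assume "f \<in> module_hom R (P n) (Q n) \<and> (n = 0 \<longrightarrow> f = f0) \<and>
        (\<forall>x\<in>carrier (P (Suc n)). f (dP n x) \<in> dQ n ` carrier (Q (Suc n)))"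
    then have f: "f \<in> module_hom R (P n) (Q n)"
      and im: "\<And>x. x \<in> carrier (P (Suc n)) \<Longrightarrow> f (dP n x) \<in> dQ n ` carrier (Q (Suc n))" by auto
    obtain g where g: "g \<in> module_hom R (P (Suc n)) (Q (Suc n))"
      "\<And>x. x \<in> carrier (P (Suc n)) \<Longrightarrow> dQ n (g x) = f (dP n x)"
      using projective_lift[OF proj Q Q module_hom_comp[OF dP f] dQ im] by auto
    have "g (dP (Suc n) x) \<in> dQ (Suc n) ` carrier (Q (Suc (Suc n)))"
      if x: "x \<in> carrier (P (Suc (Suc n)))" for x
    proof -
      have "dQ n (g (dP (Suc n) x)) = \<zero>\<^bsub>Q n\<^esub>"
        using g(2)[OF module_hom_closed[OF dP x]] complex[OF x] module_hom_zero[OF P Q f] by simp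
      then show ?thesis
        unfolding exact[symmetric]
        using module_hom_closed[OF g(1) module_hom_closed[OF dP x]] by simp
    qed
    with g show "\<exists>g. (g \<in> module_hom R (P (Suc n)) (Q (Suc n)) \<and> (Suc n = 0 \<longrightarrow> g = f0) \<and>
        (\<forall>x\<in>carrier (P (Suc (Suc n))). g (dP (Suc n) x) \<in> dQ (Suc n) ` carrier (Q (Suc (Suc n))))) \<and>
        (\<forall>x\<in>carrier (P (Suc n)). dQ n (g x) = f (dP n x))"
      by auto
  qed
  then obtain f where f: "\<And>n. f n \<in> module_hom R (P n) (Q n)" "f 0 = f0"
    "\<And>n x. x \<in> carrier (P (Suc n)) \<Longrightarrow> dQ n (f (Suc n) x) = f n (dP n x)" by blast
  show ?thesis by (rule that[of f]) (use f in auto)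
qed

text \<open>The choice of \<open>h n\<close> carries the invariant that d h = p on the boundaries in
  degree n. By it p - h d takes values in the cycles one degree higher, so it lifts along the next
  differential, and the lift is the next homotopy.\<close>

lemma null_homotopy_exists:
  fixes F :: "nat \<Rightarrow> ('r, 'p, 'y) module_scheme"
  assumes proj: "\<And>i. projective_module R (F i)"
    and d: "\<And>i. d i \<in> module_hom R (F (Suc i)) (F i)"
    and exact: "\<And>i. {x \<in> carrier (F (Suc i)). d i x = \<zero>\<^bsub>F i\<^esub>} = d (Suc i) ` carrier (F (Suc (Suc i)))"
    and p: "\<And>i. p i \<in> module_hom R (F i) (F i)"
    and chain: "\<And>i x. x \<in> carrier (F (Suc i)) \<Longrightarrow> d i (p (Suc i) x) = p i (d i x)"
    and p0: "\<And>x. x \<in> carrier (F 0) \<Longrightarrow> p 0 x \<in> d 0 ` carrier (F (Suc 0))"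
  obtains h where "\<And>i. h i \<in> module_hom R (F i) (F (Suc i))"
    "\<And>i x. x \<in> carrier (F (Suc i)) \<Longrightarrow> p (Suc i) x = d (Suc i) (h (Suc i) x) \<oplus>\<^bsub>F (Suc i)\<^esub> h i (d i x)"
proof -
  have F: "Module.module R (F i)" for i using proj by (simp add: projective_module_def)
  have dd: "d i (d (Suc i) x) = \<zero>\<^bsub>F i\<^esub>" if "x \<in> carrier (F (Suc (Suc i)))" for i x
    using exact[of i] that by blast
  have "\<exists>h. \<forall>n. (h n \<in> module_hom R (F n) (F (Suc n)) \<and>
        (\<forall>x\<in>carrier (F (Suc n)). d n (h n (d n x)) = p n (d n x))) \<and>
      (\<forall>x\<in>carrier (F (Suc n)). p (Suc n) x = d (Suc n) (h (Suc n) x) \<oplus>\<^bsub>F (Suc n)\<^esub> h n (d n x))"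
  proof (rule dependent_nat_choice)
    show "\<exists>h. h \<in> module_hom R (F 0) (F (Suc 0)) \<and>
        (\<forall>x\<in>carrier (F (Suc 0)). d 0 (h (d 0 x)) = p 0 (d 0 x))"
      using projective_lift[OF proj F F p d p0] module_hom_closed[OF d] by metis
  next
    fix h n
    assume "h \<in> module_hom R (F n) (F (Suc n)) \<and>
        (\<forall>x\<in>carrier (F (Suc n)). d n (h (d n x)) = p n (d n x))"
    then have h: "h \<in> module_hom R (F n) (F (Suc n))"
      and dh: "\<And>x. x \<in> carrier (F (Suc n)) \<Longrightarrow> d n (h (d n x)) = p n (d n x)" by auto
    interpret F0: Module.module R "F n" by (rule F)
    interpret F1: Module.module R "F (Suc n)" by (rule F)
    \<comment> \<open>Applying d gives d p - d h d = p d - p d = 0, by the chain map property and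
      the invariant.\<close>
    let ?q = "\<lambda>x. p (Suc n) x \<ominus>\<^bsub>F (Suc n)\<^esub> h (d n x)"
    have q: "?q \<in> module_hom R (F (Suc n)) (F (Suc n))"
      by (rule module_hom_minus[OF F F p module_hom_comp[OF d h]])
    note cl = module_hom_closed[OF p] module_hom_closed[OF d] module_hom_closed[OF h]
    have "?q x \<in> d (Suc n) ` carrier (F (Suc (Suc n)))" if x: "x \<in> carrier (F (Suc n))" for x
    proof -
      have "h (d n x) \<in> carrier (F (Suc n))" using cl x by blast
      then have "d n (?q x \<oplus>\<^bsub>F (Suc n)\<^esub> h (d n x)) = d n (?q x) \<oplus>\<^bsub>F n\<^esub> d n (h (d n x))"
        by (rule module_hom_add[OF d module_hom_closed[OF q x]])
      moreover have "?q x \<oplus>\<^bsub>F (Suc n)\<^esub> h (d n x) = p (Suc n) x"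
        using cl x by (simp add: a_minus_def F1.a_assoc F1.l_neg)
      ultimately have "p n (d n x) = d n (?q x) \<oplus>\<^bsub>F n\<^esub> p n (d n x)"
        using chain[OF x] dh[OF x] by simp
      then have "d n (?q x) = \<zero>\<^bsub>F n\<^esub>"
        using module_hom_closed[OF d module_hom_closed[OF q x]] module_hom_closed[OF p module_hom_closed[OF d x]]
        by (metis F0.M.add.r_cancel_one')
      then show ?thesis
        unfolding exact[symmetric] using module_hom_closed[OF q x] by simp
    qed
    then obtain k where k: "k \<in> module_hom R (F (Suc n)) (F (Suc (Suc n)))"
      "\<And>x. x \<in> carrier (F (Suc n)) \<Longrightarrow> d (Suc n) (k x) = ?q x"
      using projective_lift[OF proj F F q d] by blast
    have pk: "p (Suc n) x = d (Suc n) (k x) \<oplus>\<^bsub>F (Suc n)\<^esub> h (d n x)" if x: "x \<in> carrier (F (Suc n))" for x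
      using k(2)[OF x] cl x by (simp add: a_minus_def F1.a_assoc F1.l_neg)
    have "d (Suc n) (k (d (Suc n) x)) = p (Suc n) (d (Suc n) x)"
      if x: "x \<in> carrier (F (Suc (Suc n)))" for x
      using pk[OF module_hom_closed[OF d x]] dd[OF x] module_hom_zero[OF F F h]
        module_hom_closed[OF d module_hom_closed[OF k(1) module_hom_closed[OF d x]]] by simp
    with k(1) pk show "\<exists>k. (k \<in> module_hom R (F (Suc n)) (F (Suc (Suc n))) \<and>
        (\<forall>x\<in>carrier (F (Suc (Suc n))). d (Suc n) (k (d (Suc n) x)) = p (Suc n) (d (Suc n) x))) \<and>
      (\<forall>x\<in>carrier (F (Suc n)). p (Suc n) x = d (Suc n) (k x) \<oplus>\<^bsub>F (Suc n)\<^esub> h (d n x))"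
      by blast
  qed
  then obtain h where h: "\<And>n. h n \<in> module_hom R (F n) (F (Suc n))"
    "\<And>n x. x \<in> carrier (F (Suc n)) \<Longrightarrow> p (Suc n) x = d (Suc n) (h (Suc n) x) \<oplus>\<^bsub>F (Suc n)\<^esub> h n (d n x)"
    by blast
  show ?thesis by (rule that[of h]) (use h in auto)
qed

lemma
  assumes "projective_resolution R M P d e"
  shows projective_resolution_projective: "projective_module R (P i)"
    and projective_resolution_module: "Module.module R (P i)"
    and projective_resolution_hom: "d i \<in> module_hom R (P (Suc i)) (P i)"
    and projective_resolution_augmentation: "e \<in> module_hom R (P 0) M"
    and projective_resolution_surj: "e ` carrier (P 0) = carrier M"
    and projective_resolution_exact0: "{x \<in> carrier (P 0). e x = \<zero>\<^bsub>M\<^esub>} = d 0 ` carrier (P (Suc 0))"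
    and projective_resolution_exact:
      "{x \<in> carrier (P (Suc i)). d i x = \<zero>\<^bsub>P i\<^esub>} = d (Suc i) ` carrier (P (Suc (Suc i)))"
  using assms by (auto simp: projective_resolution_def projective_module_def)

lemma projective_resolution_chain_map:
  assumes "Module.module R M" and P: "projective_resolution R M P dP eP"
    and Q: "projective_resolution R M Q dQ eQ"
  obtains f where "\<And>i. f i \<in> module_hom R (P i) (Q i)"
    "\<And>x. x \<in> carrier (P 0) \<Longrightarrow> eQ (f 0 x) = eP x"
    "\<And>i x. x \<in> carrier (P (Suc i)) \<Longrightarrow> dQ i (f (Suc i) x) = f i (dP i x)"
proof -
  note p = projective_resolution_projective[OF P] projective_resolution_module[OF Q]
    projective_resolution_hom[OF P] projective_resolution_hom[OF Q]
  have "eP x \<in> eQ ` carrier (Q 0)" if "x \<in> carrier (P 0)" for x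
    using module_hom_closed[OF projective_resolution_augmentation[OF P] that]
    by (simp add: projective_resolution_surj[OF Q])
  then obtain f0 where f0: "f0 \<in> module_hom R (P 0) (Q 0)"
    "\<And>x. x \<in> carrier (P 0) \<Longrightarrow> eQ (f0 x) = eP x"
    using projective_lift[OF p(1) p(2) assms(1) projective_resolution_augmentation[OF P]
        projective_resolution_augmentation[OF Q]] by blast
  have im: "f0 (dP 0 x) \<in> dQ 0 ` carrier (Q (Suc 0))" if x: "x \<in> carrier (P (Suc 0))" for x
  proof -
    have "eP (dP 0 x) = \<zero>\<^bsub>M\<^esub>" using projective_resolution_exact0[OF P] x by blast
    then show ?thesis
      unfolding projective_resolution_exact0[OF Q, symmetric]
      using f0 module_hom_closed[OF f0(1)] module_hom_closed[OF p(3) x] by simp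
  qed
  have dd: "dP i (dP (Suc i) x) = \<zero>\<^bsub>P i\<^esub>" if "x \<in> carrier (P (Suc (Suc i)))" for i x
    using projective_resolution_exact[OF P, of i] that by blast
  obtain f where f: "f 0 = f0" "\<And>i. f i \<in> module_hom R (P i) (Q i)"
    "\<And>i x. x \<in> carrier (P (Suc i)) \<Longrightarrow> dQ i (f (Suc i) x) = f i (dP i x)"
    using chain_map_exists[OF p dd projective_resolution_exact[OF Q] f0(1) im] by blast
  show ?thesis by (rule that[of f]) (use f f0(2) in auto)
qed

lemma module_hom_diff:
  assumes "Module.module R M" "Module.module R N" "f \<in> module_hom R M N" "x \<in> carrier M" "y \<in> carrier M"
  shows "f (x \<ominus>\<^bsub>M\<^esub> y) = f x \<ominus>\<^bsub>N\<^esub> f y"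
proof -
  interpret M: Module.module R M by fact
  interpret N: Module.module R N by fact
  have "f (x \<ominus>\<^bsub>M\<^esub> y) \<oplus>\<^bsub>N\<^esub> f y = f (x \<ominus>\<^bsub>M\<^esub> y \<oplus>\<^bsub>M\<^esub> y)"
    using module_hom_add[OF assms(3), of "x \<ominus>\<^bsub>M\<^esub> y" y] assms by simp
  also have "x \<ominus>\<^bsub>M\<^esub> y \<oplus>\<^bsub>M\<^esub> y = x" using assms by (simp add: a_minus_def M.a_assoc M.l_neg)
  finally show ?thesis
    using assms(4,5) module_hom_closed[OF assms(3)] by (metis N.minus_eq N.add.inv_solve_right M.minus_closed)
qed

text \<open>The composite of F to P to F covers the identity of M, so its difference from the
  identity is null homotopic. In degree n + 1 the composite factors through a zero module and the
  homotopy has zero target, and the homotopy identity shrinks to x = h (d x).\<close>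

lemma resolution_splits:
  assumes M: "Module.module R M" and F: "projective_resolution R M F dF eF"
    and P: "projective_resolution R M P dP eP"
    and P0: "carrier (P (Suc n)) = {\<zero>\<^bsub>P (Suc n)\<^esub>}"
    and F0: "carrier (F (Suc (Suc n))) = {\<zero>\<^bsub>F (Suc (Suc n))\<^esub>}"
  obtains h where "h \<in> module_hom R (F n) (F (Suc n))" "\<And>x. x \<in> carrier (F (Suc n)) \<Longrightarrow> h (dF n x) = x"
proof -
  obtain f where f: "\<And>i. f i \<in> module_hom R (F i) (P i)"
    "\<And>x. x \<in> carrier (F 0) \<Longrightarrow> eP (f 0 x) = eF x"
    "\<And>i x. x \<in> carrier (F (Suc i)) \<Longrightarrow> dP i (f (Suc i) x) = f i (dF i x)"
    by (rule projective_resolution_chain_map[OF M F P]) blast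
  obtain g where g: "\<And>i. g i \<in> module_hom R (P i) (F i)"
    "\<And>x. x \<in> carrier (P 0) \<Longrightarrow> eF (g 0 x) = eP x"
    "\<And>i x. x \<in> carrier (P (Suc i)) \<Longrightarrow> dF i (g (Suc i) x) = g i (dP i x)"
    by (rule projective_resolution_chain_map[OF M P F]) blast
  note mF = projective_resolution_module[OF F] and mP = projective_resolution_module[OF P]
  note dF = projective_resolution_hom[OF F]
  define p where "p = (\<lambda>i x. x \<ominus>\<^bsub>F i\<^esub> g i (f i x))"
  have p: "p i \<in> module_hom R (F i) (F i)" for i
    unfolding p_def by (rule module_hom_minus[OF mF mF module_hom_id module_hom_comp[OF f(1) g(1)]])
  have chain: "dF i (p (Suc i) x) = p i (dF i x)" if x: "x \<in> carrier (F (Suc i))" for i x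
    using module_hom_diff[OF mF mF dF x module_hom_closed[OF g(1) module_hom_closed[OF f(1) x]]]
      g(3)[OF module_hom_closed[OF f(1) x]] f(3)[OF x]
    by (simp add: p_def)
  have p0: "p 0 x \<in> dF 0 ` carrier (F (Suc 0))" if x: "x \<in> carrier (F 0)" for x
  proof -
    interpret M: Module.module R M by fact
    have "eF (p 0 x) = \<zero>\<^bsub>M\<^esub>"
      using module_hom_diff[OF mF M projective_resolution_augmentation[OF F] x module_hom_closed[OF g(1) module_hom_closed[OF f(1) x]]]
        g(2)[OF module_hom_closed[OF f(1) x]] f(2)[OF x]
        module_hom_closed[OF projective_resolution_augmentation[OF F] x]
      by (simp add: p_def a_minus_def M.r_neg)
    then show ?thesis
      unfolding projective_resolution_exact0[OF F, symmetric] using module_hom_closed[OF p x] by simp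
  qed
  obtain h where h: "\<And>i. h i \<in> module_hom R (F i) (F (Suc i))"
    "\<And>i x. x \<in> carrier (F (Suc i)) \<Longrightarrow>
       p (Suc i) x = dF (Suc i) (h (Suc i) x) \<oplus>\<^bsub>F (Suc i)\<^esub> h i (dF i x)"
    by (rule null_homotopy_exists[OF projective_resolution_projective[OF F] dF
        projective_resolution_exact[OF F] p chain p0]) blast+
  have "h n (dF n x) = x" if x: "x \<in> carrier (F (Suc n))" for x
  proof -
    interpret F: Module.module R "F (Suc n)" by (rule mF)
    have "f (Suc n) x = \<zero>\<^bsub>P (Suc n)\<^esub>" using module_hom_closed[OF f(1) x] P0 by blast
    then have "p (Suc n) x = x"
      using module_hom_zero[OF mP mF g(1)] x by (simp add: p_def a_minus_def)
    moreover have "h (Suc n) x = \<zero>\<^bsub>F (Suc (Suc n))\<^esub>" using module_hom_closed[OF h(1) x] F0 by blast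
    then have "dF (Suc n) (h (Suc n) x) = \<zero>\<^bsub>F (Suc n)\<^esub>"
      using module_hom_zero[OF mF mF dF] by simp
    ultimately show ?thesis
      using h(2)[OF x] module_hom_closed[OF h(1) module_hom_closed[OF dF x]] by simp
  qed
  then show ?thesis by (rule that[OF h(1)])
qed

section \<open>Minimal resolutions over polynomial rings\<close>

lemma poly_ring_sel [simp]:
  "mult (poly_ring X) = (*)" "one (poly_ring X) = 1" "zero (poly_ring X) = 0" "add (poly_ring X) = (+)"
  by (simp_all add: poly_ring_def)

lemma poly_ring_carrier:
  "p \<in> carrier (poly_ring X) \<longleftrightarrow> (\<forall>t\<in>Poly_Mapping.keys p. Poly_Mapping.keys t \<subseteq> X)"
  by (simp add: poly_ring_def)

lemma poly_ring_closed [simp]: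
  "0 \<in> carrier (poly_ring X)" "1 \<in> carrier (poly_ring X)"
  "p \<in> carrier (poly_ring X) \<Longrightarrow> q \<in> carrier (poly_ring X) \<Longrightarrow> p + q \<in> carrier (poly_ring X)"
  "p \<in> carrier (poly_ring X) \<Longrightarrow> q \<in> carrier (poly_ring X) \<Longrightarrow> p * q \<in> carrier (poly_ring X)"
  "p \<in> carrier (poly_ring X) \<Longrightarrow> - p \<in> carrier (poly_ring X)"
proof -
  interpret cring "poly_ring X" by (rule poly_ring_cring)
  show "0 \<in> carrier (poly_ring X)" "1 \<in> carrier (poly_ring X)"
    using zero_closed one_closed by simp_all
  show "p \<in> carrier (poly_ring X) \<Longrightarrow> q \<in> carrier (poly_ring X) \<Longrightarrow> p + q \<in> carrier (poly_ring X)"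
    "p \<in> carrier (poly_ring X) \<Longrightarrow> q \<in> carrier (poly_ring X) \<Longrightarrow> p * q \<in> carrier (poly_ring X)"
    using add.m_closed[of p q] m_closed[of p q] by simp_all
  show "p \<in> carrier (poly_ring X) \<Longrightarrow> - p \<in> carrier (poly_ring X)"
    by (simp add: poly_ring_carrier)
qed

lemma free_poly_module_carrier:
  assumes "finite B"
  shows "f \<in> carrier (free_module (poly_ring X) B) \<longleftrightarrow>
    (\<forall>b\<in>B. f b \<in> carrier (poly_ring X)) \<and> (\<forall>b. b \<notin> B \<longrightarrow> f b = 0)"
proof -
  have "finite {b. f b \<noteq> 0}" if "\<forall>b. b \<notin> B \<longrightarrow> f b = 0"
    using that by (intro finite_subset[OF _ assms]) auto
  then show ?thesis by (auto simp: free_module_carrier)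
qed

lemma free_poly_module_value:
  "f \<in> carrier (free_module (poly_ring X) B) \<Longrightarrow> f b \<in> carrier (poly_ring X)"
  using free_module_value[OF cring.axioms(1)[OF poly_ring_cring]] .

lemma free_poly_module_closed:
  assumes "f \<in> carrier (free_module (poly_ring X) B)"
  shows "g \<in> carrier (free_module (poly_ring X) B) \<Longrightarrow> (\<lambda>b. f b + g b) \<in> carrier (free_module (poly_ring X) B)"
    and "r \<in> carrier (poly_ring X) \<Longrightarrow> (\<lambda>b. r * f b) \<in> carrier (free_module (poly_ring X) B)"
    and "(\<lambda>b. - f b) \<in> carrier (free_module (poly_ring X) B)"
proof -
  interpret Module.module "poly_ring X" "free_module (poly_ring X) B"
    by (rule module_free_module[OF poly_ring_cring])
  show "g \<in> carrier (free_module (poly_ring X) B) \<Longrightarrow> (\<lambda>b. f b + g b) \<in> carrier (free_module (poly_ring X) B)"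
    using M.add.m_closed[OF assms] by simp
  show smult: "(\<lambda>b. r * f b) \<in> carrier (free_module (poly_ring X) B)" if "r \<in> carrier (poly_ring X)" for r
    using smult_closed[OF that assms] by simp
  show "(\<lambda>b. - f b) \<in> carrier (free_module (poly_ring X) B)"
    using smult[of "-1"] by simp
qed

lemma free_poly_module_hom_iff:
  "f \<in> module_hom (poly_ring X) (free_module (poly_ring X) B) (free_module (poly_ring X) C) \<longleftrightarrow>
    (\<forall>x\<in>carrier (free_module (poly_ring X) B). f x \<in> carrier (free_module (poly_ring X) C)) \<and>
    (\<forall>x\<in>carrier (free_module (poly_ring X) B). \<forall>y\<in>carrier (free_module (poly_ring X) B).
       f (\<lambda>b. x b + y b) = (\<lambda>c. f x c + f y c)) \<and>
    (\<forall>r\<in>carrier (poly_ring X). \<forall>x\<in>carrier (free_module (poly_ring X) B).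
       f (\<lambda>b. r * x b) = (\<lambda>c. r * f x c))"
  by (simp add: module_hom_def Pi_iff)

lemma
  assumes "f \<in> module_hom (poly_ring X) (free_module (poly_ring X) B) (free_module (poly_ring X) C)"
    and "x \<in> carrier (free_module (poly_ring X) B)"
  shows free_poly_hom_closed: "f x \<in> carrier (free_module (poly_ring X) C)"
    and free_poly_hom_add: "y \<in> carrier (free_module (poly_ring X) B) \<Longrightarrow> f (\<lambda>b. x b + y b) = (\<lambda>c. f x c + f y c)"
    and free_poly_hom_smult: "r \<in> carrier (poly_ring X) \<Longrightarrow> f (\<lambda>b. r * x b) = (\<lambda>c. r * f x c)"
    and free_poly_hom_uminus: "f (\<lambda>b. - x b) = (\<lambda>c. - f x c)"
proof -
  note f = assms(1)[unfolded free_poly_module_hom_iff]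
  show "f x \<in> carrier (free_module (poly_ring X) C)"
    "y \<in> carrier (free_module (poly_ring X) B) \<Longrightarrow> f (\<lambda>b. x b + y b) = (\<lambda>c. f x c + f y c)"
    using f assms(2) by auto
  show smult: "f (\<lambda>b. r * x b) = (\<lambda>c. r * f x c)" if "r \<in> carrier (poly_ring X)" for r
    using f assms(2) that by auto
  show "f (\<lambda>b. - x b) = (\<lambda>c. - f x c)"
    using smult[of "-1"] by simp
qed

lemma free_poly_hom_zero:
  assumes "f \<in> module_hom (poly_ring X) (free_module (poly_ring X) B) (free_module (poly_ring X) C)"
  shows "f (\<lambda>_. 0) = (\<lambda>_. 0)"
  using module_hom_zero[OF module_free_module[OF poly_ring_cring] module_free_module[OF poly_ring_cring] assms]
  by simp

section \<open>Constant terms, minimal resolutions and projective dimension\<close>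

lemma coeff0_mult:
  fixes p q :: "('v \<Rightarrow>\<^sub>0 nat) \<Rightarrow>\<^sub>0 'k::field"
  assumes "Poly_Mapping.lookup q 0 = 0"
  shows "Poly_Mapping.lookup (p * q) 0 = 0"
proof (rule ccontr)
  assume "Poly_Mapping.lookup (p * q) 0 \<noteq> 0"
  then have "0 \<in> Poly_Mapping.keys (p * q)" by (simp add: in_keys_iff)
  then obtain s t where st: "0 = s + t" "t \<in> Poly_Mapping.keys q" using keys_mult[of p q] by blast
  have "Poly_Mapping.lookup t a = 0" for a
    using arg_cong[OF st(1), of "\<lambda>u. Poly_Mapping.lookup u a"] by (simp add: lookup_add)
  then have "t = 0" by (intro poly_mapping_eqI) simp
  then show False using st(2) assms by (simp add: in_keys_iff)
qed

text \<open>Matrix form of \<open>h\<close>. It shows that a vector whose entries have no constant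
  term is mapped to another such vector.\<close>

lemma free_poly_hom_expand:
  assumes h: "h \<in> module_hom (poly_ring X) (free_module (poly_ring X) B) (free_module (poly_ring X) C)"
    and "finite B" "z \<in> carrier (free_module (poly_ring X) B)"
  shows "h z c = (\<Sum>b\<in>B. z b * h (unit_vector (poly_ring X) b) c)"
  using poly_ring_cring assms(3)
proof (induction rule: free_module_induct)
  case zero
  then show ?case using free_poly_hom_zero[OF h] by simp
next
  case (add z r b)
  let ?u = "unit_vector (poly_ring X)"
  have u: "?u b \<in> carrier (free_module (poly_ring X) B)"
    using unit_vector_carrier[OF cring.axioms(1)[OF poly_ring_cring] \<open>b \<in> B\<close>] .
  have "h (z \<oplus>\<^bsub>free_module (poly_ring X) B\<^esub> (r \<odot>\<^bsub>free_module (poly_ring X) B\<^esub> ?u b)) c = h z c + r * h (?u b) c"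
    using free_poly_hom_add[OF h \<open>z \<in> _\<close> free_poly_module_closed(2)[OF u \<open>r \<in> _\<close>]]
      free_poly_hom_smult[OF h u \<open>r \<in> _\<close>] by simp
  moreover have "(\<Sum>b'\<in>B. (z \<oplus>\<^bsub>free_module (poly_ring X) B\<^esub> (r \<odot>\<^bsub>free_module (poly_ring X) B\<^esub> ?u b)) b' * h (?u b') c)
     = (\<Sum>b'\<in>B. z b' * h (?u b') c) + (\<Sum>b'\<in>B. if b' = b then r * h (?u b) c else 0)"
    by (auto simp: sum.distrib[symmetric] unit_vector_def algebra_simps intro!: sum.cong)
  moreover have "(\<Sum>b'\<in>B. if b' = b then r * h (?u b) c else 0) = r * h (?u b) c"
    using \<open>finite B\<close> \<open>b \<in> B\<close> by simp
  ultimately show ?case using \<open>h z c = _\<close> by simp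
qed

lemma projective_free_poly_module: "projective_module (poly_ring X) (free_module (poly_ring X) B)"
  by (rule projective_free_module[OF poly_ring_cring]) simp

text \<open>
  A finite free resolution of length \<open>p\<close> of the quotient by \<open>J\<close>, with a single basis element in
  degree 0. By the last condition the differentials vanish modulo the ideal of the polynomials without
  constant term.
\<close>

definition minimal_resolution ::
  "'v set \<Rightarrow> (('v \<Rightarrow>\<^sub>0 nat) \<Rightarrow>\<^sub>0 'k::field) set \<Rightarrow> (nat \<Rightarrow> ('c \<times> nat) set) \<Rightarrow>
   (nat \<Rightarrow> ('c \<times> nat \<Rightarrow> ('v \<Rightarrow>\<^sub>0 nat) \<Rightarrow>\<^sub>0 'k) \<Rightarrow> 'c \<times> nat \<Rightarrow> ('v \<Rightarrow>\<^sub>0 nat) \<Rightarrow>\<^sub>0 'k) \<Rightarrow> nat \<Rightarrow> bool"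
where
  "minimal_resolution X J B d p \<longleftrightarrow>
     (\<forall>i. finite (B i)) \<and> B 0 = {(undefined, 0)} \<and> (\<forall>i>p. B i = {}) \<and> B p \<noteq> {} \<and>
     (\<forall>i. d i \<in> module_hom (poly_ring X) (free_module (poly_ring X) (B (Suc i))) (free_module (poly_ring X) (B i))) \<and>
     d 0 ` carrier (free_module (poly_ring X) (B (Suc 0))) =
       {x \<in> carrier (free_module (poly_ring X) (B 0)). x (undefined, 0) \<in> J} \<and>
     (\<forall>i. {x \<in> carrier (free_module (poly_ring X) (B (Suc i))). d i x = (\<lambda>_. 0)} =
       d (Suc i) ` carrier (free_module (poly_ring X) (B (Suc (Suc i))))) \<and>
     (\<forall>i. \<forall>x\<in>carrier (free_module (poly_ring X) (B (Suc i))). \<forall>b. Poly_Mapping.lookup (d i x b) 0 = 0)"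

lemma
  assumes "minimal_resolution X J B d p"
  shows minimal_resolution_finite: "finite (B i)"
    and minimal_resolution_base: "B 0 = {(undefined, 0)}"
    and minimal_resolution_beyond: "i > p \<Longrightarrow> B i = {}"
    and minimal_resolution_top: "B p \<noteq> {}"
    and minimal_resolution_hom:
      "d i \<in> module_hom (poly_ring X) (free_module (poly_ring X) (B (Suc i))) (free_module (poly_ring X) (B i))"
    and minimal_resolution_image: "d 0 ` carrier (free_module (poly_ring X) (B (Suc 0))) =
       {x \<in> carrier (free_module (poly_ring X) (B 0)). x (undefined, 0) \<in> J}"
    and minimal_resolution_exact: "{x \<in> carrier (free_module (poly_ring X) (B (Suc i))). d i x = (\<lambda>_. 0)} =
       d (Suc i) ` carrier (free_module (poly_ring X) (B (Suc (Suc i))))"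
    and minimal_resolution_minimal: "x \<in> carrier (free_module (poly_ring X) (B (Suc i))) \<Longrightarrow>
       Poly_Mapping.lookup (d i x b) 0 = 0"
  using assms by (simp_all add: minimal_resolution_def del: split_paired_All)

lemma quotient_module_sel:
  "carrier (quotient_module R J) = carrier (R Quot J)"
  "zero (quotient_module R J) = J" "add (quotient_module R J) = add (R Quot J)"
  "smult (quotient_module R J) r C = (J +>\<^bsub>R\<^esub> r) \<otimes>\<^bsub>R Quot J\<^esub> C"
  by (simp_all add: quotient_module_def FactRing_def)

lemma minimal_resolution_imp_projective_resolution:
  fixes J :: "(('v \<Rightarrow>\<^sub>0 nat) \<Rightarrow>\<^sub>0 'k::field) set"
  assumes J: "ideal J (poly_ring X)" and mr: "minimal_resolution X J B d p"
  shows "projective_resolution (poly_ring X) (quotient_module (poly_ring X) J)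
    (\<lambda>i. free_module (poly_ring X) (B i)) d (\<lambda>x. J +>\<^bsub>poly_ring X\<^esub> x (undefined, 0))"
proof -
  let ?R = "poly_ring X :: (('v \<Rightarrow>\<^sub>0 nat) \<Rightarrow>\<^sub>0 'k) ring"
  interpret cring ?R by (rule poly_ring_cring)
  interpret J: ideal J ?R by (rule J)
  interpret h: ring_hom_ring ?R "?R Quot J" "(+>\<^bsub>?R\<^esub>) J" by (rule J.rcos_ring_hom_ring)
  let ?e = "\<lambda>x. J +>\<^bsub>?R\<^esub> x (undefined, 0)"
  note B0 = minimal_resolution_base[OF mr]
  have F0: "x \<in> carrier (free_module ?R (B 0)) \<longleftrightarrow>
      x (undefined, 0) \<in> carrier ?R \<and> (\<forall>b. b \<noteq> (undefined, 0) \<longrightarrow> x b = 0)" for x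
    by (simp add: B0 free_poly_module_carrier)
  have "?e \<in> module_hom ?R (free_module ?R (B 0)) (quotient_module ?R J)"
    unfolding module_hom_def
    using h.hom_add h.hom_mult by (auto simp: quotient_module_sel F0 simp del: h.hom_add h.hom_mult)
  moreover have "?e ` carrier (free_module ?R (B 0)) = carrier (quotient_module ?R J)"
  proof -
    have "C \<in> ?e ` carrier (free_module ?R (B 0))" if C: "C \<in> carrier (?R Quot J)" for C
    proof -
      obtain r where r: "r \<in> carrier ?R" "C = J +>\<^bsub>?R\<^esub> r"
        using C by (auto simp: FactRing_def A_RCOSETS_def')
      then show ?thesis
        by (intro image_eqI[where x = "\<lambda>b. if b = (undefined, 0) then r else 0"]) (simp_all add: F0)
    qed
    moreover have "?e x \<in> carrier (?R Quot J)" if "x \<in> carrier (free_module ?R (B 0))" for x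
      using that h.hom_closed by (simp add: F0)
    ultimately show ?thesis by (auto simp: quotient_module_sel)
  qed
  moreover have "{x \<in> carrier (free_module ?R (B 0)). ?e x = \<zero>\<^bsub>quotient_module ?R J\<^esub>} =
      d 0 ` carrier (free_module ?R (B (Suc 0)))"
  proof -
    have "J +>\<^bsub>?R\<^esub> r = J \<longleftrightarrow> r \<in> J" if "r \<in> carrier ?R" for r
      using J.a_rcos_const J.a_rcos_self[OF that] by blast
    then show ?thesis
      unfolding minimal_resolution_image[OF mr] quotient_module_sel by (auto simp: F0)
  qed
  ultimately show ?thesis
    unfolding projective_resolution_def
    using minimal_resolution_hom[OF mr] minimal_resolution_exact[OF mr]
    by (simp add: projective_free_poly_module)
qed

lemma proj_dim_eq_minimal_resolution_length:
  fixes J :: "(('v \<Rightarrow>\<^sub>0 nat) \<Rightarrow>\<^sub>0 'k::field) set"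
    and B :: "nat \<Rightarrow> ((('v \<Rightarrow>\<^sub>0 nat) \<Rightarrow>\<^sub>0 'k) set \<times> nat) set"
  assumes J: "ideal J (poly_ring X)" and mr: "minimal_resolution X J B d p"
  shows "proj_dim (poly_ring X) (quotient_module (poly_ring X) J) = enat p"
proof -
  let ?R = "poly_ring X :: (('v \<Rightarrow>\<^sub>0 nat) \<Rightarrow>\<^sub>0 'k) ring"
  note F = minimal_resolution_imp_projective_resolution[OF J mr]
  have zero: "carrier (free_module ?R (B i)) = {\<zero>\<^bsub>free_module ?R (B i)\<^esub>}" if "i > p" for i
    using minimal_resolution_beyond[OF mr that] by (auto simp: free_poly_module_carrier)
  have "p \<le> n"
    if P: "projective_resolution ?R (quotient_module ?R J) P dP eP" and n: "\<forall>i>n. carrier (P i) = {\<zero>\<^bsub>P i\<^esub>}"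
    for n dP eP and P :: "nat \<Rightarrow> (_, ((('v \<Rightarrow>\<^sub>0 nat) \<Rightarrow>\<^sub>0 'k) set \<times> nat) \<Rightarrow> ('v \<Rightarrow>\<^sub>0 nat) \<Rightarrow>\<^sub>0 'k) module"
  proof (rule ccontr)
    assume "\<not> p \<le> n"
    \<comment> \<open>With p = q + 1 and n < q + 1, the shorter resolution vanishes in degree q + 1
      and the minimal one in degree q + 2, as \<open>resolution_splits\<close> requires.\<close>
    then obtain q where q: "p = Suc q" "n < Suc q" by (cases p) auto
    obtain h where h: "h \<in> module_hom ?R (free_module ?R (B q)) (free_module ?R (B (Suc q)))"
      "\<And>x. x \<in> carrier (free_module ?R (B (Suc q))) \<Longrightarrow> h (d q x) = x"
      by (rule resolution_splits[OF quotient_module_module[OF poly_ring_cring J] F P, of q])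
         (use n q zero in auto)
    obtain b where b: "b \<in> B (Suc q)" using minimal_resolution_top[OF mr] q by auto
    let ?u = "unit_vector ?R b"
    have u: "?u \<in> carrier (free_module ?R (B (Suc q)))"
      by (rule unit_vector_carrier[OF cring.axioms(1)[OF poly_ring_cring] b])
    \<comment> \<open>By minimality the entries of \<open>d q ?u\<close> have no constant term, and
      \<open>h\<close> preserves this. But the retraction returns the unit vector, whose entry at b
      is 1.\<close>
    have "Poly_Mapping.lookup (h (d q ?u) b) 0 = 0"
      unfolding free_poly_hom_expand[OF h(1) minimal_resolution_finite[OF mr]
          free_poly_hom_closed[OF minimal_resolution_hom[OF mr] u]]
      using coeff0_mult[OF minimal_resolution_minimal[OF mr u]]
      by (simp add: lookup_sum mult.commute)
    then show False
      unfolding h(2)[OF u] by (simp add: unit_vector_def)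
  qed
  \<comment> \<open>Here the index type of \<open>B\<close> matters: \<open>proj_dim\<close> admits
    only resolutions with elements of one particular function type.\<close>
  moreover have "enat p \<in> {enat n | n. \<exists>(P :: nat \<Rightarrow> (_, ((('v \<Rightarrow>\<^sub>0 nat) \<Rightarrow>\<^sub>0 'k) set \<times> nat) \<Rightarrow> ('v \<Rightarrow>\<^sub>0 nat) \<Rightarrow>\<^sub>0 'k) module) d e.
      projective_resolution ?R (quotient_module ?R J) P d e \<and> (\<forall>i>n. carrier (P i) = {\<zero>\<^bsub>P i\<^esub>})}"
    by (intro CollectI exI conjI, rule refl, rule F) (use zero in blast)
  ultimately show ?thesis
    unfolding proj_dim_def by (intro antisym Inf_lower Inf_greatest) auto
qed

section \<open>Direct sums and mapping cones\<close>

text \<open>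
  The direct sum of two free modules is realised on the even and the odd indices.
\<close>

definition sum_basis :: "('c \<times> nat) set \<Rightarrow> ('c \<times> nat) set \<Rightarrow> ('c \<times> nat) set" where
  "sum_basis S T = (\<lambda>(a, n). (a, 2 * n)) ` S \<union> (\<lambda>(a, n). (a, 2 * n + 1)) ` T"

definition left_part :: "('c \<times> nat \<Rightarrow> 'r) \<Rightarrow> 'c \<times> nat \<Rightarrow> 'r" where
  "left_part z = (\<lambda>(a, n). z (a, 2 * n))"

definition right_part :: "('c \<times> nat \<Rightarrow> 'r) \<Rightarrow> 'c \<times> nat \<Rightarrow> 'r" where
  "right_part z = (\<lambda>(a, n). z (a, 2 * n + 1))"

definition join_parts :: "('c \<times> nat \<Rightarrow> 'r) \<Rightarrow> ('c \<times> nat \<Rightarrow> 'r) \<Rightarrow> 'c \<times> nat \<Rightarrow> 'r" where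
  "join_parts u v = (\<lambda>(a, n). if even n then u (a, n div 2) else v (a, n div 2))"

lemma left_part_join [simp]: "left_part (join_parts u v) = u"
  by (auto simp: left_part_def join_parts_def)

lemma right_part_join [simp]: "right_part (join_parts u v) = v"
  by (auto simp: right_part_def join_parts_def)

lemma join_parts_collapse: "join_parts (left_part z) (right_part z) = z"
  by (auto simp: left_part_def right_part_def join_parts_def fun_eq_iff elim: oddE)

lemma join_parts_eq_iff: "join_parts u v = z \<longleftrightarrow> u = left_part z \<and> v = right_part z"
  using join_parts_collapse by auto

lemma parts_linear:
  "left_part (\<lambda>b. x b + y b) = (\<lambda>b. left_part x b + left_part y b)"
  "right_part (\<lambda>b. x b + y b) = (\<lambda>b. right_part x b + right_part y b)"
  "left_part (\<lambda>b. r * x b) = (\<lambda>b. r * left_part x b)"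
  "right_part (\<lambda>b. r * x b) = (\<lambda>b. r * right_part x b)"
  "left_part (\<lambda>b. c) = (\<lambda>b. c)"
  "right_part (\<lambda>b. c) = (\<lambda>b. c)"
  by (auto simp: left_part_def right_part_def)

lemma join_parts_value: "join_parts u v b = u (fst b, snd b div 2) \<or> join_parts u v b = v (fst b, snd b div 2)"
  by (auto simp: join_parts_def split: prod.split)

lemma finite_sum_basis: "finite S \<Longrightarrow> finite T \<Longrightarrow> finite (sum_basis S T)"
  by (simp add: sum_basis_def)

lemma sum_basis_empty_iff: "sum_basis S T = {} \<longleftrightarrow> S = {} \<and> T = {}"
  by (simp add: sum_basis_def)

lemma mem_sum_basis: "(a, n) \<in> sum_basis S T \<longleftrightarrow> (if even n then (a, n div 2) \<in> S else (a, n div 2) \<in> T)"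
proof (cases "even n")
  case True
  then obtain m where [simp]: "n = 2 * m" by (rule evenE)
  have "(a, 2 * m) \<in> sum_basis S T \<longleftrightarrow> (a, m) \<in> S"
    using Suc_double_not_eq_double double_not_eq_Suc_double by (force simp: sum_basis_def)
  then show ?thesis by simp
next
  case False
  then obtain m where [simp]: "n = Suc (2 * m)" by (auto elim: oddE)
  have "(a, Suc (2 * m)) \<in> sum_basis S T \<longleftrightarrow> (a, m) \<in> T"
    using Suc_double_not_eq_double double_not_eq_Suc_double by (force simp: sum_basis_def)
  then show ?thesis by simp
qed

lemma free_module_sum_basis:
  assumes "finite S" "finite T"
  shows "z \<in> carrier (free_module (poly_ring X) (sum_basis S T)) \<longleftrightarrow>
    left_part z \<in> carrier (free_module (poly_ring X) S) \<and> right_part z \<in> carrier (free_module (poly_ring X) T)"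
    (is "?l \<longleftrightarrow> ?r")
proof
  assume ?l
  then have z: "z (a, n) \<in> carrier (poly_ring X)" "(a, n) \<notin> sum_basis S T \<Longrightarrow> z (a, n) = 0" for a n
    by (blast intro: free_poly_module_value, simp add: free_module_carrier)
  have "z (a, 2 * n) = 0" if "(a, n) \<notin> S" for a n
    using z(2)[of a "2 * n"] that by (simp add: mem_sum_basis)
  moreover have "z (a, Suc (2 * n)) = 0" if "(a, n) \<notin> T" for a n
    using z(2)[of a "Suc (2 * n)"] that by (simp add: mem_sum_basis)
  ultimately show ?r
    using z(1) assms by (auto simp: free_poly_module_carrier left_part_def right_part_def)
next
  assume r: ?r
  have "join_parts (left_part z) (right_part z) (a, n) \<in> carrier (poly_ring X)"
    "(a, n) \<notin> sum_basis S T \<Longrightarrow> join_parts (left_part z) (right_part z) (a, n) = 0" for a n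
    using r free_poly_module_value[of "left_part z"] free_poly_module_value[of "right_part z"] assms
    by (auto simp: join_parts_def free_poly_module_carrier mem_sum_basis)
  then show ?l
    unfolding join_parts_collapse using assms by (auto simp: free_poly_module_carrier finite_sum_basis)
qed

text \<open>
  The mapping cone of the multiplication by \<open>y * w\<close> from the quotient by \<open>J' = J : y * w\<close> to the
  quotient by \<open>J\<close>. Since \<open>J' = J : w\<close> as well, the multiplication by \<open>w\<close> lifts to a chain map \<open>f\<close>,
  and \<open>y\<close> times \<open>f\<close> lifts the multiplication by \<open>y * w\<close>; this choice makes the cone minimal.
\<close>

lemma mapping_cone_minimal_resolution:
  fixes J J' :: "(('v \<Rightarrow>\<^sub>0 nat) \<Rightarrow>\<^sub>0 'k::field) set"
    and B B' :: "nat \<Rightarrow> ('c \<times> nat) set"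
  assumes F: "minimal_resolution X J B d p" and F': "minimal_resolution X J' B' d' p'"
    and y: "y \<in> carrier (poly_ring X)" "Poly_Mapping.lookup y 0 = 0" and w: "w \<in> carrier (poly_ring X)"
    and colon: "\<And>r. r \<in> carrier (poly_ring X) \<Longrightarrow> y * w * r \<in> J \<Longrightarrow> r \<in> J'"
    and colon': "\<And>r. r \<in> carrier (poly_ring X) \<Longrightarrow> r \<in> J' \<Longrightarrow> w * r \<in> J"
    and J: "ideal J (poly_ring X)"
  obtains BG D where "minimal_resolution X {j + y * w * r | j r. j \<in> J \<and> r \<in> carrier (poly_ring X)}
      (BG :: nat \<Rightarrow> ('c \<times> nat) set) D (max p (Suc p'))"
proof -
  let ?R = "poly_ring X :: (('v \<Rightarrow>\<^sub>0 nat) \<Rightarrow>\<^sub>0 'k) ring"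
  let ?Fr = "\<lambda>S :: ('c \<times> nat) set. carrier (free_module ?R S)"
  let ?o = "(undefined, 0) :: 'c \<times> nat"
  \<comment> \<open>The second resolution shifted by one degree, with nothing in degree 0. In degree
    i the cone is then the sum of \<open>B i\<close> and \<open>B1 i\<close>, without case
    distinctions.\<close>
  define B1 where "B1 = case_nat {} B'"
  define d1 where "d1 = case_nat (\<lambda>_ _. 0) d'"
  have B1 [simp]: "B1 0 = {}" "B1 (Suc i) = B' i" for i by (simp_all add: B1_def)
  have d1 [simp]: "d1 0 = (\<lambda>_ _. 0)" "d1 (Suc i) = d' i" for i by (simp_all add: d1_def)
  note fin = minimal_resolution_finite[OF F] minimal_resolution_finite[OF F']
  note dh = minimal_resolution_hom[OF F] and d'h = minimal_resolution_hom[OF F']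
  have fin1: "finite (B1 i)" for i using fin by (cases i) auto
  have Fr0: "x \<in> ?Fr {?o} \<longleftrightarrow> x ?o \<in> carrier ?R \<and> (\<forall>b. b \<noteq> ?o \<longrightarrow> x b = 0)" for x
    by (simp add: free_poly_module_carrier)
  have d1h: "d1 i \<in> module_hom ?R (free_module ?R (B1 (Suc i))) (free_module ?R (B1 i))" for i
    using d'h by (cases i) (auto simp: free_poly_module_hom_iff free_poly_module_carrier)
  have dd: "d i (d (Suc i) x) = (\<lambda>_. 0)" if "x \<in> ?Fr (B (Suc (Suc i)))" for i x
    using minimal_resolution_exact[OF F, of i] that by blast
  have dd': "d' i (d' (Suc i) x) = (\<lambda>_. 0)" if "x \<in> ?Fr (B' (Suc (Suc i)))" for i x
    using minimal_resolution_exact[OF F', of i] that by blast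
  obtain f where f0: "f 0 = (\<lambda>x b. w * x b)"
    and fh: "\<And>i. f i \<in> module_hom ?R (free_module ?R (B' i)) (free_module ?R (B i))"
    and fd: "\<And>i x. x \<in> ?Fr (B' (Suc i)) \<Longrightarrow> d i (f (Suc i) x) = f i (d' i x)"
  proof (rule chain_map_exists[of ?R "\<lambda>i. free_module ?R (B' i)" "\<lambda>i. free_module ?R (B i)" d' d "\<lambda>x b. w * x b"])
    show "(\<lambda>x b. w * x b) \<in> module_hom ?R (free_module ?R (B' 0)) (free_module ?R (B 0))"
      using free_poly_module_closed(2)[OF _ w]
      by (auto simp: free_poly_module_hom_iff minimal_resolution_base[OF F] minimal_resolution_base[OF F']
          algebra_simps)
    show "(\<lambda>b. w * d' 0 x b) \<in> d 0 ` ?Fr (B (Suc 0))" if x: "x \<in> ?Fr (B' (Suc 0))" for x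
    proof -
      have "d' 0 x \<in> {x \<in> ?Fr (B' 0). x ?o \<in> J'}"
        using minimal_resolution_image[OF F'] x by blast
      then show ?thesis
        unfolding minimal_resolution_image[OF F] using w
        by (auto simp: minimal_resolution_base[OF F] minimal_resolution_base[OF F'] Fr0 colon')
    qed
  qed (use dh d'h dd' minimal_resolution_exact[OF F]
      in \<open>auto simp: projective_free_poly_module module_free_module[OF poly_ring_cring]\<close>)
  define BG where "BG = (\<lambda>i. sum_basis (B i) (B1 i))"
  \<comment> \<open>The two components of the cone differential. The minus sign in \<open>v\<close>
    makes its square vanish: d (y f r) cancels y f (d' r).\<close>
  define u where "u = (\<lambda>i z b. d i (left_part z) b + y * f i (right_part z) b)"
  define v where "v = (\<lambda>i z b. - d1 i (right_part z) b)"
  define D where "D = (\<lambda>i z. join_parts (u i z) (v i z))"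
  have G: "z \<in> ?Fr (BG i) \<longleftrightarrow> left_part z \<in> ?Fr (B i) \<and> right_part z \<in> ?Fr (B1 i)" for z i
    unfolding BG_def using free_module_sum_basis[OF fin(1) fin1] .
  have uh: "u i z \<in> ?Fr (B i)" and vh: "v i z \<in> ?Fr (B1 i)" if "z \<in> ?Fr (BG (Suc i))" for i z
  proof -
    have z: "left_part z \<in> ?Fr (B (Suc i))" "right_part z \<in> ?Fr (B' i)" "right_part z \<in> ?Fr (B1 (Suc i))"
      using that by (simp_all add: G)
    show "u i z \<in> ?Fr (B i)"
      unfolding u_def
      using free_poly_module_closed(1)[OF free_poly_hom_closed[OF dh z(1)]
          free_poly_module_closed(2)[OF free_poly_hom_closed[OF fh z(2)] y(1)]] .
    show "v i z \<in> ?Fr (B1 i)"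
      unfolding v_def using free_poly_module_closed(3)[OF free_poly_hom_closed[OF d1h z(3)]] .
  qed
  have Dh: "D i \<in> module_hom ?R (free_module ?R (BG (Suc i))) (free_module ?R (BG i))" for i
    unfolding free_poly_module_hom_iff
  proof (intro conjI ballI)
    show "D i z \<in> ?Fr (BG i)" if "z \<in> ?Fr (BG (Suc i))" for z
      using uh[OF that] vh[OF that] by (simp add: G D_def)
    show "D i (\<lambda>b. x b + z b) = (\<lambda>b. D i x b + D i z b)" if "x \<in> ?Fr (BG (Suc i))" "z \<in> ?Fr (BG (Suc i))" for x z
      using that free_poly_hom_add[OF dh, of "left_part x" i "left_part z"]
        free_poly_hom_add[OF fh, of "right_part x" i "right_part z"]
        free_poly_hom_add[OF d1h, of "right_part x" i "right_part z"]
      by (simp add: G D_def u_def v_def parts_linear join_parts_eq_iff algebra_simps)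
    show "D i (\<lambda>b. r * x b) = (\<lambda>b. r * D i x b)" if "r \<in> carrier ?R" "x \<in> ?Fr (BG (Suc i))" for r x
      using that free_poly_hom_smult[OF dh, of "left_part x" i r]
        free_poly_hom_smult[OF fh, of "right_part x" i r]
        free_poly_hom_smult[OF d1h, of "right_part x" i r]
      by (simp add: G D_def u_def v_def parts_linear join_parts_eq_iff algebra_simps)
  qed
  have D0: "D 0 z = join_parts (\<lambda>b. d 0 (left_part z) b + y * w * right_part z b) (\<lambda>_. 0)" for z
    by (simp add: D_def u_def v_def f0 mult.assoc)
  have d1d': "d1 i (d' i x) = (\<lambda>_. 0)" if "x \<in> ?Fr (B' (Suc i))" for i x
    using dd' that by (cases i) auto
  have image: "D 0 ` ?Fr (BG (Suc 0)) =
      {x \<in> ?Fr (BG 0). x ?o \<in> {j + y * w * r | j r. j \<in> J \<and> r \<in> carrier ?R}}" (is "?L = ?M")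
  proof
    show "?L \<subseteq> ?M"
    proof
      fix z assume "z \<in> ?L"
      then obtain x where xG: "x \<in> ?Fr (BG (Suc 0))" and zx: "z = D 0 x" by blast
      then have x: "left_part x \<in> ?Fr (B (Suc 0))" "right_part x \<in> ?Fr (B' 0)" "z = D 0 x"
        and z: "z \<in> ?Fr (BG 0)" using module_hom_closed[OF Dh xG] by (simp_all add: G)
      have "d 0 (left_part x) ?o \<in> J" using minimal_resolution_image[OF F] x(1) by blast
      moreover have "z ?o = d 0 (left_part x) ?o + y * w * right_part x ?o"
        unfolding x(3) D0 by (simp add: join_parts_def)
      ultimately show "z \<in> ?M" using z free_poly_module_value[OF x(2)] by blast
    qed
    show "?M \<subseteq> ?L"
    proof
      fix z assume "z \<in> ?M"
      then obtain j r where z: "z \<in> ?Fr (BG 0)" and jr: "z ?o = j + y * w * r" "j \<in> J" "r \<in> carrier ?R" by blast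
      define e where "e = (\<lambda>c b. if b = ?o then c else (0 :: ('v \<Rightarrow>\<^sub>0 nat) \<Rightarrow>\<^sub>0 'k))"
      have "e j \<in> d 0 ` ?Fr (B (Suc 0))"
        unfolding minimal_resolution_image[OF F] using jr(2) additive_subgroup.a_Hcarr[OF ideal.axioms(1)[OF J]]
        by (auto simp: minimal_resolution_base[OF F] Fr0 e_def)
      then obtain x where x: "x \<in> ?Fr (B (Suc 0))" "d 0 x = e j" by auto
      have "e r \<in> ?Fr (B' 0)" using jr(3) by (simp add: minimal_resolution_base[OF F'] Fr0 e_def)
      then have "join_parts x (e r) \<in> ?Fr (BG (Suc 0))" using x(1) by (simp add: G)
      moreover have "D 0 (join_parts x (e r)) = z"
      proof -
        have "left_part z = (\<lambda>b. e j b + y * w * e r b)"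
        proof
          fix b
          have "left_part z \<in> ?Fr {?o}" using z by (simp add: G minimal_resolution_base[OF F])
          moreover have "left_part z ?o = z ?o" by (simp add: left_part_def)
          ultimately show "left_part z b = e j b + y * w * e r b"
            using jr(1) by (simp add: Fr0 e_def del: split_paired_All)
        qed
        moreover have "right_part z = (\<lambda>_. 0)" using z by (auto simp: G free_poly_module_carrier)
        ultimately show ?thesis by (simp add: D0 join_parts_eq_iff x(2))
      qed
      ultimately show "z \<in> ?L" by blast
    qed
  qed
  have complex: "D i (D (Suc i) z) = (\<lambda>_. 0)" if z: "z \<in> ?Fr (BG (Suc (Suc i)))" for i z
  proof -
    have l: "left_part z \<in> ?Fr (B (Suc (Suc i)))" and r: "right_part z \<in> ?Fr (B' (Suc i))"
      using z by (simp_all add: G)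
    note dl = free_poly_hom_closed[OF dh l] and fr = free_poly_hom_closed[OF fh r]
    note d'r = free_poly_hom_closed[OF d'h r]
    have "u i (D (Suc i) z) = (\<lambda>_. 0)"
      unfolding u_def D_def v_def left_part_join right_part_join
      using free_poly_hom_add[OF dh dl free_poly_module_closed(2)[OF fr y(1)]]
        free_poly_hom_smult[OF dh fr y(1)] dd[OF l] fd[OF r] free_poly_hom_uminus[OF fh d'r]
      by simp
    moreover have "v i (D (Suc i) z) = (\<lambda>_. 0)"
      unfolding D_def v_def right_part_join
      using free_poly_hom_uminus[OF d1h[of i, simplified]] d1d'[OF r] d'r
      by (simp add: B1_def)
    ultimately have "join_parts (u i (D (Suc i) z)) (v i (D (Suc i) z)) = (\<lambda>_. 0)"
      by (simp add: join_parts_eq_iff parts_linear)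
    then show ?thesis unfolding D_def .
  qed
  have exact: "{z \<in> ?Fr (BG (Suc i)). D i z = (\<lambda>_. 0)} = D (Suc i) ` ?Fr (BG (Suc (Suc i)))" for i
  proof
    show "D (Suc i) ` ?Fr (BG (Suc (Suc i))) \<subseteq> {z \<in> ?Fr (BG (Suc i)). D i z = (\<lambda>_. 0)}"
      using complex module_hom_closed[OF Dh] by blast
    show "{z \<in> ?Fr (BG (Suc i)). D i z = (\<lambda>_. 0)} \<subseteq> D (Suc i) ` ?Fr (BG (Suc (Suc i)))"
    proof
      fix z assume "z \<in> {z \<in> ?Fr (BG (Suc i)). D i z = (\<lambda>_. 0)}"
      then have l: "left_part z \<in> ?Fr (B (Suc i))" and r: "right_part z \<in> ?Fr (B' i)" and D: "D i z = (\<lambda>_. 0)"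
        by (auto simp: G)
      from D have uz: "u i z = (\<lambda>_. 0)" and vz: "v i z = (\<lambda>_. 0)"
        by (simp_all add: D_def join_parts_eq_iff parts_linear)
      \<comment> \<open>In positive degrees the second component of \<open>D i z = 0\<close> says
        that \<open>right_part z\<close> is a cycle. In degree 0 it says nothing, since
        \<open>d1 0\<close> is zero; there the first component puts y w times the right part into
        \<open>J\<close>, and \<open>colon\<close> applies.\<close>
      have "right_part z \<in> d' i ` ?Fr (B' (Suc i))"
      proof (cases i)
        case 0
        have "d 0 (left_part z) ?o \<in> J" using minimal_resolution_image[OF F] l 0 by blast
        moreover have "d 0 (left_part z) ?o + y * w * right_part z ?o = 0"
          using fun_cong[OF uz, of ?o] 0 by (simp add: u_def f0 mult.assoc)
        then have "y * w * right_part z ?o = (- 1) * d 0 (left_part z) ?o"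
          by (metis add.commute add_eq_0_iff mult_minus1)
        ultimately have "y * w * right_part z ?o \<in> J"
          using ideal.I_l_closed[OF J, of _ "- 1"] by simp
        then have "right_part z ?o \<in> J'" by (intro colon free_poly_module_value[OF r])
        with r 0 show ?thesis using minimal_resolution_image[OF F'] by auto
      next
        case (Suc j)
        then have "d' j (right_part z) = (\<lambda>_. 0)" using vz by (simp add: v_def fun_eq_iff)
        with r Suc show ?thesis using minimal_resolution_exact[OF F', of j] by auto
      qed
      then obtain s where s: "s \<in> ?Fr (B' (Suc i))" "right_part z = d' i s" by blast
      \<comment> \<open>Adding y f s to the left part makes it a cycle, because d f s = f (d' s).
        With q = d t, the preimage is (t, - s): the sign of s undoes the one in \<open>v\<close> and
        subtracts y f s from q again.\<close>
      define q where "q = (\<lambda>b. left_part z b + y * f (Suc i) s b)"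
      note ys = free_poly_module_closed(2)[OF free_poly_hom_closed[OF fh s(1)] y(1)]
      have q: "q \<in> ?Fr (B (Suc i))"
        unfolding q_def by (rule free_poly_module_closed(1)[OF l ys])
      have "d i q = (\<lambda>b. d i (left_part z) b + y * f i (right_part z) b)"
        unfolding q_def free_poly_hom_add[OF dh l ys]
          free_poly_hom_smult[OF dh free_poly_hom_closed[OF fh s(1)] y(1)] fd[OF s(1)] s(2) ..
      then have "d i q = (\<lambda>_. 0)" using uz by (simp add: u_def)
      with q have "q \<in> d (Suc i) ` ?Fr (B (Suc (Suc i)))"
        using minimal_resolution_exact[OF F, of i] by blast
      then obtain t where t: "t \<in> ?Fr (B (Suc (Suc i)))" "q = d (Suc i) t" by blast
      let ?z = "join_parts t (\<lambda>b. - s b)"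
      have "?z \<in> ?Fr (BG (Suc (Suc i)))" using t(1) free_poly_module_closed(3)[OF s(1)] by (simp add: G)
      moreover have "D (Suc i) ?z = z"
        using free_poly_hom_uminus[OF fh s(1)] free_poly_hom_uminus[OF d'h s(1)] s(2)
        by (simp add: D_def u_def v_def join_parts_eq_iff t(2)[symmetric]) (simp add: q_def)
      ultimately show "z \<in> D (Suc i) ` ?Fr (BG (Suc (Suc i)))" by blast
    qed
  qed
  have minimal: "Poly_Mapping.lookup (D i z b) 0 = 0" if z: "z \<in> ?Fr (BG (Suc i))" for i z b
  proof -
    have l: "left_part z \<in> ?Fr (B (Suc i))" and r: "right_part z \<in> ?Fr (B' i)"
      using z by (simp_all add: G)
    have "Poly_Mapping.lookup (u i z c) 0 = 0" for c
      using minimal_resolution_minimal[OF F l] coeff0_mult[OF y(2), of "f i (right_part z) c"]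
      by (simp add: u_def lookup_add mult.commute)
    moreover have "Poly_Mapping.lookup (v i z c) 0 = 0" for c
      using minimal_resolution_minimal[OF F'] r by (cases i) (simp_all add: v_def)
    ultimately show ?thesis
      using join_parts_value[of "u i z" "v i z" b] unfolding D_def by metis
  qed
  have "minimal_resolution X {j + y * w * r | j r. j \<in> J \<and> r \<in> carrier ?R} BG D (max p (Suc p'))"
    unfolding minimal_resolution_def
  proof (intro conjI)
    show "\<forall>i. finite (BG i)" using fin fin1 by (simp add: BG_def finite_sum_basis)
    \<comment> \<open>Doubling fixes the index 0, so the even copy of the base element is the base
      element itself. This is why the basis in degree 0 was pinned to index 0.\<close>
    show "BG 0 = {?o}" by (simp add: BG_def sum_basis_def minimal_resolution_base[OF F])
    show "\<forall>i>max p (Suc p'). BG i = {}"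
    proof safe
      fix i b assume "max p (Suc p') < i" "b \<in> BG i"
      moreover from this obtain j where "i = Suc j" by (cases i) auto
      ultimately show "b \<in> {}"
        using minimal_resolution_beyond[OF F, of i] minimal_resolution_beyond[OF F', of j]
        by (simp add: BG_def sum_basis_def)
    qed
    show "BG (max p (Suc p')) \<noteq> {}"
      using minimal_resolution_top[OF F] minimal_resolution_top[OF F']
      by (auto simp: BG_def sum_basis_empty_iff max_def)
    show "\<forall>i. D i \<in> module_hom ?R (free_module ?R (BG (Suc i))) (free_module ?R (BG i))"
      using Dh by blast
    show "D 0 ` ?Fr (BG (Suc 0)) =
        {x \<in> ?Fr (BG 0). x ?o \<in> {j + y * w * r | j r. j \<in> J \<and> r \<in> carrier ?R}}"
      by (rule image)
    show "\<forall>i. {x \<in> ?Fr (BG (Suc i)). D i x = (\<lambda>_. 0)} = D (Suc i) ` ?Fr (BG (Suc (Suc i)))"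
      by (intro allI exact)
    show "\<forall>i. \<forall>x\<in>?Fr (BG (Suc i)). \<forall>b. Poly_Mapping.lookup (D i x b) 0 = 0"
      by (intro allI ballI minimal)
  qed
  then show thesis by (rule that)
qed

section \<open>Ideals of strings\<close>

lemma keys_plus_nat:
  fixes s t :: "'v \<Rightarrow>\<^sub>0 nat"
  shows "Poly_Mapping.keys (s + t) = Poly_Mapping.keys s \<union> Poly_Mapping.keys t"
  by (auto simp: in_keys_iff lookup_add)

text \<open>Multiplication by a monomial shifts exponents injectively, so no two terms can merge or
  cancel.\<close>

lemma keys_single_times:
  fixes r :: "('v \<Rightarrow>\<^sub>0 nat) \<Rightarrow>\<^sub>0 'k::field"
  shows "Poly_Mapping.keys (Poly_Mapping.single u 1 * r) = (\<lambda>t. u + t) ` Poly_Mapping.keys r"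
proof -
  have "Poly_Mapping.lookup (Poly_Mapping.single u 1 * r) k = (\<Sum>q. Poly_Mapping.lookup r q when k = u + q)" for k
    by (simp add: lookup_mult lookup_single when_mult)
  moreover have "(\<Sum>q. Poly_Mapping.lookup r q when k = u + q) = Poly_Mapping.lookup r t" if "k = u + t" for k t
    using that by simp
  ultimately have "Poly_Mapping.lookup (Poly_Mapping.single u 1 * r) (u + t) = Poly_Mapping.lookup r t" for t
    by metis
  then have "u + t \<in> Poly_Mapping.keys (Poly_Mapping.single u 1 * r)" if "t \<in> Poly_Mapping.keys r" for t
    using that by (simp add: in_keys_iff)
  moreover have "Poly_Mapping.keys (Poly_Mapping.single u 1 * r) \<subseteq> (\<lambda>t. u + t) ` Poly_Mapping.keys r"
    using keys_mult[of "Poly_Mapping.single u 1" r] by auto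
  ultimately show ?thesis by blast
qed

lemma poly_mapping_eq_sum_single:
  fixes r :: "'a \<Rightarrow>\<^sub>0 'b::comm_monoid_add"
  shows "r = (\<Sum>t\<in>Poly_Mapping.keys r. Poly_Mapping.single t (Poly_Mapping.lookup r t))"
proof (rule poly_mapping_eqI)
  fix k
  have "(\<Sum>t\<in>Poly_Mapping.keys r. Poly_Mapping.lookup r t when t = k) = Poly_Mapping.lookup r k"
    by (simp add: when_def in_keys_iff)
  then show "Poly_Mapping.lookup r k = Poly_Mapping.lookup (\<Sum>t\<in>Poly_Mapping.keys r. Poly_Mapping.single t (Poly_Mapping.lookup r t)) k"
    by (simp add: lookup_sum lookup_single)
qed

definition set_exponent :: "'v set \<Rightarrow> 'v \<Rightarrow>\<^sub>0 nat" where
  "set_exponent M = (\<Sum>a\<in>M. Poly_Mapping.single a 1)"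

lemma lookup_set_exponent: "finite M \<Longrightarrow> Poly_Mapping.lookup (set_exponent M) a = (if a \<in> M then 1 else 0)"
  by (simp add: set_exponent_def lookup_sum lookup_single when_def)

lemma keys_set_exponent: "finite M \<Longrightarrow> Poly_Mapping.keys (set_exponent M) = M"
  by (auto simp: in_keys_iff lookup_set_exponent split: if_splits)

lemma set_exponent_keys: "squarefree_monomial t \<Longrightarrow> set_exponent (Poly_Mapping.keys t) = t"
proof (rule poly_mapping_eqI)
  fix a
  assume "squarefree_monomial t"
  then have "Poly_Mapping.lookup t a \<le> 1" by (simp add: squarefree_monomial_def)
  then show "Poly_Mapping.lookup (set_exponent (Poly_Mapping.keys t)) a = Poly_Mapping.lookup t a"
    by (simp add: lookup_set_exponent in_keys_iff)
qed

text \<open>Membership is tested term by term on supports, which makes colon ideals and redundant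
  generators a matter of set difference and inclusion. The members of \<open>S\<close> are the
  supports of generators; they need not be minimal. \<open>squarefree_ideal_eq_genideal\<close>
  identifies the result with the generated ideal.\<close>

definition squarefree_ideal :: "'v set \<Rightarrow> 'v set set \<Rightarrow> (('v \<Rightarrow>\<^sub>0 nat) \<Rightarrow>\<^sub>0 'k::field) set" where
  "squarefree_ideal X S = {r \<in> carrier (poly_ring X). \<forall>t\<in>Poly_Mapping.keys r. \<exists>M\<in>S. M \<subseteq> Poly_Mapping.keys t}"

lemma squarefree_ideal_zero: "0 \<in> squarefree_ideal X S"
  by (simp add: squarefree_ideal_def)

lemma squarefree_ideal_add:
  "a \<in> squarefree_ideal X S \<Longrightarrow> b \<in> squarefree_ideal X S \<Longrightarrow> a + b \<in> squarefree_ideal X S"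
  using Poly_Mapping.keys_add[of a b] by (auto simp: squarefree_ideal_def)

lemma ideal_squarefree_ideal:
  "ideal (squarefree_ideal X S :: (('v \<Rightarrow>\<^sub>0 nat) \<Rightarrow>\<^sub>0 'k::field) set) (poly_ring X)"
proof -
  let ?R = "poly_ring X :: (('v \<Rightarrow>\<^sub>0 nat) \<Rightarrow>\<^sub>0 'k) ring"
  let ?J = "squarefree_ideal X S :: (('v \<Rightarrow>\<^sub>0 nat) \<Rightarrow>\<^sub>0 'k) set"
  interpret cring ?R by (rule poly_ring_cring)
  have mult: "x * a \<in> ?J" if a: "a \<in> ?J" and x: "x \<in> carrier ?R" for a x
  proof -
    have "\<exists>M\<in>S. M \<subseteq> Poly_Mapping.keys t" if t: "t \<in> Poly_Mapping.keys (x * a)" for t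
    proof -
      obtain u v where "t = u + v" "v \<in> Poly_Mapping.keys a" using keys_mult[of x a] t by blast
      moreover from this obtain M where "M \<in> S" "M \<subseteq> Poly_Mapping.keys v"
        using a by (auto simp: squarefree_ideal_def)
      ultimately show ?thesis by (auto simp: keys_plus_nat)
    qed
    then show ?thesis using a x by (simp add: squarefree_ideal_def)
  qed
  have sub: "?J \<subseteq> carrier ?R" by (auto simp: squarefree_ideal_def)
  show ?thesis
  proof (rule idealI)
    show "subgroup ?J (add_monoid ?R)"
    proof (rule group.subgroupI)
      show "group (add_monoid ?R)" by (rule a_group)
      show "inv\<^bsub>add_monoid ?R\<^esub> a \<in> ?J" if a: "a \<in> ?J" for a
      proof -
        have "\<ominus>\<^bsub>?R\<^esub> a = - 1 * a" using a sub by (intro minus_equality) auto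
        then show ?thesis using mult[OF a, of "- 1"] by (simp add: a_inv_def)
      qed
    qed (use sub in \<open>auto intro: squarefree_ideal_zero squarefree_ideal_add\<close>)
  qed (use mult in \<open>auto simp: mult.commute ring_axioms\<close>)
qed

text \<open>Allows generators divisible by other generators to be discarded, as they arise when a
  colon ideal is formed.\<close>

lemma squarefree_ideal_cong:
  assumes "\<And>M. M \<in> S \<Longrightarrow> \<exists>N\<in>T. N \<subseteq> M" "\<And>N. N \<in> T \<Longrightarrow> \<exists>M\<in>S. M \<subseteq> N"
  shows "squarefree_ideal X S = squarefree_ideal X T"
proof -
  have "(\<exists>M\<in>S. M \<subseteq> K) \<longleftrightarrow> (\<exists>N\<in>T. N \<subseteq> K)" for K
    using assms by (meson order_trans)
  then show ?thesis by (simp add: squarefree_ideal_def)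
qed

lemma single_carrier: "Poly_Mapping.keys t \<subseteq> X \<Longrightarrow> Poly_Mapping.single t c \<in> carrier (poly_ring X)"
  by (simp add: poly_ring_carrier)

text \<open>This computes the colon ideal by the monomial with support \<open>M\<close>: its terms
  are shifted by \<open>M\<close>, and N lies in the union of \<open>M\<close> and K if and only if
  N - M lies in K.\<close>

lemma mult_mem_squarefree_ideal_iff:
  fixes r :: "('v \<Rightarrow>\<^sub>0 nat) \<Rightarrow>\<^sub>0 'k::field"
  assumes "r \<in> carrier (poly_ring X)" "finite M" "M \<subseteq> X"
  shows "Poly_Mapping.single (set_exponent M) 1 * r \<in> squarefree_ideal X S \<longleftrightarrow>
    r \<in> squarefree_ideal X ((\<lambda>N. N - M) ` S)"
  using assms poly_ring_closed(4)[OF single_carrier[of "set_exponent M" X 1] assms(1)]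
  by (auto simp: squarefree_ideal_def keys_single_times keys_plus_nat keys_set_exponent Diff_subset_conv)

lemma monomial_times:
  "finite M \<Longrightarrow> a \<in> M \<Longrightarrow> Poly_Mapping.single (set_exponent {a}) 1 * Poly_Mapping.single (set_exponent (M - {a})) 1
    = (Poly_Mapping.single (set_exponent M) 1 :: ('v \<Rightarrow>\<^sub>0 nat) \<Rightarrow>\<^sub>0 'k::field)"
  by (simp add: mult_single set_exponent_def sum.remove[of M a])

text \<open>A polynomial is the sum of its terms, and each term of a member satisfies the membership
  condition on its own.\<close>

lemma squarefree_ideal_subsetI:
  fixes L :: "(('v \<Rightarrow>\<^sub>0 nat) \<Rightarrow>\<^sub>0 'k::field) set"
  assumes "0 \<in> L" "\<And>a b. a \<in> L \<Longrightarrow> b \<in> L \<Longrightarrow> a + b \<in> L"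
    and "\<And>M t c. M \<in> S \<Longrightarrow> M \<subseteq> Poly_Mapping.keys t \<Longrightarrow> Poly_Mapping.keys t \<subseteq> X \<Longrightarrow> Poly_Mapping.single t c \<in> L"
  shows "squarefree_ideal X S \<subseteq> L"
proof
  fix r :: "('v \<Rightarrow>\<^sub>0 nat) \<Rightarrow>\<^sub>0 'k" assume r: "r \<in> squarefree_ideal X S"
  have "Poly_Mapping.single t (Poly_Mapping.lookup r t) \<in> L" if "t \<in> Poly_Mapping.keys r" for t
    using r that assms(3) by (auto simp: squarefree_ideal_def poly_ring_carrier)
  then have "(\<Sum>t\<in>T. Poly_Mapping.single t (Poly_Mapping.lookup r t)) \<in> L" if "T \<subseteq> Poly_Mapping.keys r" for T
    using that by (induction T rule: infinite_finite_induct) (use assms(1,2) in auto)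
  then show "r \<in> L" by (subst poly_mapping_eq_sum_single) blast
qed

lemma single_split:
  fixes c :: "'k::field"
  assumes "finite M" "M \<subseteq> Poly_Mapping.keys (t :: 'v \<Rightarrow>\<^sub>0 nat)"
  shows "Poly_Mapping.single t c =
    Poly_Mapping.single (set_exponent M) 1 * Poly_Mapping.single (t - set_exponent M) c"
proof -
  have "set_exponent M + (t - set_exponent M) = t"
  proof (rule poly_mapping_eqI)
    fix a
    have "a \<in> M \<Longrightarrow> Poly_Mapping.lookup t a \<noteq> 0" using assms(2) by (auto simp: in_keys_iff)
    then show "Poly_Mapping.lookup (set_exponent M + (t - set_exponent M)) a = Poly_Mapping.lookup t a"
      using assms(1) by (auto simp: lookup_add lookup_minus lookup_set_exponent)
  qed
  then show ?thesis by (simp add: mult_single)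
qed

lemma keys_diff_subset: "Poly_Mapping.keys (t - s :: 'v \<Rightarrow>\<^sub>0 nat) \<subseteq> Poly_Mapping.keys t"
  by (auto simp: in_keys_iff lookup_minus)

text \<open>Brings the ideal with one more generator into the shape that the mapping cone
  resolves.\<close>

lemma squarefree_ideal_insert:
  fixes X :: "'v set"
  assumes "finite M" "M \<subseteq> X"
  shows "(squarefree_ideal X (insert M S) :: (('v \<Rightarrow>\<^sub>0 nat) \<Rightarrow>\<^sub>0 'k::field) set) =
    {j + Poly_Mapping.single (set_exponent M) 1 * r | j r. j \<in> squarefree_ideal X S \<and> r \<in> carrier (poly_ring X)}"
    (is "?J = ?L")
proof
  let ?m = "Poly_Mapping.single (set_exponent M) 1 :: ('v \<Rightarrow>\<^sub>0 nat) \<Rightarrow>\<^sub>0 'k"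
  show "?J \<subseteq> ?L"
  proof (rule squarefree_ideal_subsetI)
    show "0 \<in> ?L" by (intro CollectI exI[of _ 0]) (simp add: squarefree_ideal_zero)
    fix a b assume "a \<in> ?L" "b \<in> ?L"
    then obtain j r j' r' where "a = j + ?m * r" "b = j' + ?m * r'" "j \<in> squarefree_ideal X S" "j' \<in> squarefree_ideal X S"
      "r \<in> carrier (poly_ring X)" "r' \<in> carrier (poly_ring X)" by blast
    moreover from this have "a + b = (j + j') + ?m * (r + r')" by (simp add: algebra_simps)
    ultimately show "a + b \<in> ?L"
      by (intro CollectI exI[of _ "j + j'"] exI[of _ "r + r'"]) (simp add: squarefree_ideal_add)
  next
    fix N and t :: "'v \<Rightarrow>\<^sub>0 nat" and c :: 'k
    assume N: "N \<in> insert M S" "N \<subseteq> Poly_Mapping.keys t" "Poly_Mapping.keys t \<subseteq> X"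
    show "Poly_Mapping.single t c \<in> ?L"
    proof (cases "N \<in> S")
      case True
      then have "Poly_Mapping.single t c \<in> squarefree_ideal X S"
        using N(2) single_carrier[OF N(3), of c] by (auto simp: squarefree_ideal_def)
      then show ?thesis
        by (intro CollectI exI[of _ "Poly_Mapping.single t c"] exI[of _ "0 :: ('v \<Rightarrow>\<^sub>0 nat) \<Rightarrow>\<^sub>0 'k"]) simp
    next
      case False
      then have "Poly_Mapping.single t c = 0 + ?m * Poly_Mapping.single (t - set_exponent M) c"
        using N assms(1) single_split[of M t c] by simp
      moreover have "Poly_Mapping.single (t - set_exponent M) c \<in> carrier (poly_ring X)"
        using N(3) keys_diff_subset[of t "set_exponent M"] by (intro single_carrier) auto
      ultimately show ?thesis
        by (intro CollectI exI[of _ 0] exI[of _ "Poly_Mapping.single (t - set_exponent M) c"]) (simp add: squarefree_ideal_zero)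
    qed
  qed
  show "?L \<subseteq> ?J"
  proof clarify
    fix j r :: "('v \<Rightarrow>\<^sub>0 nat) \<Rightarrow>\<^sub>0 'k"
    assume j: "j \<in> squarefree_ideal X S" and r: "r \<in> carrier (poly_ring X)"
    have "?m \<in> ?J" using assms single_carrier[of "set_exponent M" X 1]
      by (auto simp: squarefree_ideal_def keys_set_exponent)
    then have "?m * r \<in> ?J" using ideal.I_r_closed[OF ideal_squarefree_ideal _ r] by simp
    moreover have "j \<in> ?J" using j by (auto simp: squarefree_ideal_def)
    ultimately show "j + ?m * r \<in> ?J" by (simp add: squarefree_ideal_add)
  qed
qed

lemma squarefree_ideal_eq_genideal:
  fixes X :: "'v set"
  assumes "\<And>M. M \<in> S \<Longrightarrow> finite M \<and> M \<subseteq> X"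
  shows "(squarefree_ideal X S :: (('v \<Rightarrow>\<^sub>0 nat) \<Rightarrow>\<^sub>0 'k::field) set) = Idl\<^bsub>poly_ring X\<^esub> ((\<lambda>M. Poly_Mapping.single (set_exponent M) 1) ` S)"
    (is "?J = ?I")
proof
  let ?m = "\<lambda>M. Poly_Mapping.single (set_exponent M) 1 :: ('v \<Rightarrow>\<^sub>0 nat) \<Rightarrow>\<^sub>0 'k"
  interpret cring "poly_ring X :: (('v \<Rightarrow>\<^sub>0 nat) \<Rightarrow>\<^sub>0 'k) ring" by (rule poly_ring_cring)
  have m: "?m ` S \<subseteq> carrier (poly_ring X)"
  proof clarify
    fix M assume "M \<in> S"
    then show "?m M \<in> carrier (poly_ring X)"
      using assms[of M] by (intro single_carrier) (simp add: keys_set_exponent)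
  qed
  interpret I: ideal ?I "poly_ring X" by (rule genideal_ideal[OF m])
  have mI: "?m M \<in> ?I" if "M \<in> S" for M using genideal_self[OF m] that by blast
  show "?J \<subseteq> ?I"
  proof (rule squarefree_ideal_subsetI)
    show "0 \<in> ?I" using I.zero_closed by simp
    show "a + b \<in> ?I" if "a \<in> ?I" "b \<in> ?I" for a b using I.a_closed[OF that] by simp
    fix M and t :: "'v \<Rightarrow>\<^sub>0 nat" and c :: 'k
    assume M: "M \<in> S" "M \<subseteq> Poly_Mapping.keys t" "Poly_Mapping.keys t \<subseteq> X"
    have "Poly_Mapping.single (t - set_exponent M) c \<in> carrier (poly_ring X)"
      using M(3) keys_diff_subset[of t "set_exponent M"] by (intro single_carrier) auto
    then have "?m M * Poly_Mapping.single (t - set_exponent M) c \<in> ?I"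
      using I.I_r_closed[OF mI[OF M(1)]] by simp
    then show "Poly_Mapping.single t c \<in> ?I"
      using single_split[of M t c] assms M by simp
  qed
  show "?I \<subseteq> ?J"
  proof (rule genideal_minimal[OF ideal_squarefree_ideal])
    show "?m ` S \<subseteq> ?J"
      using assms m by (auto simp: squarefree_ideal_def keys_set_exponent)
  qed
qed

section \<open>Resolving the ideal of a string generator by generator\<close>

text \<open>The index type is fixed to the one prescribed by \<open>proj_dim\<close>, and forming
  cones does not leave it, thanks to the even and odd copies.\<close>

definition minimally_resolved :: "'v set \<Rightarrow> (('v \<Rightarrow>\<^sub>0 nat) \<Rightarrow>\<^sub>0 'k::field) set \<Rightarrow> nat \<Rightarrow> bool" where
  "minimally_resolved X J p \<longleftrightarrow>
     (\<exists>(B :: nat \<Rightarrow> ((('v \<Rightarrow>\<^sub>0 nat) \<Rightarrow>\<^sub>0 'k) set \<times> nat) set) d. minimal_resolution X J B d p)"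

lemma minimally_resolved_empty:
  fixes X :: "'v set"
  shows "minimally_resolved X (squarefree_ideal X {} :: (('v \<Rightarrow>\<^sub>0 nat) \<Rightarrow>\<^sub>0 'k::field) set) 0"
proof -
  let ?B = "\<lambda>i::nat. if i = 0 then {(undefined :: (('v \<Rightarrow>\<^sub>0 nat) \<Rightarrow>\<^sub>0 'k) set, 0 :: nat)} else {}"
  have zero: "squarefree_ideal X {} = {0 :: ('v \<Rightarrow>\<^sub>0 nat) \<Rightarrow>\<^sub>0 'k}" by (auto simp: squarefree_ideal_def)
  have empty: "carrier (free_module (poly_ring X :: (('v \<Rightarrow>\<^sub>0 nat) \<Rightarrow>\<^sub>0 'k) ring)
      ({} :: ((('v \<Rightarrow>\<^sub>0 nat) \<Rightarrow>\<^sub>0 'k) set \<times> nat) set)) = {\<lambda>_. 0}"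
    by (auto simp: free_poly_module_carrier simp del: split_paired_All)
  have base: "{x \<in> carrier (free_module (poly_ring X :: (('v \<Rightarrow>\<^sub>0 nat) \<Rightarrow>\<^sub>0 'k) ring) {b}). x b = 0} = {\<lambda>_. 0}"
    for b :: "(('v \<Rightarrow>\<^sub>0 nat) \<Rightarrow>\<^sub>0 'k) set \<times> nat"
    by (auto simp: free_poly_module_carrier fun_eq_iff simp del: split_paired_All)
  have "minimal_resolution X (squarefree_ideal X {} :: (('v \<Rightarrow>\<^sub>0 nat) \<Rightarrow>\<^sub>0 'k) set) ?B (\<lambda>_ _ _. 0) 0"
    by (simp add: minimal_resolution_def free_poly_module_hom_iff empty base zero)
       (simp add: free_poly_module_carrier)
  then show ?thesis unfolding minimally_resolved_def by blast
qed

lemma minimally_resolved_insert: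
  fixes X :: "'v set"
  assumes "minimally_resolved X (squarefree_ideal X S :: (('v \<Rightarrow>\<^sub>0 nat) \<Rightarrow>\<^sub>0 'k::field) set) p"
    and "minimally_resolved X (squarefree_ideal X ((\<lambda>N. N - M) ` S) :: (('v \<Rightarrow>\<^sub>0 nat) \<Rightarrow>\<^sub>0 'k) set) p'"
    and M: "finite M" "M \<subseteq> X" "a \<in> M" "\<And>N. N \<in> S \<Longrightarrow> a \<notin> N"
  shows "minimally_resolved X (squarefree_ideal X (insert M S) :: (('v \<Rightarrow>\<^sub>0 nat) \<Rightarrow>\<^sub>0 'k) set) (max p (Suc p'))"
proof -
  let ?y = "Poly_Mapping.single (set_exponent {a}) 1 :: ('v \<Rightarrow>\<^sub>0 nat) \<Rightarrow>\<^sub>0 'k"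
  let ?w = "Poly_Mapping.single (set_exponent (M - {a})) 1 :: ('v \<Rightarrow>\<^sub>0 nat) \<Rightarrow>\<^sub>0 'k"
  let ?J = "squarefree_ideal X S :: (('v \<Rightarrow>\<^sub>0 nat) \<Rightarrow>\<^sub>0 'k) set"
  let ?J' = "squarefree_ideal X ((\<lambda>N. N - M) ` S) :: (('v \<Rightarrow>\<^sub>0 nat) \<Rightarrow>\<^sub>0 'k) set"
  have yw: "?y * ?w = Poly_Mapping.single (set_exponent M) 1" by (rule monomial_times[OF M(1,3)])
  \<comment> \<open>As the variable a divides no generator in \<open>S\<close>, removing it from
    \<open>M\<close> does not change the colon ideal. Hence multiplication by \<open>?w\<close>
    alone already maps \<open>?J'\<close> into \<open>?J\<close>, and \<open>?y\<close> is left over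
    as the factor without constant term.\<close>
  have img: "(\<lambda>N. N - (M - {a})) ` S = (\<lambda>N. N - M) ` S" using M(4) by (intro image_cong) auto
  obtain B d where F: "minimal_resolution X ?J (B :: nat \<Rightarrow> ((('v \<Rightarrow>\<^sub>0 nat) \<Rightarrow>\<^sub>0 'k) set \<times> nat) set) d p"
    using assms(1) unfolding minimally_resolved_def by blast
  obtain B' d' where F': "minimal_resolution X ?J' (B' :: nat \<Rightarrow> ((('v \<Rightarrow>\<^sub>0 nat) \<Rightarrow>\<^sub>0 'k) set \<times> nat) set) d' p'"
    using assms(2) unfolding minimally_resolved_def by blast
  have "set_exponent {a} \<noteq> 0"
    using lookup_set_exponent[of "{a}" a] by auto
  then have y0: "Poly_Mapping.lookup ?y 0 = 0" by (simp add: lookup_single)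
  have yc: "?y \<in> carrier (poly_ring X)" and wc: "?w \<in> carrier (poly_ring X)"
    using M(1-3) by (auto intro!: single_carrier simp: keys_set_exponent)
  obtain BG D where "minimal_resolution X {j + ?y * ?w * r | j r. j \<in> ?J \<and> r \<in> carrier (poly_ring X)}
      (BG :: nat \<Rightarrow> ((('v \<Rightarrow>\<^sub>0 nat) \<Rightarrow>\<^sub>0 'k) set \<times> nat) set) D (max p (Suc p'))"
  proof (rule mapping_cone_minimal_resolution[OF F F' yc y0 wc _ _ ideal_squarefree_ideal])
    show "r \<in> ?J'" if "r \<in> carrier (poly_ring X)" "?y * ?w * r \<in> ?J" for r
      using that mult_mem_squarefree_ideal_iff[OF that(1) M(1,2)] unfolding yw by blast
    show "?w * r \<in> ?J" if "r \<in> carrier (poly_ring X)" "r \<in> ?J'" for r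
      using that(2) mult_mem_squarefree_ideal_iff[OF that(1), of "M - {a}" S] M(1,2) unfolding img by blast
  qed
  then show ?thesis
    unfolding minimally_resolved_def squarefree_ideal_insert[OF M(1,2)] yw by blast
qed

text \<open>Adding generator \<open>Suc k\<close> tests the vertex k before it, so
  \<open>string_pd cl k\<close> depends on \<open>cl\<close> only at vertices below k. If vertex 1
  is closed, the second branch is reached only with k at least 2, where \<open>k - 2\<close> is a
  true difference.\<close>

fun string_pd :: "(nat \<Rightarrow> bool) \<Rightarrow> nat \<Rightarrow> nat" where
  "string_pd cl 0 = 0"
| "string_pd cl (Suc k) = (if k = 0 \<or> cl k then Suc (string_pd cl k)
     else max (string_pd cl k) (string_pd cl (k - 2) + 2))"

text \<open>
  The generators are the products of the variables in the sets \<open>M i\<close>. Removing the last generator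
  leaves a string with a closed last vertex. The colon ideal is again a string of length \<open>k\<close> if
  vertex \<open>k\<close> is closed; otherwise \<open>M k - M (Suc k)\<close> divides \<open>M (k - 1)\<close> and is coprime to the
  remaining generators.
\<close>

lemma minimally_resolved_string:
  fixes M :: "nat \<Rightarrow> 'v set"
  assumes "\<And>i. finite (M i)" "\<And>i. M i \<subseteq> X" "M 0 = {}"
    and "\<And>i j. i + 2 \<le> j \<Longrightarrow> j \<le> k \<Longrightarrow> M i \<inter> M j = {}"
    and "\<And>i. 1 \<le> i \<Longrightarrow> i < k \<Longrightarrow> M i \<inter> M (Suc i) \<noteq> {}"
    and "\<And>i. 1 \<le> i \<Longrightarrow> i < k \<Longrightarrow> cl i \<longleftrightarrow> \<not> M i \<subseteq> M (i - 1) \<union> M (Suc i)"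
    and "1 < k \<Longrightarrow> cl 1" "1 \<le> k \<Longrightarrow> \<not> M k \<subseteq> M (k - 1)"
  shows "minimally_resolved X (squarefree_ideal X (M ` {1..k}) :: (('v \<Rightarrow>\<^sub>0 nat) \<Rightarrow>\<^sub>0 'k::field) set) (string_pd cl k)"
  using assms
proof (induction k arbitrary: M rule: less_induct)
  case (less k)
  note fin = less.prems(1) and sub = less.prems(2) and M0 = less.prems(3) and disj = less.prems(4)
    and edge = less.prems(5) and cl = less.prems(6) and cl1 = less.prems(7) and last = less.prems(8)
  have initial: "minimally_resolved X (squarefree_ideal X (M ` {1..l}) :: (('v \<Rightarrow>\<^sub>0 nat) \<Rightarrow>\<^sub>0 'k) set) (string_pd cl l)"
    if l: "l < k" for l
  proof (rule less.IH[OF l])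
    \<comment> \<open>Dropping the generators beyond l closes vertex l: a variable shared with
      \<open>M (Suc l)\<close> is not in \<open>M (l - 1)\<close>, since these two supports are
      disjoint.\<close>
    show "\<not> M l \<subseteq> M (l - 1)" if "1 \<le> l"
      using edge[OF that l] disj[of "l - 1" "Suc l"] that l by auto
  qed (use l fin sub M0 disj edge cl cl1 in auto)
  show ?case
  proof (cases k)
    case 0
    then show ?thesis using minimally_resolved_empty by simp
  next
    case (Suc j)
    let ?S = "M ` {1..j}"
    obtain a where a: "a \<in> M k" "a \<notin> M j" using last Suc by auto
    have aS: "a \<notin> N" if "N \<in> ?S" for N
    proof -
      from that obtain i where i: "1 \<le> i" "i \<le> j" "N = M i" by auto
      show ?thesis using a disj[of i k] i Suc by (cases "i = j") auto
    qed
    have ins: "M ` {1..k} = insert (M k) ?S" using Suc by (auto simp: atLeastAtMostSuc_conv)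
    have step: "minimally_resolved X (squarefree_ideal X (M ` {1..k}) :: (('v \<Rightarrow>\<^sub>0 nat) \<Rightarrow>\<^sub>0 'k) set) (max (string_pd cl j) (Suc p'))"
      if "minimally_resolved X (squarefree_ideal X ((\<lambda>N. N - M k) ` ?S) :: (('v \<Rightarrow>\<^sub>0 nat) \<Rightarrow>\<^sub>0 'k) set) p'" for p'
      unfolding ins using minimally_resolved_insert[OF initial that fin sub a(1) aS] Suc by simp
    have far: "M i - M k = M i" if "i < j" for i
      using disj[of i k] that Suc by auto
    show ?thesis
    proof (cases "j = 0 \<or> cl j")
      case closed: True
      \<comment> \<open>Only the neighbour of k is affected by the colon. Vertex j being closed,
        \<open>M j - M k\<close> keeps a variable outside \<open>M (j - 1)\<close>, so the new
        family is again a string. Openness of the earlier vertices is unchanged because their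
        supports do not meet \<open>M k\<close>.\<close>
      let ?M = "M(j := M j - M k)"
      have "(\<lambda>N. N - M k) ` ?S = ?M ` {1..j}"
        unfolding image_image using far by (intro image_cong refl) auto
      moreover have "minimally_resolved X (squarefree_ideal X (?M ` {1..j}) :: (('v \<Rightarrow>\<^sub>0 nat) \<Rightarrow>\<^sub>0 'k) set) (string_pd cl j)"
      proof (rule less.IH)
        show "j < k" using Suc by simp
        show "?M i \<inter> ?M (Suc i) \<noteq> {}" if i: "1 \<le> i" "i < j" for i
          using edge[of i] disj[of i k] i Suc by (cases "Suc i = j") auto
        show "cl i \<longleftrightarrow> \<not> ?M i \<subseteq> ?M (i - 1) \<union> ?M (Suc i)" if i: "1 \<le> i" "i < j" for i
          using cl[of i] disj[of i k] i Suc by (cases "Suc i = j") auto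
        show "\<not> ?M j \<subseteq> ?M (j - 1)" if "1 \<le> j"
          using closed cl[of j] that Suc by auto
        show "?M i \<inter> ?M i' = {}" if "i + 2 \<le> i'" "i' \<le> j" for i i'
          using disj[of i i'] that Suc by auto
      qed (use fin sub M0 cl1 Suc in auto)
      ultimately have "minimally_resolved X (squarefree_ideal X (M ` {1..k}) :: (('v \<Rightarrow>\<^sub>0 nat) \<Rightarrow>\<^sub>0 'k) set)
          (max (string_pd cl j) (Suc (string_pd cl j)))"
        using step[of "string_pd cl j"] by (simp only:)
      then show ?thesis using closed Suc by (auto simp: max_def)
    next
      case False
      then have j: "2 \<le> j" using cl1 Suc by (cases "j = 1") auto
      let ?E = "M j - M k"
      \<comment> \<open>Openness of j places everything that remains of \<open>M j\<close> inside
        \<open>M (j - 1)\<close>, which makes that generator redundant. The set \<open>?E\<close> is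
        nonempty because a variable shared by \<open>M (j - 1)\<close> and \<open>M j\<close> cannot
        lie in \<open>M k\<close>.\<close>
      have E: "?E \<subseteq> M (j - 1)" using False cl[of j] j Suc by auto
      have "M (j - 1) \<inter> M j \<noteq> {}" using edge[of "j - 1"] j Suc by simp
      then have E': "?E \<noteq> {}" using disj[of "j - 1" k] j Suc by auto
      then obtain e where e: "e \<in> ?E" by blast
      let ?T = "M ` {1..j - 2}"
      have ET: "N - ?E = N" "e \<notin> N" if "N \<in> ?T" for N
      proof -
        from that obtain i where i: "1 \<le> i" "i \<le> j - 2" "N = M i" by auto
        then have "M i \<inter> M j = {}" using disj[of i j] Suc j by simp
        then show "N - ?E = N" "e \<notin> N" using i(3) e by auto
      qed
      \<comment> \<open>Since \<open>?E\<close> is disjoint from the members of \<open>?T\<close>,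
        the colon of the ideal of \<open>?T\<close> by it is the same ideal, and the cone lengthens
        the resolution by exactly one.\<close>
      have "minimally_resolved X (squarefree_ideal X (insert ?E ?T) :: (('v \<Rightarrow>\<^sub>0 nat) \<Rightarrow>\<^sub>0 'k) set)
          (max (string_pd cl (j - 2)) (Suc (string_pd cl (j - 2))))"
      proof (rule minimally_resolved_insert)
        show "minimally_resolved X (squarefree_ideal X ?T :: (('v \<Rightarrow>\<^sub>0 nat) \<Rightarrow>\<^sub>0 'k) set) (string_pd cl (j - 2))"
          using Suc by (intro initial) auto
        then show "minimally_resolved X (squarefree_ideal X ((\<lambda>N. N - ?E) ` ?T) :: (('v \<Rightarrow>\<^sub>0 nat) \<Rightarrow>\<^sub>0 'k) set) (string_pd cl (j - 2))"
          using ET by (simp cong: image_cong)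
      qed (use e ET(2) fin sub[of j] in auto)
      moreover have "(squarefree_ideal X ((\<lambda>N. N - M k) ` ?S) :: (('v \<Rightarrow>\<^sub>0 nat) \<Rightarrow>\<^sub>0 'k) set) = squarefree_ideal X (insert ?E ?T)"
      proof (rule squarefree_ideal_cong)
        fix N assume "N \<in> (\<lambda>N. N - M k) ` ?S"
        then obtain i where i: "1 \<le> i" "i \<le> j" "N = M i - M k" by auto
        consider "i = j" | "i = j - 1" | "i \<le> j - 2" using i by linarith
        then show "\<exists>N'\<in>insert ?E ?T. N' \<subseteq> N"
        proof cases
          case 2
          then have "?E \<subseteq> N" using E i far[of i] j by simp
          then show ?thesis by blast
        next
          case 3
          then have "N = M i" using i far[of i] j by simp
          then show ?thesis using 3 i by auto
        qed (use i in auto)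
      next
        fix N assume "N \<in> insert ?E ?T"
        then consider "N = ?E" | i where "1 \<le> i" "i \<le> j - 2" "N = M i" by auto
        then have "N \<in> (\<lambda>N. N - M k) ` ?S"
        proof cases
          case 1
          then show ?thesis using j by auto
        next
          case 2
          then have "N = M i - M k" using far[of i] j by simp
          then show ?thesis using 2 j by auto
        qed
        then show "\<exists>N'\<in>(\<lambda>N. N - M k) ` ?S. N' \<subseteq> N" by blast
      qed
      ultimately have "minimally_resolved X (squarefree_ideal X (M ` {1..k}) :: (('v \<Rightarrow>\<^sub>0 nat) \<Rightarrow>\<^sub>0 'k) set)
          (max (string_pd cl j) (Suc (Suc (string_pd cl (j - 2)))))"
        using step by (simp add: max_def)
      then show ?thesis using False Suc by simp
    qed
  qed
qed

section \<open>Packings of 2-special configurations\<close>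

text \<open>The conditions on \<delta> say that p (a - 1) \<le> p a \<le> p (a - 1) + 1. Under them
  the second argument attains every maximum along the run, so p grows by 2 every three vertices,
  with the three starting values p a + 1, p (a - 1) + 2 and p a + 2.\<close>

lemma string_pd_run:
  assumes "cl a" "1 \<le> a" "\<forall>v\<in>{a<..<k}. \<not> cl v"
    and \<delta>: "string_pd cl (a - 1) + 1 = string_pd cl a + \<delta>" "\<delta> \<le> 1"
  shows "a + 3 * i + 1 \<le> k \<Longrightarrow> string_pd cl (a + 3 * i + 1) = string_pd cl a + 2 * i + 1"
    and "a + 3 * i + 2 \<le> k \<Longrightarrow> string_pd cl (a + 3 * i + 2) = string_pd cl (a - 1) + 2 * i + 2"
    and "a + 3 * i + 3 \<le> k \<Longrightarrow> string_pd cl (a + 3 * i + 3) = string_pd cl a + 2 * i + 2"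
proof -
  let ?p = "string_pd cl"
  \<comment> \<open>The recursion indexed by the earliest vertex u, so that no subtraction is
    left.\<close>
  have open_step: "?p w = max (?p v) (?p u + 2)" if "w = Suc (u + 2)" "v = u + 2" "a < v" "w \<le> k" for u v w
  proof -
    have "\<not> cl v" using assms(3) that by simp
    then show ?thesis unfolding that(1,2) by simp
  qed
  \<comment> \<open>For i = 0 the recursion reaches back beyond the closed vertex a to p (a - 1);
    this is how that value enters.\<close>
  have two: "?p (a + 3 * i + 2) = ?p (a - 1) + 2 * i + 2"
    if "a + 3 * i + 2 \<le> k" "?p (a + 3 * i + 1) = ?p a + 2 * i + 1"
      "?p (a + 3 * i - 1) = ?p (a - 1) + 2 * i" for i
  proof -
    have "?p (a + 3 * i + 2) = max (?p (a + 3 * i + 1)) (?p (a + 3 * i - 1) + 2)"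
      using that(1) assms(2) by (intro open_step) auto
    then show ?thesis using that(2,3) \<delta> by linarith
  qed
  have three: "?p (a + 3 * i + 3) = ?p a + 2 * i + 2"
    if "a + 3 * i + 3 \<le> k" "?p (a + 3 * i + 2) = ?p (a - 1) + 2 * i + 2"
      "?p (a + 3 * i) = ?p a + 2 * i" for i
  proof -
    have "?p (a + 3 * i + 3) = max (?p (a + 3 * i + 2)) (?p (a + 3 * i) + 2)"
      using that(1) by (intro open_step) auto
    then show ?thesis using that(2,3) \<delta> by linarith
  qed
  have *: "(a + 3 * i + 1 \<le> k \<longrightarrow> ?p (a + 3 * i + 1) = ?p a + 2 * i + 1) \<and>
    (a + 3 * i + 2 \<le> k \<longrightarrow> ?p (a + 3 * i + 2) = ?p (a - 1) + 2 * i + 2) \<and>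
    (a + 3 * i + 3 \<le> k \<longrightarrow> ?p (a + 3 * i + 3) = ?p a + 2 * i + 2)" for i
  proof (induction i)
    case 0
    have one: "?p (a + 1) = ?p a + 1" using assms(1) by simp
    show ?case using one two[of 0] three[of 0] by auto
  next
    case (Suc i)
    have eqs: "a + 3 * Suc i = a + 3 * i + 3" "a + 3 * Suc i - 1 = a + 3 * i + 2" by auto
    have one: "?p (a + 3 * Suc i + 1) = ?p a + 2 * Suc i + 1" if "a + 3 * Suc i + 1 \<le> k"
    proof -
      have "?p (a + 3 * Suc i + 1) = max (?p (a + 3 * i + 3)) (?p (a + 3 * i + 1) + 2)"
        using that by (intro open_step) auto
      then show ?thesis using Suc.IH that by (simp add: max_def)
    qed
    have p: "?p (a + 3 * Suc i) = ?p a + 2 * Suc i" "?p (a + 3 * Suc i - 1) = ?p (a - 1) + 2 * Suc i"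
      if "a + 3 * Suc i + 1 \<le> k"
      using Suc.IH that unfolding eqs by simp_all
    have two': "?p (a + 3 * Suc i + 2) = ?p (a - 1) + 2 * Suc i + 2" if "a + 3 * Suc i + 2 \<le> k"
      using that by (intro two one p(2)) auto
    have three': "?p (a + 3 * Suc i + 3) = ?p a + 2 * Suc i + 2" if "a + 3 * Suc i + 3 \<le> k"
      using that by (intro three two' p(1)) auto
    show ?case using one two' three' by blast
  qed
  show "a + 3 * i + 1 \<le> k \<Longrightarrow> ?p (a + 3 * i + 1) = ?p a + 2 * i + 1"
    "a + 3 * i + 2 \<le> k \<Longrightarrow> ?p (a + 3 * i + 2) = ?p (a - 1) + 2 * i + 2"
    "a + 3 * i + 3 \<le> k \<Longrightarrow> ?p (a + 3 * i + 3) = ?p a + 2 * i + 2"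
    using *[of i] by auto
qed

section \<open>Chains, configurations and packings on initial segments\<close>

text \<open>
  \<open>open_chain H k t\<close>: the list \<open>t\<close> ends at vertex \<open>k\<close> and becomes a 2-special configuration as
  soon as a string whose number of opens is 1 modulo 3 is appended.
\<close>

inductive open_chain :: "nat set set \<Rightarrow> nat \<Rightarrow> (nat \<times> nat) list \<Rightarrow> bool" for H where
  start: "\<sigma> \<in> strings_of_opens H \<Longrightarrow> num_opens \<sigma> mod 3 = 1 \<Longrightarrow> open_chain H (snd \<sigma>) [\<sigma>]"
| snoc: "open_chain H (fst \<sigma>) t \<Longrightarrow> \<sigma> \<in> strings_of_opens H \<Longrightarrow> num_opens \<sigma> mod 3 = 2 \<Longrightarrow>
    open_chain H (snd \<sigma>) (t @ [\<sigma>])"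

lemma string_fst_less_snd: "\<sigma> \<in> strings_of_opens H \<Longrightarrow> fst \<sigma> < snd \<sigma>"
  by (auto simp: strings_of_opens_def)

lemma open_vertices_nonempty: "\<sigma> \<in> strings_of_opens H \<Longrightarrow> open_vertices \<sigma> \<noteq> {}"
  by (auto simp: strings_of_opens_def open_vertices_def)

lemma open_chain_properties:
  assumes "open_chain H k t"
  shows "t \<noteq> [] \<and> set t \<subseteq> strings_of_opens H \<and> (\<forall>i. i + 1 < length t \<longrightarrow> snd (t ! i) = fst (t ! (i + 1))) \<and>
    num_opens (hd t) mod 3 = 1 \<and> (\<forall>i. 0 < i \<and> i < length t \<longrightarrow> num_opens (t ! i) mod 3 = 2) \<and>
    snd (last t) = k \<and> (\<forall>\<sigma>\<in>set t. snd \<sigma> \<le> k)"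
  using assms
proof induction
  case (start \<sigma>)
  then show ?case by auto
next
  case (snoc \<sigma> t)
  have "snd ((t @ [\<sigma>]) ! i) = fst ((t @ [\<sigma>]) ! (i + 1))" if i: "i + 1 < length (t @ [\<sigma>])" for i
  proof (cases "i + 1 < length t")
    case True
    then show ?thesis using snoc.IH by (simp add: nth_append)
  next
    case False
    then have [simp]: "i = length t - 1" "t \<noteq> []" using i snoc.IH by auto
    then show ?thesis using snoc.IH by (simp add: nth_append last_conv_nth)
  qed
  moreover have "num_opens ((t @ [\<sigma>]) ! i) mod 3 = 2" if "0 < i" "i < length (t @ [\<sigma>])" for i
    using that snoc by (cases "i < length t") (auto simp: nth_append less_Suc_eq)
  moreover have "snd \<tau> \<le> snd \<sigma>" if "\<tau> \<in> set (t @ [\<sigma>])" for \<tau>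
    using that snoc.IH string_fst_less_snd[OF snoc.hyps(2)] by fastforce
  ultimately show ?case using snoc by auto
qed

lemma open_chainI:
  assumes "t \<noteq> []" "set t \<subseteq> strings_of_opens H" "\<And>i. i + 1 < length t \<Longrightarrow> snd (t ! i) = fst (t ! (i + 1))"
    "num_opens (hd t) mod 3 = 1" "\<And>i. 0 < i \<Longrightarrow> i < length t \<Longrightarrow> num_opens (t ! i) mod 3 = 2"
  shows "open_chain H (snd (last t)) t"
  using assms
proof (induction t rule: rev_nonempty_induct)
  case (single \<sigma>)
  then show ?case using open_chain.start by simp
next
  case (snoc \<sigma> t)
  have "open_chain H (snd (last t)) t"
  proof (rule snoc.IH)
    show "snd (t ! i) = fst (t ! (i + 1))" if "i + 1 < length t" for i
      using snoc.prems(2)[of i] that by (simp add: nth_append)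
    show "num_opens (t ! i) mod 3 = 2" if "0 < i" "i < length t" for i
      using snoc.prems(4)[of i] that by (simp add: nth_append)
  qed (use snoc in auto)
  moreover have "snd (last t) = fst \<sigma>"
    using snoc.prems(2)[of "length t - 1"] snoc.hyps by (simp add: nth_append last_conv_nth)
  moreover have "num_opens \<sigma> mod 3 = 2" using snoc.prems(4)[of "length t"] snoc.hyps by simp
  ultimately show ?case using open_chain.snoc[of H \<sigma> t] snoc.prems by simp
qed

text \<open>Splitting off the last string recasts the indexed description as a chain plus a closing
  string, the form needed to build configurations from left to right.\<close>

lemma two_special_iff:
  "two_special H c \<longleftrightarrow>
    (\<exists>t \<sigma>. c = t @ [\<sigma>] \<and> open_chain H (fst \<sigma>) t \<and> \<sigma> \<in> strings_of_opens H \<and> num_opens \<sigma> mod 3 = 1)"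
proof
  assume c: "two_special H c"
  then have len: "2 \<le> length c" by (simp add: two_special_def)
  define t \<sigma> where "t = butlast c" and "\<sigma> = last c"
  have ct: "c = t @ [\<sigma>]" unfolding t_def \<sigma>_def using len by (intro append_butlast_last_id[symmetric]) auto
  have t: "t \<noteq> []" using len ct by auto
  have "open_chain H (snd (last t)) t"
  proof (rule open_chainI[OF t])
    show "snd (t ! i) = fst (t ! (i + 1))" if "i + 1 < length t" for i
    proof -
      have "snd (c ! i) = fst (c ! (i + 1))" using c that ct by (auto simp: two_special_def)
      then show ?thesis using that by (simp add: ct nth_append)
    qed
    show "num_opens (t ! i) mod 3 = 2" if "0 < i" "i < length t" for i
    proof -
      have "num_opens (c ! i) mod 3 = 2" using c that ct by (auto simp: two_special_def)
      then show ?thesis using that by (simp add: ct nth_append)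
    qed
  qed (use c t in \<open>auto simp: two_special_def ct\<close>)
  moreover have "snd (last t) = fst \<sigma>"
  proof -
    have "length t - 1 + 1 < length c" using t by (simp add: ct)
    then have "snd (c ! (length t - 1)) = fst (c ! (length t - 1 + 1))" using c unfolding two_special_def by blast
    then show ?thesis using t by (simp add: ct nth_append last_conv_nth)
  qed
  ultimately show "\<exists>t \<sigma>. c = t @ [\<sigma>] \<and> open_chain H (fst \<sigma>) t \<and> \<sigma> \<in> strings_of_opens H \<and> num_opens \<sigma> mod 3 = 1"
    using c ct by (auto simp: two_special_def)
next
  assume "\<exists>t \<sigma>. c = t @ [\<sigma>] \<and> open_chain H (fst \<sigma>) t \<and> \<sigma> \<in> strings_of_opens H \<and> num_opens \<sigma> mod 3 = 1"
  then obtain t \<sigma> where c: "c = t @ [\<sigma>]" and t: "open_chain H (fst \<sigma>) t"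
    and \<sigma>: "\<sigma> \<in> strings_of_opens H" "num_opens \<sigma> mod 3 = 1" by blast
  note p = open_chain_properties[OF t]
  have "snd (c ! i) = fst (c ! (i + 1))" if i: "i + 1 < length c" for i
  proof (cases "i + 1 < length t")
    case True
    then show ?thesis using p by (simp add: nth_append c)
  next
    case False
    then have "i = length t - 1" using i c by simp
    then show ?thesis using p last_conv_nth[of t] by (auto simp: nth_append c)
  qed
  moreover have "num_opens (c ! i) mod 3 = 2" if "0 < i" "i + 1 < length c" for i
    using that p by (simp add: c nth_append)
  moreover have "2 \<le> length c" using p by (cases t) (auto simp: c)
  ultimately show "two_special H c" using p \<sigma> by (auto simp: two_special_def c)
qed

text \<open>A configuration is located by the end of its last string alone, since its strings run
  from left to right (\<open>two_special_snd_le\<close>).\<close>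

definition packing_upto :: "nat set set \<Rightarrow> nat \<Rightarrow> (nat \<times> nat) list set \<Rightarrow> bool" where
  "packing_upto H k C \<longleftrightarrow> C \<subseteq> {c. two_special H c} \<and> pairwise disjoint_configurations C \<and>
     (\<forall>c\<in>C. snd (last c) \<le> k)"

definition b_upto :: "nat set set \<Rightarrow> nat \<Rightarrow> nat" where
  "b_upto H k = (\<Sum>\<sigma>\<in>{\<sigma> \<in> strings_of_opens H. snd \<sigma> \<le> k}. 1 + (num_opens \<sigma> - 1) div 3)"

text \<open>The bounding vertices of a string are closed and so avoid the gap between a and k, and
  the closed vertex a cannot be one of its open vertices. So going from a to k brings in at most the
  string (a, k).\<close>

lemma string_before_closed:
  assumes "closed_vertex H a" "closed_vertex H k" "a < k" "\<forall>v\<in>{a<..<k}. \<not> closed_vertex H v"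
    and "\<sigma> \<in> strings_of_opens H" "snd \<sigma> \<le> k"
  shows "snd \<sigma> \<le> a \<or> \<sigma> = (a, k) \<and> a + 1 < k"
proof (cases "snd \<sigma> \<le> a")
  case False
  obtain x y where \<sigma>: "\<sigma> = (x, y)" by fastforce
  have xy: "closed_vertex H x" "closed_vertex H y" "x + 1 < y" "\<And>v. x < v \<Longrightarrow> v < y \<Longrightarrow> \<not> closed_vertex H v"
    using assms(5) by (auto simp: \<sigma> strings_of_opens_def)
  have "y \<notin> {a<..<k}" "x \<notin> {a<..<k}" using assms(4) xy(1,2) by auto
  then have y: "y = k" using False assms(6) by (auto simp: \<sigma>)
  moreover have "\<not> x < a" using xy(4)[of a] assms(1,3) y by blast
  then have "x = a" using \<open>x \<notin> {a<..<k}\<close> xy(3) y by simp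
  ultimately show ?thesis using \<sigma> xy by simp
qed simp

lemma disjoint_configurations_subset:
  "disjoint_configurations c c' \<Longrightarrow> set d \<subseteq> set c' \<Longrightarrow> disjoint_configurations c d"
  unfolding disjoint_configurations_def by blast

lemma disjoint_configurations_sym: "disjoint_configurations c c' \<Longrightarrow> disjoint_configurations c' c"
  unfolding disjoint_configurations_def by blast

lemma two_special_snd_le:
  assumes "two_special H c" "\<tau> \<in> set c"
  shows "snd \<tau> \<le> snd (last c)"
proof -
  obtain t \<sigma> where c: "c = t @ [\<sigma>]" "open_chain H (fst \<sigma>) t" "\<sigma> \<in> strings_of_opens H"
    using assms(1) two_special_iff by blast
  show ?thesis
    using assms(2) open_chain_properties[OF c(2)] string_fst_less_snd[OF c(3)] by (auto simp: c(1))
qed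

lemma disjoint_if_before:
  assumes "\<And>\<tau>. \<tau> \<in> set c \<Longrightarrow> snd \<tau> \<le> a"
  shows "disjoint_configurations c [(a, k)]"
  using assms by (fastforce simp: disjoint_configurations_def open_vertices_def)

lemma packing_upto_shrink:
  assumes "closed_vertex H a" "closed_vertex H k" "a < k" "\<forall>v\<in>{a<..<k}. \<not> closed_vertex H v"
    and "packing_upto H k C" "\<And>c. c \<in> C \<Longrightarrow> (a, k) \<notin> set c"
  shows "packing_upto H a C"
proof -
  have "snd (last c) \<le> a" if c: "c \<in> C" for c
  proof -
    have "two_special H c" "snd (last c) \<le> k" using assms(5) c by (auto simp: packing_upto_def)
    moreover from this have "last c \<in> set c" "last c \<in> strings_of_opens H"
      by (auto simp: two_special_iff)
    ultimately show ?thesis using string_before_closed[OF assms(1-4), of "last c"] assms(6)[OF c] by metis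
  qed
  then show ?thesis using assms(5) by (simp add: packing_upto_def)
qed

text \<open>Disjointness lets at most one configuration contain the string (a, k). As nothing in the
  packing extends beyond k, that string is its last one, and removing the configuration leaves a
  packing up to a that avoids the chain t.\<close>

lemma packing_upto_cases:
  assumes gap: "closed_vertex H a" "closed_vertex H k" "a < k" "\<forall>v\<in>{a<..<k}. \<not> closed_vertex H v"
    and C: "packing_upto H k C"
  obtains "packing_upto H a C"
  | t C' where "C = insert (t @ [(a, k)]) C'" "t @ [(a, k)] \<notin> C'" "packing_upto H a C'" "open_chain H a t"
      "\<forall>c\<in>C'. disjoint_configurations c t" "num_opens (a, k) mod 3 = 1"
proof (cases "\<exists>c\<in>C. (a, k) \<in> set c")
  case False
  then show ?thesis using that(1) packing_upto_shrink[OF gap C] by blast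
next
  case True
  then obtain c where c: "c \<in> C" "(a, k) \<in> set c" by blast
  have sp: "two_special H c" and le: "snd (last c) \<le> k" using C c(1) by (auto simp: packing_upto_def)
  obtain t \<sigma> where t: "c = t @ [\<sigma>]" "open_chain H (fst \<sigma>) t" "\<sigma> \<in> strings_of_opens H" "num_opens \<sigma> mod 3 = 1"
    using sp two_special_iff by blast
  have "k \<le> snd \<sigma>" using two_special_snd_le[OF sp c(2)] by (simp add: t(1))
  then have \<sigma>: "\<sigma> = (a, k)" using string_before_closed[OF gap t(3)] le gap(3) by (auto simp: t(1))
  let ?C = "C - {c}"
  have disj: "disjoint_configurations c' c" if "c' \<in> ?C" for c'
    using C c(1) that by (auto simp: packing_upto_def pairwise_def)
  have "(a, k) \<notin> set c'" if "c' \<in> ?C" for c'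
    using disj[OF that] c(2) open_vertices_nonempty[OF t(3)] \<sigma> unfolding disjoint_configurations_def by blast
  moreover have "packing_upto H k ?C" using C by (auto simp: packing_upto_def pairwise_def)
  ultimately have "packing_upto H a ?C" using packing_upto_shrink[OF gap] by blast
  moreover have "\<forall>c'\<in>?C. disjoint_configurations c' t"
    using disj disjoint_configurations_subset[of _ c t] by (auto simp: t(1))
  ultimately show ?thesis using that(2)[of t ?C] t c(1) \<sigma> by auto
qed

lemma open_chain_cases:
  assumes gap: "closed_vertex H a" "closed_vertex H k" "a < k" "\<forall>v\<in>{a<..<k}. \<not> closed_vertex H v"
    and t: "open_chain H k t"
  obtains "t = [(a, k)]" "num_opens (a, k) mod 3 = 1"
  | t' where "t = t' @ [(a, k)]" "open_chain H a t'" "num_opens (a, k) mod 3 = 2"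
  using t
proof cases
  case (start \<sigma>)
  then have "\<sigma> = (a, k)" using string_before_closed[OF gap, of \<sigma>] gap(3) by auto
  then show ?thesis using start that(1) by simp
next
  case (snoc \<sigma> t')
  have \<sigma>: "\<sigma> = (a, k)" using string_before_closed[OF gap, of \<sigma>] gap(3) snoc by auto
  show ?thesis using that(2)[of t'] snoc(2-) unfolding \<sigma> by simp
qed

lemma num_opens_pair: "num_opens (a, k) = k - a - 1"
  by (simp add: num_opens_def open_vertices_def)

lemma finite_packing:
  assumes "hypergraph \<mu> H" "packing_upto H k C"
  shows "finite C"
  using finite_subset[OF _ finite_two_special[OF assms(1)]] assms(2) by (auto simp: packing_upto_def)

text \<open>
  Here \<open>d = 1\<close> means that some maximal packing up to \<open>k\<close> leaves room for an open chain ending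
  at \<open>k\<close>.
\<close>

lemma string_pd_packing:
  assumes hyp: "hypergraph \<mu> H" and "closed_vertex H 1" and k: "closed_vertex H k"
  shows "\<exists>d N. d \<le> 1 \<and> string_pd (closed_vertex H) k + b_upto H k = k + N \<and>
    string_pd (closed_vertex H) (k - 1) + 1 = string_pd (closed_vertex H) k + d \<and>
    (\<forall>C. packing_upto H k C \<longrightarrow> card C \<le> N) \<and>
    (\<forall>C t. packing_upto H k C \<longrightarrow> open_chain H k t \<longrightarrow> (\<forall>c\<in>C. disjoint_configurations c t) \<longrightarrow> card C + 1 \<le> N + d) \<and>
    (\<exists>C. packing_upto H k C \<and> card C = N \<and>
      (d = 1 \<longrightarrow> (\<exists>t. open_chain H k t \<and> (\<forall>c\<in>C. disjoint_configurations c t))))"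
  using k
proof (induction k rule: less_induct)
  case (less k)
  let ?p = "string_pd (closed_vertex H)"
  have "\<Union>H = {1..\<mu>}" using hyp by (simp add: hypergraph_def)
  moreover have "{k} \<in> H" using less.prems by (simp add: closed_vertex_def)
  ultimately have k1: "1 \<le> k" by auto
  show ?case
  proof (cases "k = 1")
    \<comment> \<open>No string ends at vertex 1, so there are neither packings nor chains: N = 0
      and d = 0.\<close>
    case True
    have no: "\<not> snd \<sigma> \<le> 1" if "\<sigma> \<in> strings_of_opens H" for \<sigma>
      using strings_of_opens_bounds[OF hyp, of "fst \<sigma>" "snd \<sigma>"] that by simp
    have "card C = 0" if "packing_upto H 1 C" for C
    proof -
      have "C = {}" using that no by (fastforce simp: packing_upto_def two_special_iff)
      then show ?thesis by simp
    qed
    moreover have "\<not> open_chain H 1 t" for t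
      using open_chain_properties[of H 1 t] no by (metis last_in_set order_refl subsetD)
    moreover have "{\<sigma> \<in> strings_of_opens H. snd \<sigma> \<le> 1} = {}" using no by blast
    then have "b_upto H 1 = 0" unfolding b_upto_def by (metis sum.empty)
    moreover have "packing_upto H 1 {}" by (simp add: packing_upto_def)
    ultimately show ?thesis
      unfolding True by (intro exI[of _ 0]) auto
  next
    case False
    define a where "a = Max {v. closed_vertex H v \<and> v < k}"
    have fin: "finite {v. closed_vertex H v \<and> v < k}" by simp
    have "1 \<in> {v. closed_vertex H v \<and> v < k}" using assms(2) False k1 by simp
    then have "a \<in> {v. closed_vertex H v \<and> v < k}" and a1: "1 \<le> a"
      unfolding a_def using Max_in[OF fin] Max_ge[OF fin] by blast+
    then have a: "closed_vertex H a" "a < k" by auto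
    have between: "\<forall>v\<in>{a<..<k}. \<not> closed_vertex H v"
    proof (intro ballI notI)
      fix v assume v: "v \<in> {a<..<k}" "closed_vertex H v"
      then have "v \<le> a" unfolding a_def by (intro Max_ge[OF fin]) simp
      then show False using v(1) by simp
    qed
    note gap = a(1) less.prems a(2) between
    obtain d N where d: "d \<le> 1" and pN: "?p a + b_upto H a = a + N" and pd: "?p (a - 1) + 1 = ?p a + d"
      and bound: "\<And>C. packing_upto H a C \<Longrightarrow> card C \<le> N"
      and bound': "\<And>C t. packing_upto H a C \<Longrightarrow> open_chain H a t \<Longrightarrow>
        \<forall>c\<in>C. disjoint_configurations c t \<Longrightarrow> card C + 1 \<le> N + d"
      and ex: "\<exists>C. packing_upto H a C \<and> card C = N \<and>
        (d = 1 \<longrightarrow> (\<exists>t. open_chain H a t \<and> (\<forall>c\<in>C. disjoint_configurations c t)))"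
      using less.IH[OF a(2,1)] by blast
    obtain C0 where C0: "packing_upto H a C0" "card C0 = N"
      "d = 1 \<Longrightarrow> \<exists>t. open_chain H a t \<and> (\<forall>c\<in>C0. disjoint_configurations c t)" using ex by blast
    have mono: "packing_upto H k C" if "packing_upto H a C" for C
      using that a(2) by (auto simp: packing_upto_def)
    have strings: "\<sigma> \<in> {\<sigma> \<in> strings_of_opens H. snd \<sigma> \<le> k} \<longleftrightarrow>
        \<sigma> \<in> {\<sigma> \<in> strings_of_opens H. snd \<sigma> \<le> a} \<or> \<sigma> = (a, k) \<and> a + 1 < k" for \<sigma>
      using string_before_closed[OF gap, of \<sigma>] gap by (auto simp: strings_of_opens_def)
    note run = string_pd_run[where cl = "closed_vertex H" and \<delta> = d, OF a(1) a1 between pd d]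
    have before: "disjoint_configurations c [(a, k)]" if "two_special H c" "snd (last c) \<le> a" for c
      using disjoint_if_before two_special_snd_le[OF that(1)] that(2) by (meson order_trans)
    have before_t: "disjoint_configurations c (t @ [(a, k)])"
      if "two_special H c" "snd (last c) \<le> a" "disjoint_configurations c t" for c t
      using before[OF that(1,2)] that(3) by (auto simp: disjoint_configurations_def)
    have shrink: "packing_upto H a C" if "packing_upto H k C" "(a, k) \<in> set t" "(a, k) \<in> strings_of_opens H"
      "\<forall>c\<in>C. disjoint_configurations c t" for C t
    proof (rule packing_upto_shrink[OF gap that(1)])
      show "(a, k) \<notin> set c" if "c \<in> C" for c
        using that \<open>\<forall>c\<in>C. _\<close> \<open>(a, k) \<in> set t\<close> open_vertices_nonempty[OF \<open>(a, k) \<in> strings_of_opens H\<close>]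
        unfolding disjoint_configurations_def by blast
    qed
    show ?thesis
    proof (cases "k = a + 1")
      \<comment> \<open>Two adjacent closed vertices contribute no string. Every chain ending at a
        is cut off, so d drops to 0.\<close>
      case True
      have pk: "?p k = ?p a + 1" using True a(1) by simp
      have "{\<sigma> \<in> strings_of_opens H. snd \<sigma> \<le> k} = {\<sigma> \<in> strings_of_opens H. snd \<sigma> \<le> a}"
        using strings True by blast
      then have b: "b_upto H k = b_upto H a" by (simp add: b_upto_def)
      have n: "num_opens (a, k) = 0" using True by (simp add: num_opens_pair)
      have "card C \<le> N" if "packing_upto H k C" for C
        using that by (rule packing_upto_cases[OF gap]) (use bound n in auto)
      moreover have "\<not> open_chain H k t" for t
        using open_chain_cases[OF gap, of t] n by fastforce
      moreover have "?p k + b_upto H k = k + N" "?p (k - 1) + 1 = ?p k + 0"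
        unfolding pk b using pN True by (simp_all del: string_pd.simps)
      ultimately show ?thesis
        using C0(2) mono[OF C0(1)] by (intro exI[of _ 0] exI[of _ N]) auto
    next
      case False
      then have ak: "a + 1 < k" using a(2) by simp
      have S: "(a, k) \<in> strings_of_opens H"
        using strings[of "(a, k)"] ak by simp
      have "{\<sigma> \<in> strings_of_opens H. snd \<sigma> \<le> k} = insert (a, k) {\<sigma> \<in> strings_of_opens H. snd \<sigma> \<le> a}"
        using strings ak by blast
      then have b: "b_upto H k = b_upto H a + 1 + (num_opens (a, k) - 1) div 3"
        using finite_strings_of_opens[OF hyp] a(2) by (simp add: b_upto_def)
      have n0: "num_opens (a, k) \<noteq> 0" using ak by (simp add: num_opens_pair)
      \<comment> \<open>Residue 0 is written 3 i + 3 so that (n - 1) div 3 = i in all three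
        cases.\<close>
      consider (one) i where "num_opens (a, k) = 3 * i + 1" | (two) i where "num_opens (a, k) = 3 * i + 2"
        | (three) i where "num_opens (a, k) = 3 * i + 3"
        using n0 by atomize_elim presburger
      then show ?thesis
      proof cases
        \<comment> \<open>If d = 1, the new string completes a waiting chain: N grows by one and no
          chain is left over. If d = 0, it cannot complete anything without loss and starts a chain
          of its own.\<close>
        case one
        have n1: "num_opens (a, k) mod 3 = 1" unfolding one by presburger
        have ki: "k = a + 3 * i + 2" using one ak by (simp add: num_opens_pair)
        have "k - 1 = a + 3 * i + 1" using ki by simp
        note pk = run(2)[of i, folded ki, OF order_refl] and pk1 = run(1)[of i, folded this, OF diff_le_self]
        have b': "b_upto H k = b_upto H a + 1 + i" using b one by simp
        have A: "?p k + b_upto H k = k + (N + d)"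
          using pk b' pN pd ki by linarith
        have B: "?p (k - 1) + 1 = ?p k + (1 - d)"
          using pk pk1 pd d by linarith
        have c1: "card C \<le> N + d" if "packing_upto H k C" for C
          using that
        proof (rule packing_upto_cases[OF gap])
          show ?thesis if "packing_upto H a C" using bound[OF that] by simp
          show ?thesis if "C = insert (t @ [(a, k)]) C'" "t @ [(a, k)] \<notin> C'" "packing_upto H a C'"
            "open_chain H a t" "\<forall>c\<in>C'. disjoint_configurations c t" for t C'
            using bound'[OF that(3-5)] that(1,2) finite_packing[OF hyp that(3)] by simp
        qed
        \<comment> \<open>A chain ending at k can only be the single string (a, k). A packing
          avoiding it lives up to a and has at most N members.\<close>
        have c2: "card C + 1 \<le> N + d + (1 - d)"
          if C: "packing_upto H k C" and t: "open_chain H k t" and disj: "\<forall>c\<in>C. disjoint_configurations c t" for C t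
          using t
        proof (rule open_chain_cases[OF gap])
          assume "t = [(a, k)]"
          then have "packing_upto H a C" using shrink[OF C _ S disj] by simp
          then show ?thesis using bound d by fastforce
        qed (use n1 in auto)
        have c3: "\<exists>C. packing_upto H k C \<and> card C = N + d \<and>
            (1 - d = 1 \<longrightarrow> (\<exists>t. open_chain H k t \<and> (\<forall>c\<in>C. disjoint_configurations c t)))"
        proof (cases "d = 0")
          case True
          have "open_chain H k [(a, k)]" using open_chain.start[OF S n1] by simp
          moreover have "\<forall>c\<in>C0. disjoint_configurations c [(a, k)]"
            using C0(1) before by (auto simp: packing_upto_def)
          ultimately show ?thesis using C0(2) mono[OF C0(1)] True by auto
        next
          case False
          then have d1: "d = 1" using d by simp
          then obtain t where t: "open_chain H a t" "\<forall>c\<in>C0. disjoint_configurations c t" using C0(3) by blast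
          let ?c = "t @ [(a, k)]"
          have sp: "two_special H ?c" using two_special_iff S n1 t(1) by fastforce
          have disj: "disjoint_configurations c ?c" if "c \<in> C0" for c
            using before_t C0(1) t(2) that by (auto simp: packing_upto_def)
          have "?c \<notin> C0" using C0(1) a(2) by (auto simp: packing_upto_def)
          then have "card (insert ?c C0) = N + d" using finite_packing[OF hyp C0(1)] C0(2) d1 by simp
          moreover have "packing_upto H k (insert ?c C0)"
            using mono[OF C0(1)] sp disj disjoint_configurations_sym[OF disj]
            by (auto simp: packing_upto_def pairwise_insert)
          ultimately show ?thesis using d1 by auto
        qed
        show ?thesis
          by (intro exI[of _ "1 - d"] exI[of _ "N + d"] conjI allI impI A B c3 c1 c2) auto
      next
        \<comment> \<open>A string of residue 2 prolongs a chain ending at a but can neither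
          complete nor start one, so N and d persist.\<close>
        case two
        have n2: "num_opens (a, k) mod 3 = 2" unfolding two by presburger
        have ki: "k = a + 3 * i + 3" using two ak by (simp add: num_opens_pair)
        have "k - 1 = a + 3 * i + 2" using ki by simp
        note pk = run(3)[of i, folded ki, OF order_refl] and pk1 = run(2)[of i, folded this, OF diff_le_self]
        have b': "b_upto H k = b_upto H a + 1 + i" using b two by simp
        have A: "?p k + b_upto H k = k + N"
          using pk b' pN ki by linarith
        have B: "?p (k - 1) + 1 = ?p k + d"
          using pk pk1 pd by linarith
        have c1: "card C \<le> N" if "packing_upto H k C" for C
          using that by (rule packing_upto_cases[OF gap]) (use bound n2 in auto)
        have c2: "card C + 1 \<le> N + d"
          if C: "packing_upto H k C" and t: "open_chain H k t" and disj: "\<forall>c\<in>C. disjoint_configurations c t" for C t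
          using t
        proof (rule open_chain_cases[OF gap])
          fix t' assume t': "t = t' @ [(a, k)]" "open_chain H a t'"
          have "packing_upto H a C" using shrink[OF C _ S disj] t' by simp
          moreover have "\<forall>c\<in>C. disjoint_configurations c t'"
            using disj disjoint_configurations_subset[of _ t t'] t' by auto
          ultimately show ?thesis using bound' t'(2) by blast
        qed (use n2 in auto)
        have c3: "\<exists>C. packing_upto H k C \<and> card C = N \<and>
            (d = 1 \<longrightarrow> (\<exists>t. open_chain H k t \<and> (\<forall>c\<in>C. disjoint_configurations c t)))"
        proof (intro exI[of _ C0] conjI impI mono C0(1,2))
          assume "d = 1"
          then obtain t where t: "open_chain H a t" "\<forall>c\<in>C0. disjoint_configurations c t" using C0(3) by blast
          have "open_chain H k (t @ [(a, k)])" using open_chain.snoc[OF _ S n2] t(1) by simp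
          moreover have "\<forall>c\<in>C0. disjoint_configurations c (t @ [(a, k)])"
            using before_t C0(1) t(2) by (auto simp: packing_upto_def)
          ultimately show "\<exists>t. open_chain H k t \<and> (\<forall>c\<in>C0. disjoint_configurations c t)" by blast
        qed
        show ?thesis
          by (intro exI[of _ d] exI[of _ N] conjI allI impI d A B c3 c1 c2) auto
      next
        \<comment> \<open>Residue 0 occurs in no configuration. Every chain breaks here, and d
          becomes 0.\<close>
        case three
        have n3: "num_opens (a, k) mod 3 = 0" unfolding three by presburger
        have ki: "k = a + 3 * Suc i + 1" using three ak by (simp add: num_opens_pair)
        have "k - 1 = a + 3 * i + 3" using ki by simp
        note pk = run(1)[of "Suc i", folded ki, OF order_refl] and pk1 = run(3)[of i, folded this, OF diff_le_self]
        have b': "b_upto H k = b_upto H a + 1 + i" using b three by simp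
        have A: "?p k + b_upto H k = k + N"
          using pk b' pN ki unfolding mult_Suc_right by linarith
        have B: "?p (k - 1) + 1 = ?p k + 0"
          using pk pk1 unfolding mult_Suc_right by linarith
        have c1: "card C \<le> N" if "packing_upto H k C" for C
          using that by (rule packing_upto_cases[OF gap]) (use bound n3 in auto)
        have c2: "\<not> open_chain H k t" for t
          using open_chain_cases[OF gap, of t] n3 by fastforce
        show ?thesis
          using A B c1 c2 C0(2) mono[OF C0(1)] by (intro exI[of _ 0] exI[of _ N]) auto
      qed
    qed
  qed
qed

lemma string_pd_eq:
  assumes hyp: "hypergraph \<mu> H" and "closed_vertex H 1" "closed_vertex H \<mu>"
  shows "string_pd (closed_vertex H) \<mu> = \<mu> - b_inv H + modularity H"
proof -
  obtain N where N: "string_pd (closed_vertex H) \<mu> + b_upto H \<mu> = \<mu> + N"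
    "\<And>C. packing_upto H \<mu> C \<Longrightarrow> card C \<le> N" "\<exists>C. packing_upto H \<mu> C \<and> card C = N"
    using string_pd_packing[OF assms] by blast
  then obtain C0 where C0: "packing_upto H \<mu> C0" "card C0 = N" by blast
  have le: "snd \<sigma> \<le> \<mu>" if "\<sigma> \<in> strings_of_opens H" for \<sigma>
    using strings_of_opens_bounds(3)[OF hyp, of "fst \<sigma>" "snd \<sigma>"] that by simp
  then have "{\<sigma> \<in> strings_of_opens H. snd \<sigma> \<le> \<mu>} = strings_of_opens H" by blast
  then have b: "b_upto H \<mu> = b_inv H" unfolding b_upto_def b_inv_def sum.distrib by simp
  have "packing_upto H \<mu> C \<longleftrightarrow> C \<subseteq> {c. two_special H c} \<and> pairwise disjoint_configurations C" for C
    using le by (auto simp: packing_upto_def two_special_iff)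
  then have "modularity H = Max {card C | C. packing_upto H \<mu> C}" by (simp add: modularity_def)
  also have "\<dots> = N"
  proof (rule Max_eqI)
    show "finite {card C | C. packing_upto H \<mu> C}"
      using N(2)[folded atMost_iff] by (intro finite_subset[OF _ finite_atMost[of N]]) blast
    show "n \<le> N" if "n \<in> {card C | C. packing_upto H \<mu> C}" for n using N(2) that by blast
    show "N \<in> {card C | C. packing_upto H \<mu> C}" 
      using C0 by (intro CollectI exI[of _ C0]) simp
  qed
  \<comment> \<open>\<open>b_inv_le\<close> ensures that the subtraction of natural numbers is not
    truncated.\<close>
  finally show ?thesis using N(1) b b_inv_le[OF hyp] by simp
qed

section \<open>Projective dimension of string hypergraphs\<close>

lemma string_hypergraph_face:
  assumes "string_hypergraph \<mu> H" "F \<in> H"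
  shows "(\<exists>i. F = {i, i + 1} \<and> 1 \<le> i \<and> i < \<mu>) \<or> (\<exists>v. F = {v})"
  using assms by (auto simp: string_hypergraph_def)

text \<open>A face that contains an endpoint but not its neighbour must be a singleton.
  Separatedness supplies such a face, except when there is a single vertex; then any face covering
  it will do.\<close>

lemma string_hypergraph_endpoints:
  assumes "string_hypergraph \<mu> H"
  shows "closed_vertex H 1" "closed_vertex H \<mu>"
proof -
  have \<mu>: "1 \<le> \<mu>" and U: "\<Union>H = {1..\<mu>}" and sep: "separated \<mu> H"
    using assms by (auto simp: string_hypergraph_def hypergraph_def)
  have "\<exists>F\<in>H. 1 \<in> F \<and> 2 \<notin> F"
  proof (cases "\<mu> = 1")
    case True
    then have "1 \<in> \<Union>H" "2 \<notin> \<Union>H" using U by auto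
    then show ?thesis by blast
  next
    case False
    then show ?thesis using sep[unfolded separated_def, rule_format, of 1 2] \<mu> by auto
  qed
  then obtain F where F: "F \<in> H" "1 \<in> F" "2 \<notin> F" by blast
  then have "F = {1}" using string_hypergraph_face[OF assms F(1)] by (auto simp: numeral_2_eq_2)
  then show "closed_vertex H 1" using F by (simp add: closed_vertex_def)
  have "\<exists>F\<in>H. \<mu> \<in> F \<and> \<mu> - 1 \<notin> F"
  proof (cases "\<mu> = 1")
    case True
    then have "1 \<in> \<Union>H" "0 \<notin> \<Union>H" using U by auto
    then show ?thesis using True by auto
  next
    case False
    then have "1 \<le> \<mu> - 1 \<and> \<mu> - 1 < \<mu> \<and> \<mu> \<le> \<mu>" using \<mu> by auto
    from sep[unfolded separated_def, rule_format, OF this] show ?thesis by blast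
  qed
  then obtain F where F: "F \<in> H" "\<mu> \<in> F" "\<mu> - 1 \<notin> F" by blast
  then have "F = {\<mu>}" using string_hypergraph_face[OF assms F(1)] by auto
  then show "closed_vertex H \<mu>" using F by (simp add: closed_vertex_def)
qed

theorem theorem3p4:
  fixes \<mu> :: nat and H :: "nat set set"
    and X :: "'v set" and m :: "nat \<Rightarrow> 'v \<Rightarrow>\<^sub>0 nat"
    and I :: "(('v \<Rightarrow>\<^sub>0 nat) \<Rightarrow>\<^sub>0 'k::field) set"
  assumes "string_hypergraph \<mu> H"
    and "finite X"
    and "squarefree_minimal_generators X I \<mu> m"
    and "associated_hypergraph X \<mu> m = H"
  shows "proj_dim (poly_ring X) (quotient_module (poly_ring X) I) = enat (\<mu> - b_inv H + modularity H)"
proof -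
  \<comment> \<open>Supports are taken to be empty outside the vertex range. Thus \<open>M 0\<close>
    is a harmless left neighbour of vertex 1, and the face of a variable is {j. a \<in> M j} without
    a range condition.\<close>
  define M where "M = (\<lambda>i. if i \<in> {1..\<mu>} then Poly_Mapping.keys (m i) else {})"
  have gens: "Poly_Mapping.keys (m j) \<subseteq> X" "squarefree_monomial (m j)" if "j \<in> {1..\<mu>}" for j
    using assms(3) that by (auto simp: squarefree_minimal_generators_def)
  have I: "I = Idl\<^bsub>poly_ring X\<^esub> ((\<lambda>j. monomial (m j)) ` {1..\<mu>})"
    using assms(3) by (simp add: squarefree_minimal_generators_def)
  have M: "finite (M i)" "M i \<subseteq> X" for i using gens by (auto simp: M_def)
  have faces: "F \<in> H \<longleftrightarrow> F \<noteq> {} \<and> (\<exists>a\<in>X. F = {j. a \<in> M j})" for F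
  proof -
    have "{j. a \<in> M j} = {j \<in> {1..\<mu>}. a \<in> Poly_Mapping.keys (m j)}" for a
      by (auto simp: M_def split: if_splits)
    then show ?thesis unfolding assms(4)[symmetric] associated_hypergraph_def by simp
  qed
  have face: "(\<exists>l. {j. a \<in> M j} = {l, l + 1} \<and> 1 \<le> l \<and> l < \<mu>) \<or> {j. a \<in> M j} = {i}" if "a \<in> M i" for a i
  proof -
    have "{j. a \<in> M j} \<in> H" unfolding faces using that M(2) by blast
    moreover have "i \<in> {j. a \<in> M j}" using that by simp
    ultimately show ?thesis using string_hypergraph_face[OF assms(1)] by (metis singletonD)
  qed
  have closed: "closed_vertex H i \<longleftrightarrow> (\<exists>a. {j. a \<in> M j} = {i})" for i
    unfolding closed_vertex_def faces using M(2) by blast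
  note ends = string_hypergraph_endpoints[OF assms(1)]
  have "minimally_resolved X (squarefree_ideal X (M ` {1..\<mu>}) :: (('v \<Rightarrow>\<^sub>0 nat) \<Rightarrow>\<^sub>0 'k) set)
      (string_pd (closed_vertex H) \<mu>)"
  proof (rule minimally_resolved_string[OF M])
    show "M 0 = {}" by (simp add: M_def)
    show "M i \<inter> M j = {}" if "i + 2 \<le> j" for i j
    proof (rule ccontr)
      assume "M i \<inter> M j \<noteq> {}"
      then obtain a where a: "a \<in> M i" "a \<in> M j" by blast
      from face[OF a(1)] consider l where "{j. a \<in> M j} = {l, l + 1}" | "{j. a \<in> M j} = {i}" by blast
      then show False
      proof cases
        case (1 l)
        then have "i \<in> {l, l + 1}" "j \<in> {l, l + 1}" using a by blast+
        then show False using that by auto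
      next
        case 2
        then have "j = i" using a by blast
        then show False using that by simp
      qed
    qed
    show "M i \<inter> M (Suc i) \<noteq> {}" if "1 \<le> i" "i < \<mu>" for i
    proof -
      have "{i, i + 1} \<in> H" using assms(1) that by (auto simp: string_hypergraph_def)
      then obtain a where "{i, i + 1} = {j. a \<in> M j}" unfolding faces by blast
      then have "a \<in> M i" "a \<in> M (i + 1)" by blast+
      then show ?thesis by auto
    qed
    show "closed_vertex H i \<longleftrightarrow> \<not> M i \<subseteq> M (i - 1) \<union> M (Suc i)" if "1 \<le> i" "i < \<mu>" for i
    proof
      assume "closed_vertex H i"
      then obtain a where a: "{j. a \<in> M j} = {i}" unfolding closed by blast
      then have "a \<in> M j \<longleftrightarrow> j = i" for j by blast
      then have "a \<in> M i" "a \<notin> M (i - 1)" "a \<notin> M (Suc i)" using that by simp_all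
      then show "\<not> M i \<subseteq> M (i - 1) \<union> M (Suc i)" by blast
    next
      assume "\<not> M i \<subseteq> M (i - 1) \<union> M (Suc i)"
      then obtain a where a: "a \<in> M i" "a \<notin> M (i - 1)" "a \<notin> M (Suc i)" by blast
      \<comment> \<open>An edge through i would contain \<open>i - 1\<close> or
        \<open>Suc i\<close>, where the variable does not occur. So its face is the singleton of
        i.\<close>
      have "{j. a \<in> M j} \<noteq> {l, l + 1}" for l
      proof
        assume eq: "{j. a \<in> M j} = {l, l + 1}"
        then have "i \<in> {l, l + 1}" "a \<in> M l" "a \<in> M (l + 1)" using a(1) by blast+
        then show False using a by auto
      qed
      then show "closed_vertex H i" using face[OF a(1)] unfolding closed by blast
    qed
    show "closed_vertex H 1" by (rule ends)
    show "\<not> M \<mu> \<subseteq> M (\<mu> - 1)" if "1 \<le> \<mu>"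
    proof -
      obtain a where a: "{j. a \<in> M j} = {\<mu>}" using ends(2) unfolding closed by blast
      then have "a \<in> M j \<longleftrightarrow> j = \<mu>" for j by blast
      then have "a \<in> M \<mu>" "a \<notin> M (\<mu> - 1)" using that by simp_all
      then show ?thesis by blast
    qed
  qed
  moreover have "squarefree_ideal X (M ` {1..\<mu>}) = I"
  proof -
    \<comment> \<open>This is where square-freeness enters: such a monomial is determined by its
      support.\<close>
    have "monomial (m j) = Poly_Mapping.single (set_exponent (M j)) 1" if "j \<in> {1..\<mu>}" for j
      using that gens(2)[OF that] set_exponent_keys[of "m j"] by (simp add: monomial_def M_def)
    then have "(\<lambda>j. monomial (m j)) ` {1..\<mu>} =
        (\<lambda>N. Poly_Mapping.single (set_exponent N) (1 :: 'k)) ` M ` {1..\<mu>}"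
      unfolding image_image by (intro image_cong refl)
    then show ?thesis
      unfolding I using squarefree_ideal_eq_genideal[of "M ` {1..\<mu>}" X] M by auto
  qed
  ultimately obtain B d where
    "minimal_resolution X I (B :: nat \<Rightarrow> ((('v \<Rightarrow>\<^sub>0 nat) \<Rightarrow>\<^sub>0 'k) set \<times> nat) set) d (string_pd (closed_vertex H) \<mu>)"
    unfolding minimally_resolved_def by auto
  moreover have "ideal I (poly_ring X)"
    unfolding \<open>squarefree_ideal X (M ` {1..\<mu>}) = I\<close>[symmetric] by (rule ideal_squarefree_ideal)
  ultimately have "proj_dim (poly_ring X) (quotient_module (poly_ring X) I) = enat (string_pd (closed_vertex H) \<mu>)"
    by (intro proj_dim_eq_minimal_resolution_length)
  moreover have "hypergraph \<mu> H" using assms(1) by (simp add: string_hypergraph_def)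
  ultimately show ?thesis using string_pd_eq ends by simp
qed

end
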